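(* Let $W_0$ be a finite Coxeter group with longest element $w_0$, and let $\sigma$ be a length-preserving group automorphism of $W_0$. Let $\mathcal O=\{xw_0\sigma(x)^{-1};\ x\in W_0\}$ be the $\sigma$-conjugacy class of $w_0$. Then $$\ell(w_0)-2\max\{\ell(x);\ x\in W_0,\ x\le\sigma(x)w_0\}=\ell_R(\mathcal O).$$ Moreover, if $W_0$ is a finite Weyl group, i.e. the Weyl group of a finite reduced crystallographic root system $\Phi$ with a chosen set of positive roots defining the simple reflections of $W_0$, then also $$\ell_R(\mathcal O)=\min\{d_\Gamma(x,\sigma(x)w_0);\ x\in W_0\}.$$
   Context: $\ell$ is the Coxeter length function and $\le$ the Bruhat order on $W_0$. A reflection is a conjugate of a simple reflection. For $w\in W_0$, the reflection length $\ell_R(w)$ is the smallest $l$ such that $w$ is a product of $l$ reflections; for a subset $C\subset W_0$, $\ell_R(C)=\min\{\ell_R(w);\ w\in C\}$. Quantum Bruhat graph (for $W_0$ the Weyl group of $\Phi$ with positive roots $\Phi^+$ and $\rho$ the half-sum of positive roots): $\Gamma_\Phi$ is the directed graph with vertex set $W_0$ and with an edge $w\to ws_\alpha$ for $w\in W_0$, $\alpha\in\Phi^+$ whenever either $\ell(ws_\alpha)=\ell(w)+1$ (upward edge) or $\ell(ws_\alpha)=\ell(w)-\langle\alpha^\vee,2\rho\rangle+1$ (downward edge). For $x,y\in W_0$, $d_\Gamma(x,y)$ is the minimal length (number of edges) of a directed path in $\Gamma_\Phi$ from $x$ to $y$; such a path always exists. *)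

theory Defs
  imports "HOL-Algebra.Algebra" "HOL-Analysis.Analysis"
begin

section \<open>Coxeter groups\<close>

text \<open>
  The presentation of a Coxeter group by generators \<open>S\<close> and relations \<open>(s t)^m(s,t) = 1\<close>, with
  \<open>m(s,t)\<close> the order of \<open>s t\<close>, is expressed by rewriting of words over \<open>S\<close>. For \<open>s = t\<close> the rule
  deletes \<open>[s, s]\<close>, so generators are their own inverses and words over \<open>S\<close> (without formal
  inverses) suffice. If \<open>s t\<close> has infinite order, \<open>group.ord\<close> is 0 and the rule is void, as it
  should be.
\<close>

inductive coxeter_step :: "('a, 'b) monoid_scheme \<Rightarrow> 'a set \<Rightarrow> 'a list \<Rightarrow> 'a list \<Rightarrow> bool"
  for G (structure) and S where
  "\<lbrakk>s \<in> S; t \<in> S; u \<in> lists S; v \<in> lists S\<rbrakk> \<Longrightarrow>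
     coxeter_step G S (u @ concat (replicate (group.ord G (s \<otimes> t)) [s, t]) @ v) (u @ v)"

definition word_prod :: "('a, 'b) monoid_scheme \<Rightarrow> 'a list \<Rightarrow> 'a" where
  "word_prod G ws = foldr (\<otimes>\<^bsub>G\<^esub>) ws \<one>\<^bsub>G\<^esub>"

locale coxeter_system = group G for G (structure) +
  fixes S
  assumes generators_closed: "S \<subseteq> carrier G"
    and generators_order: "s \<in> S \<Longrightarrow> ord s = 2"
    and generates: "generate G S = carrier G"
    and presentation: "\<lbrakk>u \<in> lists S; v \<in> lists S; word_prod G u = word_prod G v\<rbrakk> \<Longrightarrow>
           equivclp (coxeter_step G S) u v"

definition word_length :: "('a, 'b) monoid_scheme \<Rightarrow> 'a set \<Rightarrow> 'a \<Rightarrow> nat" where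
  "word_length G A w = (LEAST n. \<exists>ws \<in> lists A. length ws = n \<and> word_prod G ws = w)"

abbreviation cox_length :: "('a, 'b) monoid_scheme \<Rightarrow> 'a set \<Rightarrow> 'a \<Rightarrow> nat" where
  "cox_length G S \<equiv> word_length G S"

definition reflections :: "('a, 'b) monoid_scheme \<Rightarrow> 'a set \<Rightarrow> 'a set" where
  "reflections G S = {x \<otimes>\<^bsub>G\<^esub> s \<otimes>\<^bsub>G\<^esub> inv\<^bsub>G\<^esub> x | x s. x \<in> carrier G \<and> s \<in> S}"

definition refl_length :: "('a, 'b) monoid_scheme \<Rightarrow> 'a set \<Rightarrow> 'a \<Rightarrow> nat" where
  "refl_length G S = word_length G (reflections G S)"

definition set_refl_length :: "('a, 'b) monoid_scheme \<Rightarrow> 'a set \<Rightarrow> 'a set \<Rightarrow> nat" where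
  "set_refl_length G S C = Min (refl_length G S ` C)"

definition bruhat_step :: "('a, 'b) monoid_scheme \<Rightarrow> 'a set \<Rightarrow> 'a \<Rightarrow> 'a \<Rightarrow> bool" where
  "bruhat_step G S x y \<longleftrightarrow> x \<in> carrier G \<and> (\<exists>t \<in> reflections G S. y = x \<otimes>\<^bsub>G\<^esub> t) \<and>
     cox_length G S x < cox_length G S y"

definition bruhat_le :: "('a, 'b) monoid_scheme \<Rightarrow> 'a set \<Rightarrow> 'a \<Rightarrow> 'a \<Rightarrow> bool" where
  "bruhat_le G S = (bruhat_step G S)\<^sup>*\<^sup>*"

definition longest_element :: "('a, 'b) monoid_scheme \<Rightarrow> 'a set \<Rightarrow> 'a \<Rightarrow> bool" where
  "longest_element G S w \<longleftrightarrow> w \<in> carrier G \<and>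
     (\<forall>x \<in> carrier G. cox_length G S x \<le> cox_length G S w)"

definition length_preserving_aut ::
    "('a, 'b) monoid_scheme \<Rightarrow> 'a set \<Rightarrow> ('a \<Rightarrow> 'a) \<Rightarrow> bool" where
  "length_preserving_aut G S \<sigma> \<longleftrightarrow> \<sigma> \<in> iso G G \<and>
     (\<forall>x \<in> carrier G. cox_length G S (\<sigma> x) = cox_length G S x)"

definition twisted_class :: "('a, 'b) monoid_scheme \<Rightarrow> ('a \<Rightarrow> 'a) \<Rightarrow> 'a \<Rightarrow> 'a set" where
  "twisted_class G \<sigma> w = {x \<otimes>\<^bsub>G\<^esub> w \<otimes>\<^bsub>G\<^esub> inv\<^bsub>G\<^esub> (\<sigma> x) | x. x \<in> carrier G}"


section \<open>Root systems and Weyl groups\<close>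

text \<open>
  The coroot of \<open>\<alpha>\<close> is identified, through the inner product, with the vector
  \<open>2 \<alpha> / (\<alpha> \<bullet> \<alpha>)\<close>; the pairing of a coroot with a vector is then the inner product.
\<close>

definition coroot :: "'v::real_inner \<Rightarrow> 'v" where
  "coroot \<alpha> = (2 / (\<alpha> \<bullet> \<alpha>)) *\<^sub>R \<alpha>"

definition root_reflection :: "'v::real_inner \<Rightarrow> 'v \<Rightarrow> 'v" where
  "root_reflection \<alpha> v = v - (coroot \<alpha> \<bullet> v) *\<^sub>R \<alpha>"

text \<open>
  The roots are not required to span the ambient Euclidean space; \<open>\<Phi>\<close> is a root system in its span,
  and the case of no roots is included.
\<close>

definition reduced_root_system :: "'v::euclidean_space set \<Rightarrow> bool" where
  "reduced_root_system \<Phi> \<longleftrightarrow>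
     finite \<Phi> \<and> 0 \<notin> \<Phi> \<and>
     (\<forall>\<alpha> \<in> \<Phi>. root_reflection \<alpha> ` \<Phi> \<subseteq> \<Phi>) \<and>
     (\<forall>\<alpha> \<in> \<Phi>. \<forall>\<beta> \<in> \<Phi>. coroot \<alpha> \<bullet> \<beta> \<in> \<int>) \<and>
     (\<forall>\<alpha> \<in> \<Phi>. \<forall>c::real. c *\<^sub>R \<alpha> \<in> \<Phi> \<longrightarrow> c = 1 \<or> c = - 1)"

definition positive_roots :: "'v::euclidean_space set \<Rightarrow> 'v set \<Rightarrow> bool" where
  "positive_roots \<Phi> P \<longleftrightarrow>
     (\<exists>v. (\<forall>\<alpha> \<in> \<Phi>. v \<bullet> \<alpha> \<noteq> 0) \<and> P = {\<alpha> \<in> \<Phi>. v \<bullet> \<alpha> > 0})"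

definition simple_roots :: "'v::euclidean_space set \<Rightarrow> 'v set" where
  "simple_roots P = {\<alpha> \<in> P. \<not> (\<exists>\<beta> \<in> P. \<exists>\<gamma> \<in> P. \<alpha> = \<beta> + \<gamma>)}"

definition half_sum :: "'v::euclidean_space set \<Rightarrow> 'v" where
  "half_sum P = (1 / 2) *\<^sub>R (\<Sum>\<alpha>\<in>P. \<alpha>)"

text \<open>Multiplication in \<^term>\<open>BijGroup UNIV\<close> is composition of functions.\<close>

definition weyl_group :: "'v::euclidean_space set \<Rightarrow> ('v \<Rightarrow> 'v) monoid" where
  "weyl_group \<Phi> = subgroup_generated (BijGroup UNIV) (root_reflection ` \<Phi>)"

definition simple_reflections :: "'v::euclidean_space set \<Rightarrow> ('v \<Rightarrow> 'v) set" where
  "simple_reflections P = root_reflection ` simple_roots P"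

text \<open>The Coxeter group \<open>G\<close> with simple reflections \<open>S\<close> is identified, by means of \<open>\<phi>\<close>, with the Weyl
  group of \<open>\<Phi>\<close> with the simple reflections defined by \<open>P\<close>.\<close>

definition weyl_identification ::
    "('a, 'b) monoid_scheme \<Rightarrow> 'a set \<Rightarrow> 'v::euclidean_space set \<Rightarrow> 'v set \<Rightarrow> ('a \<Rightarrow> 'v \<Rightarrow> 'v) \<Rightarrow> bool"
where
  "weyl_identification G S \<Phi> P \<phi> \<longleftrightarrow>
     reduced_root_system \<Phi> \<and> positive_roots \<Phi> P \<and>
     \<phi> \<in> iso G (weyl_group \<Phi>) \<and> \<phi> ` S = simple_reflections P"


section \<open>The quantum Bruhat graph\<close>

definition quantum_edge ::
    "'v::euclidean_space set \<Rightarrow> 'v set \<Rightarrow> ('v \<Rightarrow> 'v) \<Rightarrow> ('v \<Rightarrow> 'v) \<Rightarrow> bool" where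
  "quantum_edge \<Phi> P w w' \<longleftrightarrow> w \<in> carrier (weyl_group \<Phi>) \<and>
     (\<exists>\<alpha> \<in> P. w' = w \<otimes>\<^bsub>weyl_group \<Phi>\<^esub> root_reflection \<alpha> \<and>
        (let len = (\<lambda>u. real (cox_length (weyl_group \<Phi>) (simple_reflections P) u)) in
           len w' = len w + 1 \<or>
           len w' = len w - coroot \<alpha> \<bullet> (2 *\<^sub>R half_sum P) + 1))"

definition quantum_dist ::
    "'v::euclidean_space set \<Rightarrow> 'v set \<Rightarrow> ('v \<Rightarrow> 'v) \<Rightarrow> ('v \<Rightarrow> 'v) \<Rightarrow> nat" where
  "quantum_dist \<Phi> P x y = (LEAST n. (quantum_edge \<Phi> P ^^ n) x y)"

end

theory Submission
  imports Defs "HOL-Library.Function_Algebras"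
begin

text \<open>
  Put \<open>\<tau> x = w\<^sub>0 (\<sigma> x) w\<^sub>0\<close>, so that \<open>(\<sigma> x) w\<^sub>0 = w\<^sub>0 (\<tau> x)\<close>, and let \<open>\<tau>\<close> also act on the geometric
  representation by permuting the simple roots. Let \<open>f h\<close> be the dimension of the fixed space of
  \<open>h \<tau>\<close>. Then \<open>f (z h (\<tau> z)\<^sup>-\<^sup>1) = f h\<close>, multiplying \<open>h\<close> by a reflection changes \<open>f h\<close> by at most
  1, and \<open>x w\<^sub>0 (\<sigma> x)\<^sup>-\<^sup>1 = x (\<tau> x)\<^sup>-\<^sup>1 w\<^sub>0\<close>; hence every element of the class of \<open>w\<^sub>0\<close> has reflection
  length at least \<open>f 1 - f w\<^sub>0\<close>. Conversely a chain in Bruhat order from \<open>x\<close> to \<open>(\<sigma> x) w\<^sub>0\<close> has at most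
  \<open>\<ell> w\<^sub>0 - 2 (\<ell> x)\<close> steps and writes \<open>x w\<^sub>0 (\<sigma> x)\<^sup>-\<^sup>1\<close>, up to conjugation and inversion, as a product
  of as many reflections. It remains to find \<open>x\<close> and a chain of \<open>k \<le> f 1 - f w\<^sub>0\<close> covers from \<open>x\<close> to
  \<open>w\<^sub>0 (\<tau> x)\<close>.

  This is done by induction over the \<open>\<tau>\<close>-stable parabolic subgroups, with longest elements \<open>w\<close>. For a
  simple root \<open>\<alpha>\<close> of such a subgroup, with reflection \<open>s\<close>, either \<open>w \<tau>\<close> fixes a nonzero vector in the
  span of the simple roots of the subgroup, or all its fixed vectors are orthogonal to \<open>\<alpha>\<close> and \<open>s w \<tau>\<close>
  fixes a vector that is not. Moving this vector into the dominant chamber by a shortest \<open>z\<close> turns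
  \<open>w \<tau>\<close>, or \<open>s w \<tau>\<close>, into \<open>w' \<tau>\<close> with \<open>w'\<close> the longest element of the stabilizer, a smaller parabolic
  subgroup. In the second case the dimension of the fixed space grows by 1 and the chain gains the
  cover given by \<open>s\<close>.

  In the quantum Bruhat graph, covers are upward edges, and each edge is multiplication by a
  reflection, so the same two bounds apply.
\<close>

section \<open>Words and length\<close>

text \<open>The geometric representation is realized on functions from the carrier type to the
  reals; as a real vector space they have \<open>linear\<close>, \<open>span\<close> and
  \<open>dim\<close> at hand.\<close>

instantiation "fun" :: (type, real_vector) real_vector
begin

definition scaleR_fun_def: "c *\<^sub>R f = (\<lambda>x. c *\<^sub>R f x)"

instance
  by standard (simp_all add: fun_eq_iff scaleR_fun_def algebra_simps)

end

lemma scaleR_fun_apply [simp]: "(c *\<^sub>R f) x = c *\<^sub>R f x"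
  by (simp add: scaleR_fun_def)

lemma sum_fun_apply: "(\<Sum>i\<in>A. f i) x = (\<Sum>i\<in>A. f i x)"
  by (induction A rule: infinite_finite_induct) auto

text \<open>This carries a quantity that no relator changes to all words with the same product. It
  is applied to the parity of the length and to the action on vectors.\<close>

lemma equivclp_invariant:
  assumes "equivclp R x y" and "\<And>x y. R x y \<Longrightarrow> f x = f y"
  shows "f x = f y"
  using assms(1) unfolding equivclp_def
  by (induction rule: rtranclp_induct) (auto simp: symclp_def dest: assms(2))

lemma word_prod_Nil [simp]: "word_prod G [] = \<one>\<^bsub>G\<^esub>"
  and word_prod_Cons [simp]: "word_prod G (x # ws) = x \<otimes>\<^bsub>G\<^esub> word_prod G ws"
  by (simp_all add: word_prod_def)

lemma word_length_le: "ws \<in> lists A \<Longrightarrow> word_length G A (word_prod G ws) \<le> length ws"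
  unfolding word_length_def by (rule Least_le) blast

lemma reduced_word:
  assumes "ws \<in> lists A" "word_prod G ws = x"
  obtains us where "us \<in> lists A" "length us = word_length G A x" "word_prod G us = x"
proof -
  have "\<exists>us\<in>lists A. length us = word_length G A x \<and> word_prod G us = x"
    unfolding word_length_def by (rule LeastI_ex) (use assms in blast)
  then show ?thesis using that by blast
qed

context group
begin

lemma word_prod_closed [simp]: "ws \<in> lists (carrier G) \<Longrightarrow> word_prod G ws \<in> carrier G"
  by (induction ws) auto

lemma word_prod_append:
  "us \<in> lists (carrier G) \<Longrightarrow> vs \<in> lists (carrier G) \<Longrightarrow>
    word_prod G (us @ vs) = word_prod G us \<otimes> word_prod G vs"
  by (induction us) (auto simp: m_assoc)

end

text \<open>The last letter is the second argument whatever the length, so the first letter to act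
  on a vector is known; parity governs only the leading letter.\<close>

fun alternating :: "'a \<Rightarrow> 'a \<Rightarrow> nat \<Rightarrow> 'a list" where
  "alternating s t 0 = []"
| "alternating s t (Suc n) = alternating t s n @ [t]"

lemma length_alternating [simp]: "length (alternating s t n) = n"
  by (induction s t n rule: alternating.induct) auto

lemma set_alternating: "set (alternating s t n) \<subseteq> {s, t}"
  by (induction s t n rule: alternating.induct) auto

lemma alternating_in_lists: "s \<in> A \<Longrightarrow> t \<in> A \<Longrightarrow> alternating s t n \<in> lists A"
  using set_alternating[of s t n] by auto

lemma alternating_Cons:
  "alternating s t (Suc n) = (if even n then t else s) # alternating s t n"
  by (induction s t n rule: alternating.induct) auto

lemma alternating_add:
  "alternating s t (i + n) = (if even n then alternating s t i else alternating t s i) @ alternating s t n"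
  by (induction i) (auto simp: alternating_Cons simp del: alternating.simps(2) split: if_splits)

lemma rev_alternating:
  "rev (alternating s t n) = (if even n then alternating t s n else alternating s t n)"
proof (induction s t n rule: alternating.induct)
  case (2 s t n)
  have "rev (alternating s t (Suc n)) = t # rev (alternating t s n)" by simp
  then show ?case using 2 alternating_Cons[of s t n] alternating_Cons[of t s n]
    by (auto simp del: alternating.simps(2))
qed simp

lemma alternating_even: "alternating s t (2 * n) = concat (replicate n [s, t])"
proof (induction n)
  case (Suc n)
  then show ?case using alternating_Cons[of s t "Suc (2*n)"] alternating_Cons[of s t "2*n"]
    by (simp del: alternating.simps(2))
qed simp

section \<open>The length function of a Coxeter system\<close>

context coxeter_system
begin

abbreviation len :: "'a \<Rightarrow> nat" where "len \<equiv> cox_length G S"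

lemma simple_closed [simp]: "s \<in> S \<Longrightarrow> s \<in> carrier G"
  using generators_closed by auto

lemma lists_simple_closed: "ws \<in> lists S \<Longrightarrow> ws \<in> lists (carrier G)"
  using generators_closed by auto

lemma simple_square [simp]: "s \<in> S \<Longrightarrow> s \<otimes> s = \<one>"
  using pow_ord_eq_1[of s] generators_order[of s] by (simp add: numeral_2_eq_2)

lemma simple_inv [simp]: "s \<in> S \<Longrightarrow> inv s = s"
  by (simp add: inv_equality)

lemma simple_not_one: "s \<in> S \<Longrightarrow> s \<noteq> \<one>"
  using generators_order ord_id by force

lemma simple_cancel: "s \<in> S \<Longrightarrow> x \<in> carrier G \<Longrightarrow> x \<otimes> s \<otimes> s = x"
  by (simp add: m_assoc)

lemma simple_cancel_left: "s \<in> S \<Longrightarrow> x \<in> carrier G \<Longrightarrow> s \<otimes> (s \<otimes> x) = x"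
  by (simp flip: m_assoc)

lemma word_prod_simple_closed [simp]: "ws \<in> lists S \<Longrightarrow> word_prod G ws \<in> carrier G"
  using lists_simple_closed word_prod_closed by blast

lemma word_prod_rev:
  "ws \<in> lists S \<Longrightarrow> word_prod G (rev ws) = inv (word_prod G ws)"
proof (induction ws)
  case (Cons s ws)
  then have "ws \<in> lists S" "s \<in> S" "rev ws \<in> lists (carrier G)"
    using generators_closed by auto
  then show ?case using Cons word_prod_append[of "rev ws" "[s]"]
    by (simp add: inv_mult_group)
qed simp

lemma generate_word:
  assumes "x \<in> generate G K" "K \<subseteq> S"
  obtains ws where "ws \<in> lists K" "word_prod G ws = x"
proof -
  from assms have "\<exists>ws\<in>lists K. word_prod G ws = x"
  proof (induction rule: generate.induct)
    case one
    show ?case by (rule bexI[of _ "[]"]) auto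
  next
    case (incl h)
    then show ?case by (intro bexI[of _ "[h]"]) auto
  next
    case (inv h)
    then have "h \<in> S" by auto
    with inv show ?case by (intro bexI[of _ "[h]"]) auto
  next
    case (eng h1 h2)
    then obtain u v where *: "u \<in> lists K" "word_prod G u = h1" "v \<in> lists K" "word_prod G v = h2"
      by auto
    moreover have "u \<in> lists (carrier G)" "v \<in> lists (carrier G)"
      using * eng.prems generators_closed by auto
    ultimately show ?case by (intro bexI[of _ "u @ v"]) (auto simp: word_prod_append)
  qed
  then show ?thesis using that by blast
qed

lemma word_generate: "ws \<in> lists K \<Longrightarrow> K \<subseteq> S \<Longrightarrow> word_prod G ws \<in> generate G K"
  by (induction ws) (auto intro: generate.intros)

lemma reduced_simple_word:
  assumes "x \<in> carrier G"
  obtains ws where "ws \<in> lists S" "length ws = len x" "word_prod G ws = x"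
  using assms generates generate_word[of x S] reduced_word[where A=S and G=G and x=x] by (metis subset_refl)

lemma len_one [simp]: "len \<one> = 0"
  using word_length_le[of "[]" S G] by simp

lemma len_eq_0: "x \<in> carrier G \<Longrightarrow> len x = 0 \<longleftrightarrow> x = \<one>"
  by (metis reduced_simple_word len_one length_0_conv word_prod_Nil)

lemma len_mult_le:
  assumes "x \<in> carrier G" "ws \<in> lists S"
  shows "len (x \<otimes> word_prod G ws) \<le> len x + length ws"
proof -
  obtain us where us: "us \<in> lists S" "length us = len x" "word_prod G us = x"
    using reduced_simple_word assms(1) by blast
  have "x \<otimes> word_prod G ws = word_prod G (us @ ws)"
    using us assms lists_simple_closed by (simp add: word_prod_append)
  then show ?thesis using word_length_le[of "us @ ws" S G] us assms by simp
qed

text \<open>Through this description by length a length-preserving automorphism permutes the simple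
  reflections.\<close>

lemma simple_iff: "s \<in> S \<longleftrightarrow> s \<in> carrier G \<and> len s = 1"
proof
  assume s: "s \<in> S"
  then have "len s \<noteq> 0" using len_eq_0 simple_not_one by simp
  moreover have "len s \<le> 1" using word_length_le[of "[s]" S G] s by simp
  ultimately show "s \<in> carrier G \<and> len s = 1" using s by simp
next
  assume s: "s \<in> carrier G \<and> len s = 1"
  then obtain ws where "ws \<in> lists S" "length ws = 1" "word_prod G ws = s"
    using reduced_simple_word[of s] by metis
  then show "s \<in> S" by (auto simp: length_Suc_conv)
qed

text \<open>Every relator is a power of a word of two letters, so deleting it keeps the parity; this
  is the sign character.\<close>

lemma length_parity:
  assumes "us \<in> lists S" "vs \<in> lists S" "word_prod G us = word_prod G vs"
  shows "even (length us) = even (length vs)"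
proof (rule equivclp_invariant[where f = "\<lambda>w. even (length w)"])
  show "equivclp (coxeter_step G S) us vs" using presentation assms by blast
  fix u v :: "'a list"
  assume "coxeter_step G S u v"
  then show "even (length u) = even (length v)"
    by cases (auto simp: length_concat sum_list_replicate)
qed

text \<open>One more letter changes the length by at most one in either direction, and parity
  excludes equality.\<close>

lemma len_mult_simple:
  assumes "x \<in> carrier G" "s \<in> S"
  shows "len (x \<otimes> s) = len x + 1 \<or> len x = len (x \<otimes> s) + 1"
proof -
  have 1: "len (x \<otimes> s) \<le> len x + 1"
    using len_mult_le[of x "[s]"] assms by simp
  have 2: "len x \<le> len (x \<otimes> s) + 1"
    using len_mult_le[of "x \<otimes> s" "[s]"] assms by (simp add: simple_cancel)
  obtain us where us: "us \<in> lists S" "length us = len x" "word_prod G us = x"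
    using reduced_simple_word assms(1) by blast
  obtain vs where vs: "vs \<in> lists S" "length vs = len (x \<otimes> s)" "word_prod G vs = x \<otimes> s"
    using reduced_simple_word[of "x \<otimes> s"] assms by auto
  have "word_prod G (us @ [s]) = word_prod G vs"
    using us vs assms lists_simple_closed by (simp add: word_prod_append)
  with length_parity[of "us @ [s]" vs] us vs assms
  have "even (len x + 1) = even (len (x \<otimes> s))" by simp
  then have "len x \<noteq> len (x \<otimes> s)" by auto
  with 1 2 show ?thesis by linarith
qed

lemma len_inv: "x \<in> carrier G \<Longrightarrow> len (inv x) = len x"
proof -
  have *: "len (inv x) \<le> len x" if x: "x \<in> carrier G" for x
  proof -
    obtain us where us: "us \<in> lists S" "length us = len x" "word_prod G us = x"
      using reduced_simple_word x by blast
    then have "rev us \<in> lists S" by (simp add: in_lists_conv_set)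
    then show ?thesis using us word_length_le[of "rev us" S G] word_prod_rev[of us] by simp
  qed
  then show "x \<in> carrier G \<Longrightarrow> len (inv x) = len x"
    by (metis * inv_closed inv_inv le_antisym)
qed

lemma len_simple_mult:
  assumes "x \<in> carrier G" "s \<in> S"
  shows "len (s \<otimes> x) = len (inv x \<otimes> s)"
  using len_inv[of "s \<otimes> x"] assms by (simp add: inv_mult_group)

lemma right_descent:
  assumes "x \<in> carrier G" "x \<noteq> \<one>"
  obtains t where "t \<in> S" "len (x \<otimes> t) < len x"
proof -
  obtain us where us: "us \<in> lists S" "length us = len x" "word_prod G us = x"
    using reduced_simple_word assms(1) by blast
  have "us \<noteq> []" using us assms by auto
  then obtain vs t where vt: "us = vs @ [t]" by (metis rev_exhaust)
  with us have "vs \<in> lists S" "t \<in> S" by auto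
  then have "x = word_prod G vs \<otimes> t"
    using us vt by (auto simp: word_prod_append lists_simple_closed)
  then have "x \<otimes> t = word_prod G vs"
    using \<open>t \<in> S\<close> \<open>vs \<in> lists S\<close> by (simp add: simple_cancel)
  then have "len (x \<otimes> t) < len x"
    using word_length_le[of vs S G] us vt \<open>vs \<in> lists S\<close> by simp
  then show ?thesis using that \<open>t \<in> S\<close> by blast
qed

text \<open>The alternating word of length \<open>2 m\<close> has product
  \<open>(s t)^m = 1\<close>, so its two halves are inverse to each other, and inversion reverses a
  word.\<close>

lemma braid_relation:
  assumes "s \<in> S" "t \<in> S"
  defines "m \<equiv> ord (s \<otimes> t)"
  shows "word_prod G (alternating s t m) = word_prod G (alternating t s m)"
proof -
  have lists: "alternating a b n \<in> lists S" if "a \<in> {s, t}" "b \<in> {s, t}" for a b n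
    by (rule alternating_in_lists) (use that assms in auto)
  have "word_prod G (alternating s t (2 * n)) = (s \<otimes> t) [^] n" for n
  proof (induction n)
    case (Suc n)
    have "word_prod G (alternating s t (2 * Suc n)) = s \<otimes> (t \<otimes> word_prod G (alternating s t (2 * n)))"
      unfolding alternating_even by simp
    also have "\<dots> = (s \<otimes> t) \<otimes> (s \<otimes> t) [^] n"
      using assms Suc by (simp add: m_assoc)
    finally show ?case
      using assms nat_pow_Suc2 by simp
  qed simp
  then have "word_prod G (alternating s t (m + m)) = \<one>"
    using assms by (simp add: m_def flip: mult_2)
  moreover have "word_prod G (alternating s t (m + m))
    = word_prod G (if even m then alternating s t m else alternating t s m) \<otimes> word_prod G (alternating s t m)"
    unfolding alternating_add by (rule word_prod_append) (use lists lists_simple_closed in auto)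
  ultimately have "inv (word_prod G (alternating s t m))
      = word_prod G (if even m then alternating s t m else alternating t s m)"
    using lists by (intro inv_equality) auto
  then have "word_prod G (alternating s t m)
      = inv (word_prod G (if even m then alternating s t m else alternating t s m))"
    using lists by (metis inv_inv insertI1 insertI2 word_prod_simple_closed)
  also have "\<dots> = word_prod G (alternating t s m)"
    using lists by (simp add: rev_alternating flip: word_prod_rev)
  finally show ?thesis .
qed

end

section \<open>The geometric representation\<close>

locale finite_coxeter_system = coxeter_system +
  assumes finite_carrier: "finite (carrier G)"
begin

lemma finite_simple [simp]: "finite S"
  using generators_closed finite_carrier finite_subset by blast

text \<open>Finiteness rules out the value 0, which \<open>ord\<close> assigns to elements of
  infinite order; so the angle \<open>pi / m\<close> is meaningful.\<close>

lemma ord_simple_ge_2: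
  assumes "s \<in> S" "t \<in> S" "s \<noteq> t"
  shows "2 \<le> ord (s \<otimes> t)"
proof -
  have "s \<otimes> t \<noteq> \<one>"
    using assms by (metis inv_equality simple_closed simple_inv)
  then have "ord (s \<otimes> t) \<noteq> 1"
    using assms ord_eq_1 by simp
  moreover have "1 \<le> ord (s \<otimes> t)"
    using assms finite_carrier ord_ge_1 by simp
  ultimately show ?thesis by linarith
qed

lemma ord_mult_commute: "s \<in> S \<Longrightarrow> t \<in> S \<Longrightarrow> ord (t \<otimes> s) = ord (s \<otimes> t)"
  using ord_inv[of "s \<otimes> t"] by (simp add: inv_mult_group)

text \<open>The Gram matrix of the simple roots for the Tits form: a root has norm 1 because
  \<open>s \<otimes> s\<close> has order 1, and two distinct roots meet at the angle
  \<open>pi - pi / m\<close>.\<close>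

definition cox_form :: "'a \<Rightarrow> 'a \<Rightarrow> real" where
  "cox_form s t = - cos (pi / real (ord (s \<otimes> t)))"

definition root_form :: "'a \<Rightarrow> ('a \<Rightarrow> real) \<Rightarrow> real" where
  "root_form s v = (\<Sum>t\<in>S. cox_form s t * v t)"

definition simple_root :: "'a \<Rightarrow> 'a \<Rightarrow> real" where
  "simple_root s = (\<lambda>x. of_bool (x = s))"

definition simple_act :: "'a \<Rightarrow> ('a \<Rightarrow> real) \<Rightarrow> ('a \<Rightarrow> real)" where
  "simple_act s v = v - (2 * root_form s v) *\<^sub>R simple_root s"

definition word_act :: "'a list \<Rightarrow> ('a \<Rightarrow> real) \<Rightarrow> ('a \<Rightarrow> real)" where
  "word_act ws = foldr simple_act ws"

lemma cox_form_commute: "s \<in> S \<Longrightarrow> t \<in> S \<Longrightarrow> cox_form s t = cox_form t s"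
  by (simp add: cox_form_def ord_mult_commute)

lemma cox_form_self [simp]: "s \<in> S \<Longrightarrow> cox_form s s = 1"
  by (simp add: cox_form_def)

lemma root_form_simple_root [simp]: "t \<in> S \<Longrightarrow> root_form s (simple_root t) = cox_form s t"
  by (simp add: root_form_def simple_root_def of_bool_def if_distrib cong: if_cong)

lemma root_form_add: "root_form s (u + v) = root_form s u + root_form s v"
  by (simp add: root_form_def algebra_simps sum.distrib)

lemma root_form_scaleR: "root_form s (c *\<^sub>R v) = c * root_form s v"
  by (simp add: root_form_def sum_distrib_left algebra_simps)

lemma linear_root_form: "linear (root_form s)"
  by (rule linearI) (simp_all add: root_form_add root_form_scaleR)

lemmas root_form_diff = linear_diff[OF linear_root_form]

lemma linear_simple_act: "linear (simple_act s)"
  by (rule linearI) (simp_all add: simple_act_def root_form_add root_form_scaleR algebra_simps)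

lemma simple_act_simple_act [simp]: "s \<in> S \<Longrightarrow> simple_act s (simple_act s v) = v"
  by (simp add: simple_act_def root_form_diff root_form_scaleR algebra_simps flip: scaleR_2)

lemma simple_act_self: "s \<in> S \<Longrightarrow> simple_act s (simple_root s) = - simple_root s"
  by (simp add: simple_act_def scaleR_2)

lemma word_act_Nil [simp]: "word_act [] v = v"
  and word_act_Cons [simp]: "word_act (s # ws) v = simple_act s (word_act ws v)"
  and word_act_append [simp]: "word_act (us @ vs) v = word_act us (word_act vs v)"
  by (simp_all add: word_act_def)

lemma linear_word_act: "linear (word_act ws)"
proof (induction ws)
  case (Cons s ws)
  then show ?case
    using linear_compose[OF Cons linear_simple_act[of s]] by (simp add: comp_def)
qed (simp add: linearI)

lemma word_act_rev: "ws \<in> lists S \<Longrightarrow> word_act (rev ws) (word_act ws v) = v"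
  by (induction ws arbitrary: v) auto

text \<open>The Tits form. Its invariance enters the proof that the defining relations act
  trivially.\<close>

definition cox_bilinear :: "('a \<Rightarrow> real) \<Rightarrow> ('a \<Rightarrow> real) \<Rightarrow> real" where
  "cox_bilinear u v = (\<Sum>s\<in>S. u s * root_form s v)"

lemma cox_bilinear_commute: "cox_bilinear u v = cox_bilinear v u"
proof -
  have "cox_bilinear u v = (\<Sum>s\<in>S. \<Sum>t\<in>S. u s * cox_form s t * v t)"
    by (simp add: cox_bilinear_def root_form_def sum_distrib_left mult.assoc)
  also have "\<dots> = (\<Sum>t\<in>S. \<Sum>s\<in>S. u s * cox_form s t * v t)"
    by (rule sum.swap)
  also have "\<dots> = cox_bilinear v u"
    unfolding cox_bilinear_def root_form_def sum_distrib_left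
    by (intro sum.cong refl) (simp add: cox_form_commute)
  finally show ?thesis .
qed

lemma sum_simple_root:
  assumes "s \<in> S"
  shows "(\<Sum>x\<in>S. simple_root s x * f x) = f s"
proof -
  have "(\<Sum>x\<in>S. simple_root s x * f x) = (\<Sum>x\<in>S. if x = s then f x else 0)"
    by (rule sum.cong) (auto simp: simple_root_def)
  then show ?thesis using assms by simp
qed

lemma cox_bilinear_simple_root: "s \<in> S \<Longrightarrow> cox_bilinear (simple_root s) v = root_form s v"
  by (simp add: cox_bilinear_def sum_simple_root)

lemma linear_cox_bilinear: "linear (cox_bilinear u)"
  by (rule linearI)
    (simp_all add: cox_bilinear_def root_form_add root_form_scaleR sum.distrib sum_distrib_left algebra_simps)

lemma cox_bilinear_simple_act: "s \<in> S \<Longrightarrow> cox_bilinear (simple_act s u) (simple_act s v) = cox_bilinear u v"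
proof -
  assume s: "s \<in> S"
  have *: "cox_bilinear u (simple_act s v) = cox_bilinear u v - 2 * root_form s u * root_form s v" for u v
    using s cox_bilinear_commute[of u "simple_root s"]
    by (simp add: simple_act_def linear_diff[OF linear_cox_bilinear] linear_scale[OF linear_cox_bilinear]
        cox_bilinear_simple_root)
  have neg: "root_form s (simple_act s u) = - root_form s u"
    using s by (simp add: simple_act_def root_form_diff root_form_scaleR)
  have "cox_bilinear (simple_act s u) (simple_act s v)
      = cox_bilinear v (simple_act s u) + 2 * root_form s u * root_form s v"
    by (simp add: * neg cox_bilinear_commute[of "simple_act s u" v])
  also have "\<dots> = cox_bilinear u v"
    by (simp add: * cox_bilinear_commute[of v u])
  finally show ?thesis .
qed

lemma cox_bilinear_word_act:
  "ws \<in> lists S \<Longrightarrow> cox_bilinear (word_act ws u) (word_act ws v) = cox_bilinear u v"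
  by (induction ws) (auto simp: cox_bilinear_simple_act)

text \<open>The coefficients obey the recursion \<open>sin ((n+1) \<theta>) = 2 cos \<theta> sin (n
  \<theta>) - sin ((n-1) \<theta>)\<close> of a rotation in the plane of the two roots. The factor
  \<open>sin \<theta>\<close> on the left spares a division.\<close>

lemma alternating_act:
  assumes "s \<in> S" "t \<in> S" "s \<noteq> t" "\<theta> = pi / real (ord (s \<otimes> t))"
  shows "sin \<theta> *\<^sub>R word_act (alternating s t n) (simple_root s)
    = sin (real (n + 1) * \<theta>) *\<^sub>R simple_root (if even n then s else t)
      + sin (real n * \<theta>) *\<^sub>R simple_root (if even n then t else s)"
  using assms
proof (induction n arbitrary: s t rule: less_induct)
  case (less n)
  have c: "cox_form t s = - cos \<theta>" "cox_form s t = - cos \<theta>"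
    using less.prems by (simp_all add: cox_form_def ord_mult_commute)
  have ts: "simple_act t (simple_root s) = simple_root s + (2 * cos \<theta>) *\<^sub>R simple_root t"
    using less.prems c by (simp add: simple_act_def)
  consider "n = 0" | "n = 1" | k where "n = Suc (Suc k)"
    by (metis One_nat_def nat.exhaust)
  then show ?case
  proof cases
    case 1
    then show ?thesis by simp
  next
    case 2
    have "sin (2 * \<theta>) = 2 * sin \<theta> * cos \<theta>" by (rule sin_double)
    then show ?thesis using 2 ts by (intro ext) (simp add: algebra_simps)
  next
    case (3 k)
    have IH1: "sin \<theta> *\<^sub>R word_act (alternating s t k) (simple_root s)
      = sin (real (k + 1) * \<theta>) *\<^sub>R simple_root (if even k then s else t)
        + sin (real k * \<theta>) *\<^sub>R simple_root (if even k then t else s)"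
      by (rule less.IH) (use less.prems 3 in simp_all)
    have IH2: "sin \<theta> *\<^sub>R word_act (alternating t s (Suc k)) (simple_root t)
      = sin (real (Suc k + 1) * \<theta>) *\<^sub>R simple_root (if even (Suc k) then t else s)
        + sin (real (Suc k) * \<theta>) *\<^sub>R simple_root (if even (Suc k) then s else t)"
      by (rule less.IH) (use less.prems 3 in \<open>simp_all add: ord_mult_commute\<close>)
    \<comment> \<open>The last letter \<open>t\<close> acts first and adds
      \<open>2 cos \<theta>\<close> times the root of \<open>t\<close>; on the summand left over,
      the next letter \<open>s\<close> only changes the sign, which removes a second letter.\<close>
    have "word_act (alternating s t n) (simple_root s)
        = word_act (alternating t s (Suc k)) (simple_root s)
          + (2 * cos \<theta>) *\<^sub>R word_act (alternating t s (Suc k)) (simple_root t)"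
      using 3 ts by (simp del: alternating.simps(2) add: alternating.simps(2)[of s t "Suc k"]
          linear_add[OF linear_word_act] linear_scale[OF linear_word_act])
    also have "word_act (alternating t s (Suc k)) (simple_root s) = - word_act (alternating s t k) (simple_root s)"
      using less.prems by (simp add: simple_act_self linear_neg[OF linear_word_act])
    finally have E: "word_act (alternating s t n) (simple_root s)
        = - word_act (alternating s t k) (simple_root s)
          + (2 * cos \<theta>) *\<^sub>R word_act (alternating t s (Suc k)) (simple_root t)" .
    have "sin \<theta> *\<^sub>R word_act (alternating s t n) (simple_root s)
        = (2 * cos \<theta>) *\<^sub>R (sin \<theta> *\<^sub>R word_act (alternating t s (Suc k)) (simple_root t))
          - sin \<theta> *\<^sub>R word_act (alternating s t k) (simple_root s)"
      unfolding E by (rule ext) (simp add: algebra_simps del: alternating.simps(2))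
    also have "\<dots> = (2 * cos \<theta> * sin (real (Suc k + 1) * \<theta>) - sin (real (k + 1) * \<theta>)) *\<^sub>R simple_root (if even k then s else t)
       + (2 * cos \<theta> * sin (real (Suc k) * \<theta>) - sin (real k * \<theta>)) *\<^sub>R simple_root (if even k then t else s)"
      unfolding IH1 IH2 by (simp add: algebra_simps)
    also have "2 * cos \<theta> * sin (real (Suc k + 1) * \<theta>) - sin (real (k + 1) * \<theta>) = sin (real (n + 1) * \<theta>)"
    proof -
      have "sin (real (n + 1) * \<theta>) = sin (real (Suc k + 1) * \<theta> + \<theta>)"
        and "sin (real (k + 1) * \<theta>) = sin (real (Suc k + 1) * \<theta> - \<theta>)"
        using 3 by (simp_all add: algebra_simps)
      then show ?thesis by (simp only: sin_add sin_diff) (simp add: algebra_simps)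
    qed
    also have "2 * cos \<theta> * sin (real (Suc k) * \<theta>) - sin (real k * \<theta>) = sin (real n * \<theta>)"
    proof -
      have "sin (real n * \<theta>) = sin (real (Suc k) * \<theta> + \<theta>)"
        and "sin (real k * \<theta>) = sin (real (Suc k) * \<theta> - \<theta>)"
        using 3 by (simp_all add: algebra_simps)
      then show ?thesis by (simp only: sin_add sin_diff) (simp add: algebra_simps)
    qed
    finally show ?thesis using 3 by simp
  qed
qed

text \<open>Each letter moves a vector along its own root. For a relator this leaves only two
  unknown coefficients.\<close>

lemma word_act_difference:
  assumes "ws \<in> lists {s, t}"
  shows "\<exists>x y. word_act ws v = v + x *\<^sub>R simple_root s + y *\<^sub>R simple_root t"
  using assms
proof (induction ws)
  case Nil
  show ?case by (intro exI[of _ 0]) simp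
next
  case (Cons r ws)
  from Cons.IH obtain x y where xy: "word_act ws v = v + x *\<^sub>R simple_root s + y *\<^sub>R simple_root t"
    by blast
  define c where "c = 2 * root_form r (word_act ws v)"
  have eq: "word_act (r # ws) v = v + x *\<^sub>R simple_root s + y *\<^sub>R simple_root t - c *\<^sub>R simple_root r"
    by (simp add: simple_act_def c_def flip: xy)
  from Cons.hyps consider "r = s" | "r = t" by auto
  then show ?case
  proof cases
    case 1
    then show ?thesis unfolding eq by (intro exI[of _ "x - c"] exI[of _ y]) (simp add: algebra_simps)
  next
    case 2
    then show ?thesis unfolding eq by (intro exI[of _ x] exI[of _ "y - c"]) (simp add: algebra_simps)
  qed
qed

lemma simple_angle:
  assumes "s \<in> S" "t \<in> S" "s \<noteq> t"
  defines "\<theta> \<equiv> pi / real (ord (s \<otimes> t))"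
  shows "sin \<theta> > 0"
  using ord_simple_ge_2[OF assms(1-3)] unfolding \<theta>_def
  by (intro sin_gt_zero) (auto simp: field_simps)

text \<open>The relator turns the plane of the two roots by \<open>2 pi\<close> and so fixes both
  roots. Any other vector is displaced within this plane, and by invariance of the form the
  displacement is orthogonal to both roots. Their Gram matrix has the positive determinant
  \<open>(sin \<theta>)\<^sup>2\<close>, so it is zero.\<close>

lemma relation_act:
  assumes "s \<in> S" "t \<in> S"
  shows "word_act (concat (replicate (ord (s \<otimes> t)) [s, t])) v = v"
proof (cases "s = t")
  case True
  then show ?thesis using assms by simp
next
  case False
  define m where "m = ord (s \<otimes> t)"
  define \<theta> where "\<theta> = pi / real m"
  have m: "m \<ge> 2" using ord_simple_ge_2 assms False by (simp add: m_def)
  have sin: "sin \<theta> > 0" using simple_angle[OF assms False] by (simp add: \<theta>_def m_def)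
  have full: "word_act (concat (replicate (ord (a \<otimes> b)) [a, b])) (simple_root a) = simple_root a"
    if ab: "a \<in> S" "b \<in> S" "a \<noteq> b" "ord (a \<otimes> b) = m" for a b
  proof -
    have 1: "real (2 * m) * \<theta> = 2 * pi" using m by (simp add: \<theta>_def)
    have 2: "real (2 * m + 1) * \<theta> = \<theta> + 2 * pi" using 1 by (simp add: algebra_simps)
    have "sin (real (2 * m) * \<theta>) = 0" "sin (real (2 * m + 1) * \<theta>) = sin \<theta>"
      unfolding 1 2 by simp_all
    then show ?thesis
      using alternating_act[OF ab(1-3), of \<theta> "2 * m"] sin ab(4)
      unfolding alternating_even \<theta>_def by simp
  qed
  define R where "R = word_act (concat (replicate m [s, t]))"
  have ws: "concat (replicate m [s, t]) \<in> lists {s, t}" by (auto simp: in_lists_conv_set)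
  then have ws': "concat (replicate m [s, t]) \<in> lists S" using assms by auto
  have R_s: "R (simple_root s) = simple_root s"
    using full[of s t] assms False by (simp add: R_def m_def)
  \<comment> \<open>The relator with \<open>s\<close> and \<open>t\<close> exchanged fixes the root
    of \<open>t\<close>; read backwards it is the present relator, which acts as its
    inverse.\<close>
  have "concat (replicate m [s, t]) = rev (concat (replicate m [t, s]))"
    by (simp add: rev_concat)
  then have R_t: "R (simple_root t) = simple_root t"
    using full[of t s] word_act_rev[of "concat (replicate m [t, s])" "simple_root t"] assms False ws
    by (simp add: R_def m_def ord_mult_commute in_lists_conv_set)
  obtain x y where xy: "R v = v + x *\<^sub>R simple_root s + y *\<^sub>R simple_root t"
    using word_act_difference[OF ws] unfolding R_def by blast
  have inv: "root_form a (R v) = root_form a v" if "a \<in> {s, t}" for a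
    using that R_s R_t cox_bilinear_word_act[OF ws', of "simple_root a" v] assms
    by (auto simp: R_def cox_bilinear_simple_root)
  have "x - y * cos \<theta> = 0"
    using inv[of s] assms by (simp add: xy root_form_add root_form_scaleR cox_form_def \<theta>_def m_def)
  moreover have "y - x * cos \<theta> = 0"
    using inv[of t] assms
    by (simp add: xy root_form_add root_form_scaleR cox_form_def \<theta>_def m_def ord_mult_commute)
  ultimately have "x * (sin \<theta>)\<^sup>2 = 0" "y * (sin \<theta>)\<^sup>2 = 0"
  proof -
    have "x * (1 - c\<^sup>2) = (x - y * c) + (y - x * c) * c"
      and "y * (1 - c\<^sup>2) = (y - x * c) + (x - y * c) * c" for c
      by (simp_all add: algebra_simps power2_eq_square)
    moreover assume "x - y * cos \<theta> = 0" "y - x * cos \<theta> = 0"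
    ultimately show "x * (sin \<theta>)\<^sup>2 = 0" "y * (sin \<theta>)\<^sup>2 = 0"
      unfolding sin_squared_eq by simp_all
  qed
  then show ?thesis using xy sin by (simp add: R_def m_def)
qed

section \<open>The action of the group and the signs of roots\<close>

definition act :: "'a \<Rightarrow> ('a \<Rightarrow> real) \<Rightarrow> ('a \<Rightarrow> real)" where
  "act x = word_act (SOME ws. ws \<in> lists S \<and> word_prod G ws = x)"

text \<open>Here the presentation enters: words with equal products are linked by relators, and
  these act trivially. So the choice of word in \<open>act\<close> does not matter.\<close>

lemma word_act_eq:
  assumes "us \<in> lists S" "vs \<in> lists S" "word_prod G us = word_prod G vs"
  shows "word_act us = word_act vs"
proof (rule equivclp_invariant)
  show "equivclp (coxeter_step G S) us vs" using presentation assms by blast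
  fix u v :: "'a list"
  assume "coxeter_step G S u v"
  then show "word_act u = word_act v"
    by cases (auto simp: relation_act fun_eq_iff)
qed

lemma act_word_prod: "ws \<in> lists S \<Longrightarrow> act (word_prod G ws) = word_act ws"
  unfolding act_def by (rule someI2[of _ ws]) (auto intro: word_act_eq)

lemma act_one [simp]: "act \<one> v = v"
  using act_word_prod[of "[]"] by simp

lemma act_simple: "s \<in> S \<Longrightarrow> act s = simple_act s"
  using act_word_prod[of "[s]"] by (simp add: fun_eq_iff)

lemma act_mult:
  assumes "x \<in> carrier G" "y \<in> carrier G"
  shows "act (x \<otimes> y) v = act x (act y v)"
proof -
  obtain us vs where *: "us \<in> lists S" "word_prod G us = x" "vs \<in> lists S" "word_prod G vs = y"
    using assms generates generate_word by (metis subset_refl)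
  then have "act (word_prod G (us @ vs)) = word_act (us @ vs)"
    by (intro act_word_prod) auto
  then show ?thesis
    using * act_word_prod[of us] act_word_prod[of vs] by (simp add: word_prod_append lists_simple_closed)
qed

lemma linear_act: "linear (act x)"
  by (simp add: act_def linear_word_act)

lemmas act_add = linear_add[OF linear_act]
  and act_diff = linear_diff[OF linear_act]
  and act_neg = linear_neg[OF linear_act]
  and act_scaleR = linear_scale[OF linear_act]
  and act_sum = linear_sum[OF linear_act]
  and act_0 = linear_0[OF linear_act]

lemma act_inv_act [simp]: "x \<in> carrier G \<Longrightarrow> act (inv x) (act x v) = v"
  by (simp flip: act_mult)

lemma act_act_inv [simp]: "x \<in> carrier G \<Longrightarrow> act x (act (inv x) v) = v"
  by (simp flip: act_mult)

lemma act_mult_simple_root: "x \<in> carrier G \<Longrightarrow> s \<in> S \<Longrightarrow>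
    act (x \<otimes> s) (simple_root s) = - act x (simple_root s)"
  by (simp add: act_mult act_simple simple_act_self act_neg)

lemma act_simple_root_nonzero: "x \<in> carrier G \<Longrightarrow> act x (simple_root s) \<noteq> 0"
proof
  assume x: "x \<in> carrier G" and "act x (simple_root s) = 0"
  then have "simple_root s = 0" using act_inv_act[OF x, of "simple_root s"] by (simp add: act_0)
  then have "simple_root s s = 0" by simp
  then show False by (simp add: simple_root_def)
qed

text \<open>Split \<open>x\<close> into \<open>v\<close> and a longest possible alternating suffix
  in \<open>s\<close> and a descent \<open>t\<close>, with lengths adding. The shorter
  \<open>v\<close> makes both roots nonnegative by induction, and the suffix, having fewer than
  \<open>ord (s \<otimes> t)\<close> letters, sends the root of \<open>s\<close> to a nonnegative
  combination of them.\<close>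

lemma act_simple_root_nonneg:
  assumes "x \<in> carrier G" "s \<in> S" "len x < len (x \<otimes> s)"
  shows "0 \<le> act x (simple_root s) y"
  using assms
proof (induction "len x" arbitrary: x s y rule: less_induct)
  case less
  show ?case
  proof (cases "x = \<one>")
    case True
    then show ?thesis by (simp add: simple_root_def)
  next
    case False
    obtain t where t: "t \<in> S" "len (x \<otimes> t) < len x"
      using right_descent less.prems(1) False by blast
    then have st: "s \<noteq> t" using less.prems by auto
    define J where "J = {j. \<exists>v\<in>carrier G. x = v \<otimes> word_prod G (alternating s t j) \<and> len v + j = len x}"
    define m where "m = ord (s \<otimes> t)"
    have alt: "alternating a b j \<in> lists S" if "a \<in> {s, t}" "b \<in> {s, t}" for a b j
      by (rule alternating_in_lists) (use that less.prems t in auto)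
    have J1: "1 \<in> J"
      using len_mult_simple[of x t] less.prems t
      by (auto simp: J_def simple_cancel intro!: bexI[of _ "x \<otimes> t"])
    have fin: "finite J" by (rule finite_subset[of _ "{..len x}"]) (auto simp: J_def)
    define j where "j = Max J"
    have jJ: "j \<in> J" unfolding j_def by (rule Max_in) (use J1 fin in auto)
    have jmax: "Suc j \<notin> J" using Max_ge[OF fin, of "Suc j"] unfolding j_def by auto
    have j1: "1 \<le> j" using Max_ge[OF fin J1] unfolding j_def .
    from jJ obtain v where v: "v \<in> carrier G" "x = v \<otimes> word_prod G (alternating s t j)" "len v + j = len x"
      by (auto simp: J_def)
    \<comment> \<open>The letter \<open>p\<close> would extend the suffix on the left, and
      \<open>q\<close> is its leading letter: a descent of \<open>v\<close> at \<open>p\<close>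
      contradicts maximality, one at \<open>q\<close> would make \<open>x\<close> shorter.\<close>
    define p where "p = (if even j then t else s)"
    define q where "q = (if even j then s else t)"
    have pq: "p \<in> S" "q \<in> S" "{p, q} = {s, t}" using less.prems t by (auto simp: p_def q_def)
    have vp: "len v < len (v \<otimes> p)"
    proof (rule ccontr)
      assume "\<not> ?thesis"
      then have 1: "len v = len (v \<otimes> p) + 1" using len_mult_simple[of v p] v pq by linarith
      have "x = v \<otimes> p \<otimes> word_prod G (alternating s t (Suc j))"
        using v pq alt[of s t j] by (simp add: alternating_Cons m_assoc simple_cancel_left p_def[symmetric]
            del: alternating.simps(2))
      then have "Suc j \<in> J" using 1 v pq by (auto simp: J_def intro!: bexI[of _ "v \<otimes> p"])
      then show False using jmax by simp
    qed
    obtain i where i: "j = Suc i" using j1 by (cases j) auto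
    have vq: "len v < len (v \<otimes> q)"
    proof (rule ccontr)
      assume "\<not> ?thesis"
      then have 1: "len v = len (v \<otimes> q) + 1" using len_mult_simple[of v q] v pq by linarith
      have "x = v \<otimes> q \<otimes> word_prod G (alternating s t i)"
        using v pq alt[of s t i] i by (simp add: alternating_Cons m_assoc q_def
            del: alternating.simps(2))
      then have "len x \<le> len (v \<otimes> q) + i"
        using len_mult_le[of "v \<otimes> q" "alternating s t i"] v pq alt[of s t i] by simp
      then show False using 1 v i by linarith
    qed
    \<comment> \<open>In a suffix of at least \<open>m\<close> letters the braid relation could make
      the last letter \<open>s\<close>, and \<open>s\<close> would be a descent of
      \<open>x\<close>.\<close>
    have jm: "j < m"
    proof (rule ccontr)
      assume "\<not> j < m"
      then obtain k where k: "j = k + m" by (metis add.commute le_Suc_ex not_less)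
      obtain n where n: "m = Suc n"
        using ord_simple_ge_2[of s t] less.prems t st by (cases m) (auto simp: m_def)
      define pre where "pre = (if even m then alternating s t k else alternating t s k)"
      have pre: "pre \<in> lists S" "length pre = k" using alt[of s t k] alt[of t s k] by (auto simp: pre_def)
      have "word_prod G (alternating s t j) = word_prod G pre \<otimes> word_prod G (alternating s t m)"
        unfolding k alternating_add pre_def[symmetric]
        using pre alt[of s t m] by (simp add: word_prod_append lists_simple_closed)
      also have "word_prod G (alternating s t m) = word_prod G (alternating s t n @ [s])"
        using braid_relation[of s t] less.prems t n by (simp add: m_def)
      finally have "x \<otimes> s = v \<otimes> (word_prod G pre \<otimes> (word_prod G (alternating s t n) \<otimes> s)) \<otimes> s"
        using v alt[of s t n] less.prems by (simp add: word_prod_append lists_simple_closed)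
      also have "\<dots> = v \<otimes> word_prod G (pre @ alternating s t n)"
        using v alt[of s t n] less.prems pre by (simp add: word_prod_append lists_simple_closed m_assoc)
      finally have "len (x \<otimes> s) \<le> len v + (k + n)"
        using len_mult_le[of v "pre @ alternating s t n"] v alt[of s t n] pre by simp
      then show False using less.prems k n v by linarith
    qed
    define \<theta> where "\<theta> = pi / real m"
    have sin: "sin \<theta> > 0" using simple_angle[of s t] less.prems t st by (simp add: \<theta>_def m_def)
    \<comment> \<open>As \<open>j < m\<close>, the angles up to \<open>(j + 1) \<theta>\<close> do
      not exceed \<open>pi\<close>.\<close>
    have sin_nonneg: "sin (real n * \<theta>) \<ge> 0" if "n \<le> m" for n
      using that jm by (intro sin_ge_zero) (auto simp: \<theta>_def field_simps)
    have pos: "0 \<le> act v (simple_root s) y" "0 \<le> act v (simple_root t) y"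
      using less.hyps[of v] v j1 vp vq less.prems t by (auto simp: p_def q_def split: if_splits)
    have "sin \<theta> * act x (simple_root s) y = act v (sin \<theta> *\<^sub>R word_act (alternating s t j) (simple_root s)) y"
      using v alt[of s t j] by (simp add: act_mult act_word_prod act_scaleR)
    also have "sin \<theta> *\<^sub>R word_act (alternating s t j) (simple_root s)
        = sin (real (j + 1) * \<theta>) *\<^sub>R simple_root (if even j then s else t)
          + sin (real j * \<theta>) *\<^sub>R simple_root (if even j then t else s)"
      by (rule alternating_act) (use less.prems t st in \<open>simp_all add: \<theta>_def m_def\<close>)
    also have "act v \<dots> y = sin (real (j + 1) * \<theta>) * act v (simple_root (if even j then s else t)) y
        + sin (real j * \<theta>) * act v (simple_root (if even j then t else s)) y"
      by (simp only: act_add act_scaleR plus_fun_apply scaleR_fun_apply real_scaleR_def)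
    also have "\<dots> \<ge> 0"
      using sin_nonneg[of j] sin_nonneg[of "j + 1"] jm pos by (auto intro!: add_nonneg_nonneg mult_nonneg_nonneg)
    finally show ?thesis using sin by (simp add: zero_le_mult_iff)
  qed
qed

end

section \<open>Parabolic subgroups and dominant vectors\<close>

context finite_coxeter_system
begin

text \<open>The geometric representation proper is \<open>coord_space S\<close>; smaller sets give
  the spans of the roots of parabolic subgroups.\<close>

definition coord_space :: "'a set \<Rightarrow> ('a \<Rightarrow> real) set" where
  "coord_space K = {v. \<forall>x. x \<notin> K \<longrightarrow> v x = 0}"

lemma subspace_coord_space: "subspace (coord_space K)"
  by (auto simp: subspace_def coord_space_def)

lemma simple_root_coord_space: "s \<in> K \<Longrightarrow> simple_root s \<in> coord_space K"
  by (auto simp: coord_space_def simple_root_def)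

lemma coord_space_mono: "K \<subseteq> L \<Longrightarrow> coord_space K \<subseteq> coord_space L"
  by (auto simp: coord_space_def)

lemma coord_space_expansion:
  assumes "finite K" "v \<in> coord_space K"
  shows "v = (\<Sum>t\<in>K. v t *\<^sub>R simple_root t)"
proof
  fix x
  have "(\<Sum>t\<in>K. v t * simple_root t x) = (\<Sum>t\<in>K. if t = x then v t else 0)"
    by (rule sum.cong) (auto simp: simple_root_def)
  then show "v x = (\<Sum>t\<in>K. v t *\<^sub>R simple_root t) x"
    using assms by (simp add: sum_fun_apply coord_space_def)
qed

lemma generate_closed: "K \<subseteq> S \<Longrightarrow> x \<in> generate G K \<Longrightarrow> x \<in> carrier G"
  using generate_in_carrier generators_closed by (meson subset_trans)

lemma finite_generate: "K \<subseteq> S \<Longrightarrow> finite (generate G K)"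
  using generate_closed finite_carrier by (meson finite_subset subsetI)

lemma generate_m_inv: "K \<subseteq> S \<Longrightarrow> x \<in> generate G K \<Longrightarrow> inv x \<in> generate G K"
  using generators_closed by (intro generate_m_inv_closed) auto

lemma generate_induct [consumes 2, case_names one mult]:
  assumes "K \<subseteq> S" "x \<in> generate G K"
    and "P \<one>" and "\<And>y s. y \<in> generate G K \<Longrightarrow> s \<in> K \<Longrightarrow> P y \<Longrightarrow> P (y \<otimes> s)"
  shows "P x"
proof -
  obtain ws where ws: "ws \<in> lists K" "word_prod G ws = x"
    using generate_word assms(1,2) by blast
  from ws(1) have "P (word_prod G ws)"
  proof (induction ws rule: rev_induct)
    case (snoc s ws)
    then have "ws \<in> lists K" "s \<in> K" by auto
    moreover from this have "ws \<in> lists (carrier G)" "s \<in> carrier G"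
      using assms(1) generators_closed by auto
    ultimately show ?case
      using snoc assms(4)[of "word_prod G ws" s] word_generate[of ws K] assms(1)
      by (simp add: word_prod_append)
  qed (simp add: assms(3))
  then show ?thesis using ws by simp
qed

lemma act_minus_coord_space:
  assumes "K \<subseteq> S" "y \<in> generate G K"
  shows "act y v - v \<in> coord_space K"
  using assms
proof (induction arbitrary: v rule: generate_induct)
  case one
  then show ?case by (simp add: coord_space_def)
next
  case (mult y s)
  have "y \<in> carrier G" "s \<in> S" using mult assms generate_closed by auto
  then have "act (y \<otimes> s) v = act y (v - (2 * root_form s v) *\<^sub>R simple_root s)"
    by (simp add: act_mult act_simple simple_act_def)
  also have "\<dots> = act y v - (2 * root_form s v) *\<^sub>R act y (simple_root s)"
    by (simp only: act_diff act_scaleR)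
  finally have E: "act (y \<otimes> s) v = act y v - (2 * root_form s v) *\<^sub>R act y (simple_root s)" .
  have "act (y \<otimes> s) v - v = (act y v - v)
      - (2 * root_form s v) *\<^sub>R ((act y (simple_root s) - simple_root s) + simple_root s)"
    unfolding E by (intro ext) (simp add: algebra_simps)
  then show ?case
    using mult simple_root_coord_space[of s K]
    by (simp only: subspace_diff subspace_scale subspace_add subspace_coord_space)
qed

lemma act_coord_space:
  assumes "K \<subseteq> S" "y \<in> generate G K" "v \<in> coord_space K"
  shows "act y v \<in> coord_space K"
  using subspace_add[OF subspace_coord_space act_minus_coord_space[OF assms(1,2), of v] assms(3)]
  by (simp only: diff_add_cancel)

lemma act_coord_space_all: "y \<in> carrier G \<Longrightarrow> v \<in> coord_space S \<Longrightarrow> act y v \<in> coord_space S"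
  using act_coord_space[of S] generates by simp

text \<open>The factor \<open>c\<close> treats preservation and reversal of signs together, as in
  \<open>len_mult_signed\<close>.\<close>

lemma act_sign:
  assumes "K \<subseteq> S" "\<And>t x. t \<in> K \<Longrightarrow> 0 \<le> c * act z (simple_root t) x"
    and "v \<in> coord_space K" "\<And>x. 0 \<le> v x"
  shows "0 \<le> c * act z v x"
proof -
  have "finite K" using assms(1) finite_simple finite_subset by blast
  then have "act z v = act z (\<Sum>t\<in>K. v t *\<^sub>R simple_root t)"
    using coord_space_expansion assms(3) by simp
  then have "c * act z v x = (\<Sum>t\<in>K. v t * (c * act z (simple_root t) x))"
    by (simp add: act_sum act_scaleR sum_fun_apply sum_distrib_left algebra_simps)
  then show ?thesis using assms by (simp add: sum_nonneg)
qed

lemma act_simple_root_nonpos: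
  assumes "x \<in> carrier G" "s \<in> S" "len (x \<otimes> s) < len x"
  shows "act x (simple_root s) y \<le> 0"
  using act_simple_root_nonneg[of "x \<otimes> s" s y] assms
  by (simp add: simple_cancel act_mult_simple_root)

text \<open>For the converse, a root that is both nonnegative and nonpositive would vanish, whereas
  group elements act injectively.\<close>

lemma len_mult_simple_increases_iff:
  assumes "x \<in> carrier G" "s \<in> S"
  shows "len x < len (x \<otimes> s) \<longleftrightarrow> (\<forall>y. 0 \<le> act x (simple_root s) y)"
proof
  show "len x < len (x \<otimes> s) \<Longrightarrow> \<forall>y. 0 \<le> act x (simple_root s) y"
    using act_simple_root_nonneg assms by blast
  assume nonneg: "\<forall>y. 0 \<le> act x (simple_root s) y"
  show "len x < len (x \<otimes> s)"
  proof (rule ccontr)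
    assume "\<not> ?thesis"
    then have "len (x \<otimes> s) < len x" using len_mult_simple[OF assms] by linarith
    then have "act x (simple_root s) = 0"
      using act_simple_root_nonpos[OF assms] nonneg by (intro ext) (auto intro: order_antisym)
    then show False using act_simple_root_nonzero assms by blast
  qed
qed

lemma len_mult_simple_decreases_iff:
  assumes "x \<in> carrier G" "s \<in> S"
  shows "len (x \<otimes> s) < len x \<longleftrightarrow> (\<forall>y. act x (simple_root s) y \<le> 0)"
  using len_mult_simple_increases_iff[of "x \<otimes> s" s] assms
  by (simp add: simple_cancel act_mult_simple_root)

text \<open>For \<open>c = 1\<close> this is additivity of length for minimal coset representatives, for \<open>c = -1\<close> it is
  the length formula for products with a longest element.\<close>

lemma len_mult_signed:
  fixes c :: int
  assumes "K \<subseteq> S" "y \<in> generate G K" "z \<in> carrier G" "c \<in> {1, -1}"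
    and sign: "\<And>t x. t \<in> K \<Longrightarrow> 0 \<le> real_of_int c * act z (simple_root t) x"
  shows "int (len (z \<otimes> y)) = int (len z) + c * int (len y)"
  using assms(1,2)
proof (induction rule: generate_induct)
  case one
  then show ?case using assms by simp
next
  case (mult y t)
  have y: "y \<in> carrier G" and t: "t \<in> S" using mult generate_closed assms(1) by auto
  have coord: "act y (simple_root t) \<in> coord_space K"
    using act_coord_space simple_root_coord_space mult assms(1) by blast
  have zyt: "act (z \<otimes> y) (simple_root t) = act z (act y (simple_root t))"
    using assms y by (simp add: act_mult)
  \<comment> \<open>Whether \<open>t\<close> lengthens \<open>y\<close> is read off the sign of
    \<open>act y (simple_root t)\<close>. This vector lies in \<open>coord_space K\<close>, where
    \<open>z\<close> multiplies signs by \<open>c\<close>.\<close>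
  have *: "0 \<le> real_of_int c * act (z \<otimes> y) (simple_root t) x"
    if "\<And>x. 0 \<le> act y (simple_root t) x" for x
    unfolding zyt by (rule act_sign[OF assms(1) sign coord that])
  have **: "real_of_int c * act (z \<otimes> y) (simple_root t) x \<le> 0"
    if "\<And>x. act y (simple_root t) x \<le> 0" for x
  proof -
    have "- act y (simple_root t) \<in> coord_space K" using coord by (simp add: coord_space_def)
    then have "0 \<le> real_of_int c * act z (- act y (simple_root t)) x"
      using that by (intro act_sign[OF assms(1) sign]) auto
    then show ?thesis unfolding zyt by (simp add: act_neg)
  qed
  have inc: "len (z \<otimes> y \<otimes> t) = len (z \<otimes> y) + 1" if "\<And>x. 0 \<le> act (z \<otimes> y) (simple_root t) x"
    using that len_mult_simple[of "z \<otimes> y" t] len_mult_simple_increases_iff[of "z \<otimes> y" t] assms y t by auto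
  have dec: "len (z \<otimes> y) = len (z \<otimes> y \<otimes> t) + 1" if "\<And>x. act (z \<otimes> y) (simple_root t) x \<le> 0"
    using that len_mult_simple[of "z \<otimes> y" t] len_mult_simple_decreases_iff[of "z \<otimes> y" t] assms y t by auto
  have assoc: "z \<otimes> (y \<otimes> t) = z \<otimes> y \<otimes> t" using assms y t by (simp add: m_assoc)
  from len_mult_simple[OF y t] show ?case
  proof
    assume 1: "len (y \<otimes> t) = len y + 1"
    then have "\<And>x. 0 \<le> act y (simple_root t) x"
      using act_simple_root_nonneg y t by simp
    from *[OF this] show ?case
      using assms(4) 1 mult.IH inc dec unfolding assoc by auto
  next
    assume 1: "len y = len (y \<otimes> t) + 1"
    then have "\<And>x. act y (simple_root t) x \<le> 0"
      using act_simple_root_nonpos y t by simp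
    from **[OF this] show ?case
      using assms(4) 1 mult.IH inc dec unfolding assoc by auto
  qed
qed

lemma len_coset_representative:
  assumes "K \<subseteq> S" "y \<in> generate G K" "z \<in> carrier G" "\<And>t. t \<in> K \<Longrightarrow> len z < len (z \<otimes> t)"
  shows "len (z \<otimes> y) = len z + len y"
proof -
  have "int (len (z \<otimes> y)) = int (len z) + 1 * int (len y)"
    by (rule len_mult_signed[OF assms(1-3)])
      (use assms in \<open>auto intro!: act_simple_root_nonneg\<close>)
  then show ?thesis by simp
qed

text \<open>Encoded by right descents, which is the form in which longest elements of stabilizers
  arise later; \<open>is_longest_len\<close> recovers maximality of the length.\<close>

definition is_longest :: "'a set \<Rightarrow> 'a \<Rightarrow> bool" where
  "is_longest K w \<longleftrightarrow> w \<in> generate G K \<and> (\<forall>t\<in>K. len (w \<otimes> t) < len w)"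

text \<open>Having all descents, \<open>w\<close> sends every simple root of \<open>K\<close> to a
  nonpositive vector: the case \<open>c = -1\<close> of \<open>len_mult_signed\<close>.\<close>

lemma is_longest_len:
  assumes "K \<subseteq> S" "is_longest K w" "y \<in> generate G K"
  shows "len (w \<otimes> y) + len y = len w"
proof -
  have "w \<in> carrier G" using assms generate_closed by (auto simp: is_longest_def)
  moreover have "0 \<le> real_of_int (-1) * act w (simple_root t) x" if "t \<in> K" for t x
    using act_simple_root_nonpos[of w t x] that assms calculation by (auto simp: is_longest_def)
  ultimately have "int (len (w \<otimes> y)) = int (len w) + (-1) * int (len y)"
    using assms by (intro len_mult_signed) auto
  then show ?thesis by simp
qed

lemma is_longest_if_maximal:
  assumes "K \<subseteq> S" "w \<in> generate G K" "\<And>y. y \<in> generate G K \<Longrightarrow> len y \<le> len w"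
  shows "is_longest K w"
  unfolding is_longest_def
proof (intro conjI ballI)
  fix t assume t: "t \<in> K"
  then have "len (w \<otimes> t) \<le> len w"
    using assms by (intro assms(3)) (auto intro: generate.intros)
  then show "len (w \<otimes> t) < len w"
    using len_mult_simple[of w t] assms t generate_closed by fastforce
qed (rule assms)

text \<open>The length formula, applied to the quotient in both directions, forces the quotient to
  have length 0.\<close>

lemma is_longest_unique:
  assumes K: "K \<subseteq> S" and "is_longest K v" "is_longest K w"
  shows "v = w"
proof -
  have vw: "v \<in> generate G K" "w \<in> generate G K" using assms by (auto simp: is_longest_def)
  then have c: "v \<in> carrier G" "w \<in> carrier G" using K generate_closed by auto
  have y: "inv v \<otimes> w \<in> generate G K"
    using vw generate_m_inv[OF K] by (intro generate.eng)
  have "v \<otimes> (inv v \<otimes> w) = w" using c by (simp flip: m_assoc)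
  with is_longest_len[OF K assms(2) y] have 1: "len w + len (inv v \<otimes> w) = len v" by simp
  have "len v \<le> len w"
    using is_longest_len[OF K assms(3), of "inv w \<otimes> v"] vw generate_m_inv[OF K]
    by (metis (no_types, opaque_lifting) c generate.eng inv_closed inv_solve_left' le_add1 m_closed)
  with 1 have "len (inv v \<otimes> w) = 0" by simp
  then have "inv v \<otimes> w = \<one>" using c len_eq_0 by simp
  then show ?thesis using c by (metis inv_closed inv_equality inv_inv)
qed

lemma is_longest_inv:
  assumes K: "K \<subseteq> S" and w: "is_longest K w"
  shows "inv w = w"
proof (rule is_longest_unique[OF K _ w])
  have wK: "w \<in> generate G K" using w by (simp add: is_longest_def)
  show "is_longest K (inv w)"
  proof (rule is_longest_if_maximal[OF K generate_m_inv[OF K wK]])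
    fix y assume y: "y \<in> generate G K"
    have "len y \<le> len w"
      using is_longest_len[OF K w, of y] y by simp
    then show "len y \<le> len (inv w)" using wK K generate_closed len_inv by simp
  qed
qed

text \<open>Summing the coordinate inner product over the finite group makes it invariant and keeps
  it positive definite on \<open>coord_space S\<close>.\<close>

definition invariant_form :: "('a \<Rightarrow> real) \<Rightarrow> ('a \<Rightarrow> real) \<Rightarrow> real" where
  "invariant_form u v = (\<Sum>w\<in>carrier G. \<Sum>t\<in>S. act w u t * act w v t)"

lemma invariant_form_commute: "invariant_form u v = invariant_form v u"
  by (simp add: invariant_form_def mult.commute)

lemma linear_invariant_form: "linear (invariant_form u)"
  by (rule linearI)
    (simp_all add: invariant_form_def act_add act_scaleR sum.distrib sum_distrib_left algebra_simps)

lemmas invariant_form_diff = linear_diff[OF linear_invariant_form]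
  and invariant_form_scaleR = linear_scale[OF linear_invariant_form]
  and invariant_form_sum = linear_sum[OF linear_invariant_form]
  and invariant_form_neg = linear_neg[OF linear_invariant_form]

lemma invariant_form_diff_left: "invariant_form (u - v) w = invariant_form u w - invariant_form v w"
  by (metis invariant_form_commute invariant_form_diff)

lemma invariant_form_act:
  assumes x: "x \<in> carrier G"
  shows "invariant_form (act x u) (act x v) = invariant_form u v"
proof -
  have bij: "bij_betw (\<lambda>w. w \<otimes> x) (carrier G) (carrier G)"
    by (rule bij_betw_byWitness[where f' = "\<lambda>w. w \<otimes> inv x"]) (use x in \<open>auto simp: m_assoc\<close>)
  have "invariant_form (act x u) (act x v) = (\<Sum>w\<in>carrier G. \<Sum>t\<in>S. act (w \<otimes> x) u t * act (w \<otimes> x) v t)"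
    unfolding invariant_form_def by (intro sum.cong refl) (simp add: act_mult x)
  also have "\<dots> = invariant_form u v"
    unfolding invariant_form_def by (rule sum.reindex_bij_betw[OF bij])
  finally show ?thesis .
qed

lemma invariant_form_nonneg: "0 \<le> invariant_form v v"
  by (simp add: invariant_form_def sum_nonneg)

lemma invariant_form_eq_0:
  assumes "v \<in> coord_space S" "invariant_form v v = 0"
  shows "v = 0"
proof -
  have "\<forall>w\<in>carrier G. (\<Sum>t\<in>S. act w v t * act w v t) = 0"
    using assms(2) finite_carrier unfolding invariant_form_def
    by (subst (asm) sum_nonneg_eq_0_iff) (auto intro: sum_nonneg)
  then have "(\<Sum>t\<in>S. v t * v t) = 0" using act_one by (metis one_closed)
  then have "\<forall>t\<in>S. v t * v t = 0"
    by (subst (asm) sum_nonneg_eq_0_iff) auto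
  then show ?thesis using assms(1) by (intro ext) (auto simp: coord_space_def)
qed

lemma invariant_form_simple_root_pos: "s \<in> S \<Longrightarrow> 0 < invariant_form (simple_root s) (simple_root s)"
proof -
  assume s: "s \<in> S"
  then have "simple_root s \<noteq> 0" using act_simple_root_nonzero[of \<one> s] by simp
  then have "invariant_form (simple_root s) (simple_root s) \<noteq> 0"
    using invariant_form_eq_0 simple_root_coord_space s by blast
  then show ?thesis using invariant_form_nonneg[of "simple_root s"] by linarith
qed

text \<open>The reflection \<open>s\<close> preserves the form and negates its root; comparing the
  two sides determines the pairing up to the norm of the root.\<close>

lemma invariant_form_simple_root:
  assumes s: "s \<in> S"
  shows "invariant_form v (simple_root s) = root_form s v * invariant_form (simple_root s) (simple_root s)"
proof -
  have "invariant_form v (simple_root s) = invariant_form (act s v) (act s (simple_root s))"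
    using s by (simp add: invariant_form_act)
  also have "\<dots> = - invariant_form (simple_root s) (v - (2 * root_form s v) *\<^sub>R simple_root s)"
    using s by (simp only: act_simple simple_act_self invariant_form_neg)
      (simp only: simple_act_def invariant_form_commute)
  also have "\<dots> = - invariant_form v (simple_root s)
      + 2 * root_form s v * invariant_form (simple_root s) (simple_root s)"
    by (simp only: invariant_form_diff invariant_form_scaleR)
      (simp add: invariant_form_commute)
  finally show ?thesis by simp
qed

definition dominant :: "'a set \<Rightarrow> ('a \<Rightarrow> real) \<Rightarrow> bool" where
  "dominant K p \<longleftrightarrow> (\<forall>t\<in>K. 0 \<le> root_form t p)"

lemma dominant_form_nonneg:
  assumes "K \<subseteq> S" "dominant K p" "v \<in> coord_space K" "\<And>x. 0 \<le> v x"
  shows "0 \<le> invariant_form p v"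
proof -
  have "finite K" using assms(1) finite_simple finite_subset by blast
  then have "invariant_form p v = invariant_form p (\<Sum>t\<in>K. v t *\<^sub>R simple_root t)"
    using coord_space_expansion assms(3) by simp
  also have "\<dots> = (\<Sum>t\<in>K. v t * (root_form t p * invariant_form (simple_root t) (simple_root t)))"
    using assms(1) by (simp add: invariant_form_sum invariant_form_scaleR)
      (intro sum.cong refl, use invariant_form_simple_root[of _ p] in auto)
  also have "\<dots> \<ge> 0"
    using assms invariant_form_nonneg by (intro sum_nonneg mult_nonneg_nonneg) (auto simp: dominant_def)
  finally show ?thesis .
qed

text \<open>Maximize the sum of the coordinates over the finite orbit. Reflecting in
  \<open>t\<close> lowers this sum by twice the value of \<open>root_form t\<close>, so at the
  maximum these values are nonnegative.\<close>

lemma ex_dominant: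
  assumes K: "K \<subseteq> S"
  obtains z where "z \<in> generate G K" "dominant K (act (inv z) v)"
proof -
  define h where "h y = (\<Sum>s\<in>S. act y v s)" for y
  have "finite (h ` generate G K)" "h ` generate G K \<noteq> {}"
    using finite_generate[OF K] generate.one by auto
  then obtain y where y: "y \<in> generate G K" "h y = Max (h ` generate G K)"
    using Max_in by (metis (no_types, lifting) imageE)
  have yc: "y \<in> carrier G" using y K generate_closed by auto
  have "dominant K (act y v)"
    unfolding dominant_def
  proof
    fix t assume t: "t \<in> K"
    have tS: "t \<in> S" using t K by auto
    have "h (t \<otimes> y) = (\<Sum>s\<in>S. act y v s) - (\<Sum>s\<in>S. simple_root t s * (2 * root_form t (act y v)))"
      using tS yc by (simp add: h_def act_mult act_simple simple_act_def sum_subtractf mult.commute)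
    also have "\<dots> = h y - 2 * root_form t (act y v)"
      using tS by (simp add: sum_simple_root h_def)
    finally have "h (t \<otimes> y) = h y - 2 * root_form t (act y v)" .
    moreover have "h (t \<otimes> y) \<le> h y"
      unfolding y(2) using finite_generate[OF K] generate.eng[OF generate.incl[OF t] y(1)]
      by (intro Max_ge) auto
    ultimately show "0 \<le> root_form t (act y v)" by simp
  qed
  then show ?thesis using that[of "inv y"] y generate_m_inv[OF K] yc by simp
qed

text \<open>Without a descent in \<open>K\<close>, \<open>y\<close> would be a minimal
  representative of its coset, and lengths would add in
  \<open>y \<otimes> inv y = \<one>\<close>.\<close>

lemma generate_right_descent:
  assumes K: "K \<subseteq> S" and y: "y \<in> generate G K" "y \<noteq> \<one>"
  obtains t where "t \<in> K" "len (y \<otimes> t) < len y"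
proof -
  have yc: "y \<in> carrier G" using y K generate_closed by auto
  have "\<exists>t\<in>K. len (y \<otimes> t) < len y"
  proof (rule ccontr)
    assume "\<not> ?thesis"
    then have "len y < len (y \<otimes> t)" if "t \<in> K" for t
      using len_mult_simple[of y t] yc that K by fastforce
    then have "len (y \<otimes> inv y) = len y + len (inv y)"
      using K generate_m_inv[OF K y(1)] yc by (intro len_coset_representative) auto
    then show False using yc y by (simp add: len_eq_0)
  qed
  then show ?thesis using that by blast
qed

text \<open>For a descent \<open>t\<close> of \<open>y\<close>, the dominant \<open>act y p\<close>
  pairs nonnegatively with the nonnegative vector \<open>- act y (simple_root t)\<close>. So
  \<open>root_form t p\<close> is at most 0, hence 0; then \<open>t\<close> fixes \<open>p\<close>
  and can be split off \<open>y\<close>. Thus the dominant chamber meets each orbit once, and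
  stabilizers are parabolic.\<close>

lemma dominant_orbit:
  assumes K: "K \<subseteq> S" and "y \<in> generate G K" "dominant K p" "dominant K (act y p)"
  shows "act y p = p \<and> y \<in> generate G {t \<in> K. root_form t p = 0}"
  using assms(2,4)
proof (induction "len y" arbitrary: y rule: less_induct)
  case less
  have yc: "y \<in> carrier G" using less.prems K generate_closed by auto
  show ?case
  proof (cases "y = \<one>")
    case True
    then show ?thesis by (auto intro: generate.one)
  next
    case False
    then obtain t where t: "t \<in> K" "len (y \<otimes> t) < len y"
      using generate_right_descent[OF K] less.prems by blast
    have tS: "t \<in> S" using t K by auto
    have "0 \<le> invariant_form (act y p) (- act y (simple_root t))"
    proof (rule dominant_form_nonneg[OF K less.prems(2)])
      show "- act y (simple_root t) \<in> coord_space K"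
        using act_coord_space[OF K less.prems(1) simple_root_coord_space[OF t(1)]]
        by (simp add: coord_space_def)
      show "0 \<le> (- act y (simple_root t)) x" for x
        using act_simple_root_nonpos[OF yc tS t(2)] by simp
    qed
    then have "root_form t p * invariant_form (simple_root t) (simple_root t) \<le> 0"
      using invariant_form_simple_root[OF tS, of p] by (simp add: invariant_form_neg invariant_form_act yc)
    then have "root_form t p \<le> 0"
      using invariant_form_simple_root_pos[OF tS] by (simp add: mult_le_0_iff)
    then have p0: "root_form t p = 0" using assms(3) t by (auto simp: dominant_def)
    then have "act t p = p" using tS by (simp add: act_simple simple_act_def)
    then have yt: "act (y \<otimes> t) p = act y p" using yc tS by (simp add: act_mult)
    have "y \<otimes> t \<in> generate G K" using less.prems t by (auto intro: generate.intros)
    then have "act (y \<otimes> t) p = p \<and> y \<otimes> t \<in> generate G {t \<in> K. root_form t p = 0}"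
      using less.hyps[of "y \<otimes> t"] t less.prems yt by simp
    then have "act y p = p" "y \<otimes> t \<otimes> t \<in> generate G {t \<in> K. root_form t p = 0}"
      using yt t p0 by (auto intro: generate.eng generate.incl)
    then show ?thesis using yc tS by (simp add: simple_cancel)
  qed
qed

end

section \<open>Fixed spaces of twisted operators\<close>

text \<open>The function space may have infinite dimension, and \<open>dim\<close> is then 0 for
  spaces with infinite bases; a finite spanning set restores monotonicity.\<close>

lemma dim_mono_finite_span:
  fixes A B :: "'v::real_vector set"
  assumes "A \<subseteq> B" "B \<subseteq> span F" "finite F"
  shows "dim A \<le> dim B"
proof -
  obtain C where C: "C \<subseteq> B" "independent C" "B \<subseteq> span C" "card C = dim B"
    by (rule basis_exists)
  then have "finite C" using independent_span_bound[OF assms(3)] assms by blast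
  then show ?thesis using dim_le_card[of A C] C assms by auto
qed

lemma dim_less_finite_span:
  fixes A B :: "'v::real_vector set"
  assumes "subspace A" "A \<subseteq> B" "b \<in> B" "b \<notin> A" "B \<subseteq> span F" "finite F"
  shows "dim A + 1 \<le> dim B"
proof -
  obtain C where C: "C \<subseteq> A" "independent C" "A \<subseteq> span C" "card C = dim A"
    by (rule basis_exists)
  obtain D where D: "D \<subseteq> B" "independent D" "B \<subseteq> span D" "card D = dim B"
    by (rule basis_exists)
  have fD: "finite D" using independent_span_bound[OF assms(6)] D assms by blast
  have fC: "finite C" using independent_span_bound[OF assms(6)] C assms by blast
  have "span C \<subseteq> A" using C assms(1) by (simp add: span_minimal)
  then have b: "b \<notin> span C" using assms by auto
  then have "independent (insert b C)" using C independent_insertI by blast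
  then have "card (insert b C) \<le> card D"
    using independent_span_bound[OF fD, of "insert b C"] C D assms by blast
  moreover have "b \<notin> C" using b span_base by blast
  ultimately show ?thesis using fC C D by simp
qed

lemma dim_le_insert:
  fixes A B :: "'v::real_vector set"
  assumes "B \<subseteq> span (insert a A)" "A \<subseteq> span F" "finite F"
  shows "dim B \<le> dim A + 1"
proof -
  obtain C where C: "C \<subseteq> A" "independent C" "A \<subseteq> span C" "card C = dim A"
    by (rule basis_exists)
  have fC: "finite C" using independent_span_bound[OF assms(3)] C assms by blast
  have "insert a A \<subseteq> span (insert a C)"
    using C span_mono[of C "insert a C"] span_base[of a "insert a C"] by auto
  then have "B \<subseteq> span (insert a C)" using assms(1) span_minimal subspace_span by blast
  then have "dim B \<le> card (insert a C)" using fC by (intro dim_le_card) auto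
  also have "\<dots> \<le> card C + 1" using card_insert_le_m1 by (simp add: card_insert_if fC)
  finally show ?thesis using C by simp
qed

lemma dim_linear_image_le:
  fixes A :: "'v::real_vector set"
  assumes "linear f" "A \<subseteq> span F" "finite F"
  shows "dim (f ` A) \<le> dim A"
proof -
  obtain C where C: "C \<subseteq> A" "independent C" "A \<subseteq> span C" "card C = dim A"
    by (rule basis_exists)
  have fC: "finite C" using independent_span_bound[OF assms(3)] C assms by blast
  have "f ` A \<subseteq> span (f ` C)"
    using C linear_span_image[OF assms(1), of C] by auto
  then have "dim (f ` A) \<le> card (f ` C)" using fC by (intro dim_le_card) auto
  then show ?thesis using card_image_le[OF fC, of f] C by simp
qed

context finite_coxeter_system
begin

lemma coord_space_span: "coord_space S \<subseteq> span (simple_root ` S)"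
proof
  fix v assume "v \<in> coord_space S"
  then have "v = (\<Sum>t\<in>S. v t *\<^sub>R simple_root t)" by (intro coord_space_expansion) auto
  also have "\<dots> \<in> span (simple_root ` S)"
    by (intro span_sum span_scale span_base imageI)
  finally show "v \<in> span (simple_root ` S)" .
qed

lemma reflections_closed: "t \<in> reflections G S \<Longrightarrow> t \<in> carrier G"
  by (auto simp: reflections_def)

lemma simple_reflection: "s \<in> S \<Longrightarrow> s \<in> reflections G S"
  unfolding reflections_def by (intro CollectI exI[of _ \<one>] exI[of _ s]) simp

lemma reflections_conj:
  assumes "t \<in> reflections G S" "z \<in> carrier G"
  shows "z \<otimes> t \<otimes> inv z \<in> reflections G S"
proof -
  obtain x s where xs: "x \<in> carrier G" "s \<in> S" "t = x \<otimes> s \<otimes> inv x"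
    using assms by (auto simp: reflections_def)
  then have "z \<otimes> t \<otimes> inv z = (z \<otimes> x) \<otimes> s \<otimes> inv (z \<otimes> x)"
    using assms by (simp add: inv_mult_group m_assoc)
  then show ?thesis using xs assms unfolding reflections_def
    by (intro CollectI exI[of _ "z \<otimes> x"] exI[of _ s]) simp
qed

lemma reflection_inv:
  assumes "t \<in> reflections G S"
  shows "inv t = t"
  using assms by (auto simp: reflections_def inv_mult_group m_assoc)

lemma act_fix_generate:
  assumes "K \<subseteq> S" "y \<in> generate G K" "\<And>t. t \<in> K \<Longrightarrow> root_form t p = 0"
  shows "act y p = p"
  using assms(1,2)
proof (induction rule: generate_induct)
  case (mult y s)
  then have "y \<in> carrier G" "s \<in> S" using assms(1) generate_closed by auto
  then show ?case using mult assms(3) by (simp add: act_mult act_simple simple_act_def)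
qed simp

text \<open>Both ends are kept in the parabolic subgroup, since only there does translation by a
  minimal coset representative add a constant length. The reflection itself may be any reflection of
  \<open>G\<close>.\<close>

definition left_cover :: "'a set \<Rightarrow> 'a \<Rightarrow> 'a \<Rightarrow> bool" where
  "left_cover K u v \<longleftrightarrow> u \<in> generate G K \<and> v \<in> generate G K \<and>
     (\<exists>t\<in>reflections G S. v = t \<otimes> u) \<and> len v = len u + 1"

end

lemma relpowp_map:
  assumes "(R ^^ n) x y" "\<And>x y. R x y \<Longrightarrow> R' (f x) (f y)"
  shows "(R' ^^ n) (f x) (f y)"
  using assms(1)
proof (induction n arbitrary: y)
  case (Suc n)
  then obtain w where "(R ^^ n) x w" "R w y" by auto
  then show ?case using Suc.IH assms(2) by (meson relpowp_Suc_I)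
qed simp

section \<open>Length-preserving automorphisms and fixed spaces\<close>

locale twisted_coxeter_system = finite_coxeter_system +
  fixes \<tau> :: "'a \<Rightarrow> 'a"
  assumes length_preserving: "length_preserving_aut G S \<tau>"
begin

lemma aut_hom: "\<tau> \<in> hom G G" and aut_bij: "bij_betw \<tau> (carrier G) (carrier G)"
  using length_preserving by (auto simp: length_preserving_aut_def iso_def)

sublocale aut: group_hom G G \<tau>
  by unfold_locales (rule aut_hom)

lemma aut_inj: "x \<in> carrier G \<Longrightarrow> y \<in> carrier G \<Longrightarrow> \<tau> x = \<tau> y \<longleftrightarrow> x = y"
  using aut_bij by (auto simp: bij_betw_def inj_on_eq_iff)

lemma len_aut [simp]: "x \<in> carrier G \<Longrightarrow> len (\<tau> x) = len x"
  using length_preserving by (auto simp: length_preserving_aut_def)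

lemma aut_simple [simp]: "s \<in> S \<Longrightarrow> \<tau> s \<in> S"
  using simple_iff by auto

lemma aut_simple_image: "\<tau> ` S = S"
proof
  show "S \<subseteq> \<tau> ` S"
  proof
    fix s assume s: "s \<in> S"
    then have "s \<in> \<tau> ` carrier G" using aut_bij by (simp add: bij_betw_def)
    then obtain x where "x \<in> carrier G" "s = \<tau> x" by blast
    then show "s \<in> \<tau> ` S" using s simple_iff by auto
  qed
qed auto

lemma bij_aut_simple: "bij_betw \<tau> S S"
  using aut_simple_image aut_inj by (auto simp: bij_betw_def inj_on_def)

lemma ord_aut: "x \<in> carrier G \<Longrightarrow> ord (\<tau> x) = ord x"
proof (rule dvd_antisym)
  assume x: "x \<in> carrier G"
  have *: "\<tau> x [^] (n::nat) = \<one> \<longleftrightarrow> x [^] n = \<one>" for n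
    using aut_inj[of "x [^] n" \<one>] x by (simp flip: aut.hom_nat_pow)
  show "ord (\<tau> x) dvd ord x" "ord x dvd ord (\<tau> x)"
    using *[of "ord x"] *[of "ord (\<tau> x)"] x by (simp_all flip: pow_eq_id)
qed

lemma cox_form_aut: "s \<in> S \<Longrightarrow> t \<in> S \<Longrightarrow> cox_form (\<tau> s) (\<tau> t) = cox_form s t"
  using ord_aut[of "s \<otimes> t"] by (simp add: cox_form_def)

lemma generate_aut:
  assumes "K \<subseteq> S" "x \<in> generate G K"
  shows "\<tau> x \<in> generate G (\<tau> ` K)"
  using assms
proof (induction rule: generate_induct)
  case (mult y s)
  then have "y \<in> carrier G" "s \<in> carrier G" using assms(1) generate_closed by auto
  then show ?case using mult by (auto intro!: generate.eng intro: generate.incl)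
qed (auto intro: generate.intros)

text \<open>Coordinates are pulled back along the inverse permutation, so that simple roots move by
  \<open>\<tau>\<close>. The value 0 off \<open>S\<close> puts every image, and hence every fixed
  vector of a twisted operator, into \<open>coord_space S\<close>.\<close>

definition twist :: "('a \<Rightarrow> real) \<Rightarrow> ('a \<Rightarrow> real)" where
  "twist v = (\<lambda>x. if x \<in> S then v (inv_into S \<tau> x) else 0)"

lemma twist_aut [simp]: "s \<in> S \<Longrightarrow> twist v (\<tau> s) = v s"
  using bij_aut_simple by (simp add: twist_def bij_betw_def)

lemma linear_twist: "linear twist"
  by (rule linearI) (auto simp: twist_def fun_eq_iff)

lemma twist_coord_space_all: "twist v \<in> coord_space S"
  by (simp add: twist_def coord_space_def)

lemma eq_on_coord_space:
  assumes "u \<in> coord_space S" "v \<in> coord_space S" "\<And>s. s \<in> S \<Longrightarrow> u (\<tau> s) = v (\<tau> s)"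
  shows "u = v"
proof
  fix x
  show "u x = v x"
  proof (cases "x \<in> S")
    case True
    then obtain s where "s \<in> S" "x = \<tau> s" using aut_simple_image by auto
    then show ?thesis using assms(3) by simp
  qed (use assms in \<open>simp add: coord_space_def\<close>)
qed

lemma twist_simple_root: "s \<in> S \<Longrightarrow> twist (simple_root s) = simple_root (\<tau> s)"
proof (rule eq_on_coord_space)
  fix t assume "s \<in> S" "t \<in> S"
  then show "twist (simple_root s) (\<tau> t) = simple_root (\<tau> s) (\<tau> t)"
    using aut_inj[of t s] by (simp add: simple_root_def)
qed (auto intro: twist_coord_space_all simple_root_coord_space)

lemma root_form_twist: "s \<in> S \<Longrightarrow> root_form (\<tau> s) (twist v) = root_form s v"
proof -
  assume s: "s \<in> S"
  have "root_form (\<tau> s) (twist v) = (\<Sum>t\<in>S. cox_form (\<tau> s) (\<tau> t) * twist v (\<tau> t))"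
    unfolding root_form_def by (rule sum.reindex_bij_betw[OF bij_aut_simple, symmetric])
  also have "\<dots> = root_form s v"
    unfolding root_form_def by (intro sum.cong refl) (simp add: cox_form_aut s)
  finally show ?thesis .
qed

lemma twist_simple_act: "s \<in> S \<Longrightarrow> twist (simple_act s v) = simple_act (\<tau> s) (twist v)"
  unfolding simple_act_def
  by (simp only: linear_diff[OF linear_twist] linear_scale[OF linear_twist] twist_simple_root root_form_twist)

lemma twist_act:
  assumes "x \<in> carrier G"
  shows "twist (act x v) = act (\<tau> x) (twist v)"
proof -
  have "x \<in> generate G S" using assms generates by simp
  with subset_refl show ?thesis
  proof (induction arbitrary: v rule: generate_induct)
    case (mult y s)
    then have "y \<in> carrier G" using generate_closed by auto
    then show ?case using mult by (simp add: act_mult act_simple twist_simple_act)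
  qed simp
qed

lemma twist_coord_space:
  assumes "K \<subseteq> S" "v \<in> coord_space K"
  shows "twist v \<in> coord_space (\<tau> ` K)"
  unfolding coord_space_def
proof (intro CollectI allI impI)
  fix x assume x: "x \<notin> \<tau> ` K"
  show "twist v x = 0"
  proof (cases "x \<in> S")
    case True
    then obtain s where "s \<in> S" "x = \<tau> s" using aut_simple_image by auto
    then show ?thesis using x assms by (auto simp: coord_space_def)
  qed (simp add: twist_def)
qed

text \<open>The automorphism permutes both the group and the coordinates over which the form is
  summed.\<close>

lemma invariant_form_twist: "invariant_form (twist u) (twist v) = invariant_form u v"
proof -
  have "invariant_form (twist u) (twist v)
      = (\<Sum>w\<in>carrier G. \<Sum>t\<in>S. act (\<tau> w) (twist u) t * act (\<tau> w) (twist v) t)"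
    unfolding invariant_form_def by (rule sum.reindex_bij_betw[OF aut_bij, symmetric])
  also have "\<dots> = (\<Sum>w\<in>carrier G. \<Sum>t\<in>S. act (\<tau> w) (twist u) (\<tau> t) * act (\<tau> w) (twist v) (\<tau> t))"
    by (intro sum.cong refl sum.reindex_bij_betw[OF bij_aut_simple, symmetric])
  also have "\<dots> = invariant_form u v"
    unfolding invariant_form_def by (intro sum.cong refl) (simp flip: twist_act)
  finally show ?thesis .
qed

definition fixed_space :: "'a \<Rightarrow> ('a \<Rightarrow> real) set" where
  "fixed_space h = {v. act h (twist v) = v}"

definition fixed_dim :: "'a \<Rightarrow> nat" where
  "fixed_dim h = dim (fixed_space h)"

lemma linear_act_twist: "linear (\<lambda>v. act h (twist v))"
  using linear_compose[OF linear_twist linear_act[of h]] by (simp add: comp_def)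

lemma subspace_fixed_space: "subspace (fixed_space h)"
  unfolding fixed_space_def
  by (rule subspaceI) (simp_all add: linear_0[OF linear_act_twist] linear_add[OF linear_act_twist]
      linear_scale[OF linear_act_twist])

lemma fixed_space_coord_space: "h \<in> carrier G \<Longrightarrow> fixed_space h \<subseteq> coord_space S"
proof
  fix v assume h: "h \<in> carrier G" and "v \<in> fixed_space h"
  then have "act h (twist v) = v" by (simp add: fixed_space_def)
  then show "v \<in> coord_space S"
    using act_coord_space_all[OF h twist_coord_space_all, of v] by simp
qed

lemma fixed_space_span: "h \<in> carrier G \<Longrightarrow> fixed_space h \<subseteq> span (simple_root ` S)"
  using fixed_space_coord_space coord_space_span by blast

text \<open>The two twisted operators are conjugate under \<open>act z\<close>. One inequality, for
  all \<open>z\<close>, suffices because \<open>inv z\<close> undoes the conjugation.\<close>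

lemma fixed_dim_twisted_conj:
  assumes "z \<in> carrier G" "h \<in> carrier G"
  shows "fixed_dim (z \<otimes> h \<otimes> inv (\<tau> z)) = fixed_dim h"
proof -
  have *: "fixed_dim (z \<otimes> h \<otimes> inv (\<tau> z)) \<le> fixed_dim h"
    if zh: "z \<in> carrier G" "h \<in> carrier G" for z h
  proof -
    have "fixed_space (z \<otimes> h \<otimes> inv (\<tau> z)) \<subseteq> act z ` fixed_space h"
    proof
      fix v assume "v \<in> fixed_space (z \<otimes> h \<otimes> inv (\<tau> z))"
      then have v: "act z (act h (twist (act (inv z) v))) = v"
        using zh by (simp add: fixed_space_def act_mult twist_act)
      then have "act (inv z) v = act h (twist (act (inv z) v))"
        by (metis act_inv_act zh(1))
      then have "act (inv z) v \<in> fixed_space h" by (simp add: fixed_space_def)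
      moreover have "v = act z (act (inv z) v)" using zh by simp
      ultimately show "v \<in> act z ` fixed_space h"
        using image_eqI[of v "act z" "act (inv z) v"] by blast
    qed
    moreover have "act z ` fixed_space h \<subseteq> span (simple_root ` S)"
      using act_coord_space_all[of z] fixed_space_coord_space[of h] coord_space_span zh by blast
    ultimately have "fixed_dim (z \<otimes> h \<otimes> inv (\<tau> z)) \<le> dim (act z ` fixed_space h)"
      unfolding fixed_dim_def by (rule dim_mono_finite_span) simp
    also have "\<dots> \<le> fixed_dim h"
      unfolding fixed_dim_def
      by (rule dim_linear_image_le[OF linear_act fixed_space_span]) (use zh in auto)
    finally show ?thesis .
  qed
  have "inv z \<otimes> (z \<otimes> h \<otimes> inv (\<tau> z)) \<otimes> inv (\<tau> (inv z)) = h"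
    using assms by (simp add: m_assoc flip: m_assoc[of "inv z" z])
  then show ?thesis
    using *[of z h] *[of "inv z" "z \<otimes> h \<otimes> inv (\<tau> z)"] assms by simp
qed

text \<open>On the mirror of \<open>t\<close>, the kernel of the linear form \<open>c\<close>,
  vectors fixed for \<open>t \<otimes> h\<close> are also fixed for \<open>h\<close>; restricting to
  a mirror costs at most one dimension.\<close>

lemma fixed_dim_reflection_mult:
  assumes "t \<in> reflections G S" "h \<in> carrier G"
  shows "fixed_dim (t \<otimes> h) \<le> fixed_dim h + 1"
proof -
  obtain x s where xs: "x \<in> carrier G" "s \<in> S" "t = x \<otimes> s \<otimes> inv x"
    using assms by (auto simp: reflections_def)
  have t: "t \<in> carrier G" using assms reflections_closed by blast
  define c where "c v = root_form s (act (inv x) v)" for v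
  have lin: "linear c"
    using linear_compose[OF linear_act[of "inv x"] linear_root_form[of s]] by (simp add: comp_def c_def[abs_def])
  have act_t: "act t v = v" if "c v = 0" for v
    using that xs by (simp add: act_mult act_simple simple_act_def c_def)
  define A where "A = {v \<in> fixed_space (t \<otimes> h). c v = 0}"
  have "A \<subseteq> fixed_space h"
  proof
    fix v assume "v \<in> A"
    then have v: "act t (act h (twist v)) = v" "c v = 0"
      using t assms by (auto simp: A_def fixed_space_def act_mult)
    then have "act h (twist v) = act (inv t) v" using t by (metis act_inv_act)
    then have "act h (twist v) = v" using reflection_inv[OF assms(1)] act_t v by simp
    then show "v \<in> fixed_space h" by (simp add: fixed_space_def)
  qed
  then have 1: "dim A \<le> fixed_dim h"
    unfolding fixed_dim_def using fixed_space_span[OF assms(2)] by (intro dim_mono_finite_span) auto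
  have "\<exists>a. fixed_space (t \<otimes> h) \<subseteq> span (insert a A)"
  proof (cases "\<exists>a\<in>fixed_space (t \<otimes> h). c a \<noteq> 0")
    case True
    then obtain a where a: "a \<in> fixed_space (t \<otimes> h)" "c a \<noteq> 0" by blast
    have "fixed_space (t \<otimes> h) \<subseteq> span (insert a A)"
    proof
      fix v assume v: "v \<in> fixed_space (t \<otimes> h)"
      have "c (v - (c v / c a) *\<^sub>R a) = 0"
        using a(2) by (simp only: linear_diff[OF lin] linear_scale[OF lin]) simp
      then have "v - (c v / c a) *\<^sub>R a \<in> A"
        using v a subspace_fixed_space unfolding A_def by (simp only: mem_Collect_eq subspace_diff subspace_scale)
      then have "(v - (c v / c a) *\<^sub>R a) + (c v / c a) *\<^sub>R a \<in> span (insert a A)"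
        by (intro span_add span_scale span_base) auto
      then show "v \<in> span (insert a A)" by (simp only: diff_add_cancel)
    qed
    then show ?thesis by blast
  next
    case False
    then have "fixed_space (t \<otimes> h) \<subseteq> A" by (auto simp: A_def)
    \<comment> \<open>All fixed vectors lie on the mirror, so the additional spanning vector is a
      dummy.\<close>
    then have "fixed_space (t \<otimes> h) \<subseteq> span (insert 0 A)" using span_superset[of "insert 0 A"] by blast
    then show ?thesis by blast
  qed
  then obtain a where "fixed_space (t \<otimes> h) \<subseteq> span (insert a A)" by blast
  moreover have "A \<subseteq> span (simple_root ` S)"
    using fixed_space_span[of "t \<otimes> h"] t assms by (auto simp: A_def)
  ultimately have "fixed_dim (t \<otimes> h) \<le> dim A + 1"
    unfolding fixed_dim_def by (rule dim_le_insert) simp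
  with 1 show ?thesis by simp
qed

end

section \<open>Saturated chains\<close>

text \<open>Summation by parts, for evaluating \<open>v - M v\<close> on a weighted orbit
  sum.\<close>

lemma sum_weighted_telescope:
  fixes f :: "nat \<Rightarrow> 'v::real_vector"
  shows "(\<Sum>i<n. real i *\<^sub>R (f i - f (Suc i))) = (\<Sum>i\<le>n. f i) - f 0 - real n *\<^sub>R f n"
  by (induction n) (simp_all add: algebra_simps)

context twisted_coxeter_system
begin

text \<open>The orbit of a simple root under the twisted operator is finite; its sum is either a nonzero
  fixed vector, or a weighted orbit sum is fixed after composing with the simple reflection.\<close>

lemma fixed_vector_dichotomy:
  assumes K: "K \<subseteq> S" "\<tau> ` K = K" and s: "s \<in> K" and h: "h \<in> generate G K"
  obtains a v where "a \<in> {\<one>, s}" "v \<in> coord_space K" "v \<noteq> 0" "act (a \<otimes> h) (twist v) = v"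
    "a = s \<Longrightarrow> 0 < root_form s v" "a = s \<Longrightarrow> \<forall>u\<in>fixed_space h. root_form s u = 0"
proof -
  define M where "M v = act h (twist v)" for v
  define \<alpha> where "\<alpha> = simple_root s"
  have sS: "s \<in> S" using s K by auto
  have hc: "h \<in> carrier G" using h K generate_closed by auto
  have linM: "linear M" using linear_act_twist[of h] by (simp add: M_def[abs_def])
  have formM: "invariant_form (M u) (M v) = invariant_form u v" for u v
    by (simp add: M_def invariant_form_act hc invariant_form_twist)
  have formMi: "invariant_form ((M ^^ i) u) ((M ^^ i) v) = invariant_form u v" for i u v
    by (induction i) (simp_all add: formM)
  have coordM: "M v \<in> coord_space K" if "v \<in> coord_space K" for v
    using act_coord_space[OF K(1) h] twist_coord_space[OF K(1) that] K(2) by (simp add: M_def)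
  have coordMi: "(M ^^ i) \<alpha> \<in> coord_space K" for i
    by (induction i) (simp_all add: coordM \<alpha>_def simple_root_coord_space s)
  \<comment> \<open>The orbit of the root stays in the finite set of all images of simple roots, so
    it repeats.\<close>
  define roots where "roots = (\<lambda>(y, t). act y (simple_root t)) ` (carrier G \<times> S)"
  have "finite roots" using finite_carrier by (simp add: roots_def)
  have Mroots: "(M ^^ i) \<alpha> \<in> roots" for i
  proof (induction i)
    case 0
    then show ?case using sS by (auto simp: roots_def \<alpha>_def intro!: image_eqI[of _ _ "(\<one>, s)"])
  next
    case (Suc i)
    then obtain y t where yt: "y \<in> carrier G" "t \<in> S" "(M ^^ i) \<alpha> = act y (simple_root t)"
      by (auto simp: roots_def)
    then have "(M ^^ Suc i) \<alpha> = act (h \<otimes> \<tau> y) (simple_root (\<tau> t))"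
      using hc by (simp add: M_def twist_act twist_simple_root act_mult)
    then show ?case using yt hc
      by (auto simp: roots_def intro!: image_eqI[of _ _ "(h \<otimes> \<tau> y, \<tau> t)"])
  qed
  have "\<not> inj (\<lambda>i. (M ^^ i) \<alpha>)"
    using \<open>finite roots\<close> Mroots finite_imageD[of "\<lambda>i. (M ^^ i) \<alpha>" UNIV]
    by (metis (no_types, lifting) finite_subset image_subsetI infinite_UNIV_nat)
  then obtain i j where "i < j" and ij: "(M ^^ i) \<alpha> = (M ^^ j) \<alpha>"
    by (metis (no_types, lifting) injI nat_neq_iff)
  define d where "d = j - i"
  have d: "0 < d" "j = i + d" using \<open>i < j\<close> by (auto simp: d_def)
  \<comment> \<open>A repetition gives pure periodicity, since \<open>M\<close> preserves a form
    that is definite on \<open>coord_space S\<close> and is therefore injective there.\<close>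
  have period: "(M ^^ d) \<alpha> = \<alpha>"
  proof -
    define \<beta> where "\<beta> = (M ^^ d) \<alpha> - \<alpha>"
    have "(M ^^ i) ((M ^^ d) \<alpha>) = (M ^^ i) \<alpha>"
      using ij d by (simp add: funpow_add)
    moreover have "linear (M ^^ i)"
    proof (induction i)
      case (Suc i)
      then show ?case using linear_compose[OF Suc linM] by (simp add: comp_def)
    qed (simp add: linearI)
    ultimately have "(M ^^ i) \<beta> = 0" by (simp only: \<beta>_def linear_diff) simp
    then have "invariant_form \<beta> \<beta> = 0"
      using formMi[of i \<beta> \<beta>] by (simp add: linear_0[OF linear_invariant_form])
    moreover have "\<beta> \<in> coord_space S"
      using subspace_diff[OF subspace_coord_space coordMi[of d] coordMi[of 0]] coord_space_mono[OF K(1)]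
      by (auto simp: \<beta>_def)
    ultimately have "\<beta> = 0" using invariant_form_eq_0 by blast
    then show ?thesis by (simp add: \<beta>_def)
  qed
  define u where "u = (\<Sum>i<d. (M ^^ i) \<alpha>)"
  have uK: "u \<in> coord_space K"
    unfolding u_def by (rule subspace_sum[OF subspace_coord_space coordMi])
  have Mu: "M u = u"
  proof -
    have "M u = (\<Sum>i<d. (M ^^ Suc i) \<alpha>)" by (simp add: u_def linear_sum[OF linM])
    also have "\<dots> = u + (M ^^ d) \<alpha> - (M ^^ 0) \<alpha>"
      using sum.lessThan_Suc_shift[of "\<lambda>i. (M ^^ i) \<alpha>" d] sum.lessThan_Suc[of "\<lambda>i. (M ^^ i) \<alpha>" d]
      unfolding u_def by (metis add_diff_cancel_left')
    finally show ?thesis using period by simp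
  qed
  show ?thesis
  proof (cases "u = 0")
    case False
    show ?thesis
    proof (cases "s = \<one>")
      case True
      then show ?thesis using simple_not_one sS by blast
    next
      case s1: False
      show ?thesis
        by (rule that[of \<one> u]) (use False uK Mu hc s1 in \<open>auto simp: M_def\<close>)
    qed
  next
    case True
    \<comment> \<open>With orbit sum 0, summation by parts makes this a solution of
      \<open>v - M v = \<alpha>\<close>; the scale \<open>- 1 / d\<close> turns the boundary term
      into \<open>\<alpha>\<close>.\<close>
    define v where "v = (- 1 / real d) *\<^sub>R (\<Sum>i<d. real i *\<^sub>R (M ^^ i) \<alpha>)"
    have vK: "v \<in> coord_space K"
      unfolding v_def by (intro subspace_scale subspace_sum subspace_coord_space coordMi)
    have "v - M v = (- 1 / real d) *\<^sub>R (\<Sum>i<d. real i *\<^sub>R ((M ^^ i) \<alpha> - (M ^^ Suc i) \<alpha>))"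
      unfolding v_def
      by (simp only: linear_scale[OF linM] linear_sum[OF linM] funpow.simps(2) comp_def
          scaleR_diff_right sum_subtractf)
    also have "\<dots> = (- 1 / real d) *\<^sub>R (u + (M ^^ d) \<alpha> - \<alpha> - real d *\<^sub>R (M ^^ d) \<alpha>)"
    proof -
      have "(\<Sum>i\<le>d. (M ^^ i) \<alpha>) = u + (M ^^ d) \<alpha>"
        unfolding u_def by (simp add: lessThan_Suc_atMost[symmetric])
      then show ?thesis
        using sum_weighted_telescope[of "\<lambda>i. (M ^^ i) \<alpha>" d] by (simp only: funpow_0)
    qed
    also have "\<dots> = \<alpha>" using True d period by (intro ext) simp
    finally have vM: "M v = v - \<alpha>" by (simp only: algebra_simps)
    \<comment> \<open>Since \<open>M v = v - \<alpha>\<close> has the same norm as \<open>v\<close>,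
      the value of \<open>root_form s\<close> at \<open>v\<close> is \<open>1 / 2\<close>; then
      reflecting in \<open>s\<close> undoes the subtraction of \<open>\<alpha>\<close>.\<close>
    have "invariant_form v v = invariant_form (v - \<alpha>) (v - \<alpha>)"
      using formM[of v v] vM by simp
    also have "\<dots> = invariant_form v v - 2 * invariant_form v \<alpha> + invariant_form \<alpha> \<alpha>"
      by (simp only: invariant_form_diff invariant_form_diff_left invariant_form_commute[of \<alpha> v])
    finally have "2 * root_form s v * invariant_form \<alpha> \<alpha> = invariant_form \<alpha> \<alpha>"
      using invariant_form_simple_root[OF sS, of v] by (simp add: \<alpha>_def)
    then have half: "root_form s v = 1 / 2"
      using invariant_form_simple_root_pos[OF sS] by (simp add: \<alpha>_def)
    have "act (s \<otimes> h) (twist v) = simple_act s (v - \<alpha>)"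
      using hc sS vM by (simp add: act_mult act_simple M_def)
    also have "\<dots> = v"
      unfolding simple_act_def root_form_diff half \<alpha>_def root_form_simple_root[OF sS] cox_form_self[OF sS]
      by (intro ext) simp
    finally have fix_v: "act (s \<otimes> h) (twist v) = v" .
    \<comment> \<open>A vector fixed by \<open>M\<close> pairs equally with all members of the
      orbit, whose sum is 0.\<close>
    have "root_form s w = 0" if "w \<in> fixed_space h" for w
    proof -
      have Mw: "M w = w" using that by (simp add: fixed_space_def M_def)
      then have Miw: "(M ^^ i) w = w" for i by (induction i) auto
      have "invariant_form w ((M ^^ i) \<alpha>) = invariant_form w \<alpha>" for i
        using formMi[of i w \<alpha>] Miw by simp
      then have "invariant_form w u = real d * invariant_form w \<alpha>"
        unfolding u_def by (simp add: invariant_form_sum)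
      then have "invariant_form w \<alpha> = 0"
        using True d by (simp add: linear_0[OF linear_invariant_form])
      then show ?thesis
        using invariant_form_simple_root[OF sS, of w] invariant_form_simple_root_pos[OF sS] by (simp add: \<alpha>_def)
    qed
    moreover have "v \<noteq> 0" using half by (auto simp: root_form_def)
    ultimately show ?thesis using that[of s v] vK fix_v half by simp
  qed
qed

text \<open>Fixed dimensions are taken in the whole representation even for small \<open>K\<close>,
  so the bound of the induction hypothesis combines directly with the growth at the present
  stage.\<close>

lemma ex_saturated_chain:
  assumes "K \<subseteq> S" "\<tau> ` K = K" "is_longest K w"
  shows "\<exists>x\<in>generate G K. \<exists>k. (left_cover K ^^ k) x (w \<otimes> \<tau> x) \<and> fixed_dim w + k \<le> fixed_dim \<one>"
  using assms
proof (induction "card K" arbitrary: K w rule: less_induct)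
  case less
  note K = less.prems(1,2) and w = less.prems(3)
  have wK: "w \<in> generate G K" using w by (simp add: is_longest_def)
  have wc: "w \<in> carrier G" using wK K generate_closed by auto
  have finK: "finite K" using K finite_simple finite_subset by blast
  show ?case
  proof (cases "K = {}")
    case True
    then have "w = \<one>" using wK generate_empty by auto
    then show ?thesis using True by (intro bexI[of _ \<one>] exI[of _ 0]) (auto intro: generate.one)
  next
    case False
    then obtain s where s: "s \<in> K" by blast
    have sS: "s \<in> S" using s K by auto
    \<comment> \<open>Both cases run in parallel from here on: \<open>a\<close> is
      \<open>\<one>\<close> if a vector fixed by \<open>w \<tau>\<close> was found, and
      \<open>s\<close> if the simple reflection is needed.\<close>
    obtain a v where a: "a \<in> {\<one>, s}" and v: "v \<in> coord_space K" "v \<noteq> 0"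
      and fix_v: "act (a \<otimes> w) (twist v) = v"
      and as: "a = s \<Longrightarrow> 0 < root_form s v" "a = s \<Longrightarrow> \<forall>u\<in>fixed_space w. root_form s u = 0"
      using fixed_vector_dichotomy[OF K s wK] by blast
    have aK: "a \<in> generate G K" using a s by (auto intro: generate.intros)
    have ac: "a \<in> carrier G" using aK K generate_closed by auto
    obtain z0 where z0: "z0 \<in> generate G K" "dominant K (act (inv z0) v)"
      using ex_dominant[OF K(1)] by blast
    define p where "p = act (inv z0) v"
    have p: "dominant K p" using z0 by (simp add: p_def)
    have pK: "p \<in> coord_space K"
      unfolding p_def using act_coord_space[OF K(1) generate_m_inv[OF K(1) z0(1)] v(1)] .
    have z0c: "z0 \<in> carrier G" using z0 K generate_closed by auto
    then have "act z0 p = v" by (simp add: p_def)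
    \<comment> \<open>The shortest element carrying \<open>p\<close> to \<open>v\<close> is a
      minimal coset representative modulo the stabilizer of \<open>p\<close>; this is
      \<open>zt\<close> below.\<close>
    then obtain z where z: "z \<in> generate G K" "act z p = v"
      and zmin: "\<And>y. y \<in> generate G K \<Longrightarrow> act y p = v \<Longrightarrow> len z \<le> len y"
      using ex_has_least_nat[of "\<lambda>y. y \<in> generate G K \<and> act y p = v" z0 len] z0 by blast
    have zc: "z \<in> carrier G" using z K generate_closed by auto
    have p0: "p \<noteq> 0" using v z act_0 by auto
    define K' where "K' = {t \<in> K. root_form t p = 0}"
    have K'S: "K' \<subseteq> S" "K' \<subseteq> K" using K by (auto simp: K'_def)
    \<comment> \<open>Otherwise \<open>p\<close> would be orthogonal to all roots of
      \<open>K\<close>, whose span contains it.\<close>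
    have "K' \<noteq> K"
    proof
      assume "K' = K"
      have "invariant_form p p = invariant_form p (\<Sum>t\<in>K. p t *\<^sub>R simple_root t)"
        using coord_space_expansion[OF finK pK] by simp
      also have "\<dots> = (\<Sum>t\<in>K. p t * invariant_form p (simple_root t))"
        by (simp only: invariant_form_sum invariant_form_scaleR) simp
      also have "\<dots> = 0"
      proof (rule sum.neutral, rule ballI)
        fix t assume "t \<in> K"
        then have "root_form t p = 0" "t \<in> S" using \<open>K' = K\<close> K by (auto simp: K'_def)
        then show "p t * invariant_form p (simple_root t) = 0"
          using invariant_form_simple_root[of t p] by simp
      qed
      finally show False
        using invariant_form_eq_0[of p] pK coord_space_mono[OF K(1)] p0 by auto
    qed
    then have card: "card K' < card K" using finK K'S by (intro psubset_card_mono) auto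
    \<comment> \<open>Twisted conjugation by \<open>z\<close> transports the fixed vector
      \<open>v\<close> of \<open>a w \<tau>\<close> to \<open>p\<close>, so \<open>b \<tau>\<close>
      fixes \<open>p\<close>.\<close>
    define b where "b = inv z \<otimes> (a \<otimes> w) \<otimes> \<tau> z"
    have tauz: "\<tau> z \<in> generate G K" using generate_aut[OF K(1) z(1)] K(2) by simp
    have bK: "b \<in> generate G K"
      unfolding b_def using generate_m_inv[OF K(1) z(1)] aK wK tauz by (auto intro: generate.eng)
    have bc: "b \<in> carrier G" using bK K generate_closed by auto
    have zb: "z \<otimes> b = a \<otimes> w \<otimes> \<tau> z"
      unfolding b_def using zc ac wc by (simp add: m_assoc flip: m_assoc[of z "inv z"])
    have tw: "dominant K (twist p)"
      unfolding dominant_def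
    proof
      fix t assume "t \<in> K"
      then obtain t' where "t' \<in> K" "t = \<tau> t'" using K by blast
      then show "0 \<le> root_form t (twist p)"
        using p K root_form_twist[of t' p] by (auto simp: dominant_def)
    qed
    have "act (z \<otimes> b) (twist p) = act z p"
      using fix_v zc ac wc unfolding zb z(2)[symmetric] by (simp add: act_mult twist_act)
    then have "act z (act b (twist p)) = act z p" using zc bc by (simp add: act_mult)
    then have bp: "act b (twist p) = p" using act_inv_act zc by metis
    \<comment> \<open>Both \<open>twist p\<close> and its image \<open>p\<close> under
      \<open>b\<close> are dominant; so they coincide, and \<open>b\<close> lies in the stabilizer
      of \<open>p\<close>.\<close>
    have "act b (twist p) = twist p \<and> b \<in> generate G {t \<in> K. root_form t (twist p) = 0}"
      by (rule dominant_orbit[OF K(1) bK tw]) (simp add: bp p)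
    then have tp: "twist p = p" and bK': "b \<in> generate G K'"
      using bp by (auto simp: K'_def)
    have sub: "\<tau> ` K' \<subseteq> K'"
    proof
      fix t assume "t \<in> \<tau> ` K'"
      then obtain t' where t': "t' \<in> K'" "t = \<tau> t'" by blast
      then have "t \<in> K" using K'S K(2) by blast
      moreover have "root_form t p = 0"
        using root_form_twist[of t' p] t' K'S tp by (auto simp: K'_def)
      ultimately show "t \<in> K'" by (simp add: K'_def)
    qed
    have tauK': "\<tau> ` K' = K'"
    proof (rule card_subset_eq[OF _ sub])
      show "finite K'" using finK K'S finite_subset by blast
      show "card (\<tau> ` K') = card K'"
        by (rule card_image) (use bij_aut_simple K'S in \<open>auto simp: bij_betw_def intro: inj_on_subset\<close>)
    qed
    have zt: "len z < len (z \<otimes> t)" if t: "t \<in> K'" for t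
    proof -
      have tS: "t \<in> S" "t \<in> K" using t K'S by auto
      have "act t p = p" using t tS by (simp add: act_simple simple_act_def K'_def)
      then have "act (z \<otimes> t) p = v" using zc tS z by (simp add: act_mult)
      then have "len z \<le> len (z \<otimes> t)"
        using zmin[of "z \<otimes> t"] z tS by (auto intro: generate.intros)
      then show ?thesis using len_mult_simple[OF zc tS(1)] by linarith
    qed
    have lenz: "len (z \<otimes> y) = len z + len y" if "y \<in> generate G K'" for y
      by (rule len_coset_representative[OF K'S(1) that zc zt])
    have K'K: "y \<in> generate G K" if "y \<in> generate G K'" for y
      using that mono_generate[OF K'S(2)] by blast
    \<comment> \<open>As \<open>z y\<close> carries \<open>p\<close> to \<open>v\<close>, which
      pairs positively with the root of \<open>s\<close>, the inverse of \<open>z y\<close> cannot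
      make this root nonpositive: it would pair nonpositively with the dominant \<open>p\<close>. So
      \<open>s\<close> lengthens \<open>z y\<close> on the left.\<close>
    have up: "len (s \<otimes> (z \<otimes> y)) = len (z \<otimes> y) + 1" if a_s: "a = s" and y: "y \<in> generate G K'" for y
    proof -
      have yc: "y \<in> carrier G" using y K'S generate_closed by blast
      have "act y p = p" using act_fix_generate[OF K'S(1) y] by (simp add: K'_def)
      then have zyp: "act (z \<otimes> y) p = v" using zc yc z by (simp add: act_mult)
      define Y where "Y = inv (z \<otimes> y)"
      have Y: "Y \<in> carrier G" "Y \<in> generate G K"
        unfolding Y_def using zc yc generate_m_inv[OF K(1)] z K'K[OF y] by (auto intro: generate.eng)
      have "\<not> len (Y \<otimes> s) < len Y"
      proof
        assume "len (Y \<otimes> s) < len Y"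
        then have neg: "act Y (simple_root s) x \<le> 0" for x
          using act_simple_root_nonpos[OF Y(1) sS] by blast
        have "- act Y (simple_root s) \<in> coord_space K"
          using act_coord_space[OF K(1) Y(2) simple_root_coord_space[OF s]] by (simp add: coord_space_def)
        then have "0 \<le> invariant_form p (- act Y (simple_root s))"
          using neg by (intro dominant_form_nonneg[OF K(1) p]) auto
        also have "\<dots> = - invariant_form (act (z \<otimes> y) p) (act (z \<otimes> y) (act Y (simple_root s)))"
          using zc yc by (simp add: invariant_form_neg invariant_form_act)
        also have "\<dots> = - invariant_form v (simple_root s)"
          using zc yc by (simp add: zyp Y_def)
        finally show False
          using as(1)[OF a_s] invariant_form_simple_root[OF sS, of v] invariant_form_simple_root_pos[OF sS]
          by (simp add: mult_le_0_iff)
      qed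
      then have "len (Y \<otimes> s) = len Y + 1" using len_mult_simple[OF Y(1) sS] by linarith
      moreover have "len (s \<otimes> (z \<otimes> y)) = len (Y \<otimes> s)"
        unfolding Y_def using len_simple_mult sS zc yc by simp
      moreover have "len Y = len (z \<otimes> y)" unfolding Y_def using len_inv zc yc by simp
      ultimately show ?thesis by simp
    qed
    \<comment> \<open>A letter \<open>t = \<tau> t'\<close> after \<open>b\<close> becomes
      \<open>t'\<close> after \<open>z\<close> and lengthens \<open>z\<close>; left multiplication
      by \<open>w\<close> reverses lengths. If \<open>a = s\<close>, the factor \<open>s\<close>
      shifts both compared lengths by one, by \<open>up\<close>.\<close>
    have longest: "is_longest K' b"
      unfolding is_longest_def
    proof (intro conjI ballI bK')
      fix t assume t: "t \<in> K'"
      then obtain t' where t': "t' \<in> K'" "t = \<tau> t'" using tauK' by blast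
      have t'S: "t' \<in> S" "t \<in> S" "t' \<in> K" using t t' K'S by auto
      have bt: "b \<otimes> t \<in> generate G K'" using bK' t by (auto intro: generate.intros)
      have zbt: "z \<otimes> (b \<otimes> t) = a \<otimes> (w \<otimes> \<tau> (z \<otimes> t'))"
        using zb zc bc ac wc t' t'S by (simp flip: m_assoc)
      have zb': "z \<otimes> b = a \<otimes> (w \<otimes> \<tau> z)"
        using zb zc ac wc by (simp add: m_assoc)
      have zt'K: "z \<otimes> t' \<in> generate G K" using z t'S by (auto intro: generate.intros)
      then have "\<tau> (z \<otimes> t') \<in> generate G K" using generate_aut[OF K(1)] K(2) by fastforce
      then have "len (w \<otimes> \<tau> (z \<otimes> t')) + len (\<tau> (z \<otimes> t')) = len w"
        by (rule is_longest_len[OF K(1) w])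
      moreover have "len (w \<otimes> \<tau> z) + len (\<tau> z) = len w"
        by (rule is_longest_len[OF K(1) w tauz])
      moreover have "len (\<tau> (z \<otimes> t')) = len z + 1" "len (\<tau> z) = len z"
        using zt[OF t'(1)] len_mult_simple[OF zc t'S(1)] zc t'S len_aut[of "z \<otimes> t'"] by auto
      ultimately have less: "len (w \<otimes> \<tau> (z \<otimes> t')) < len (w \<otimes> \<tau> z)" by linarith
      have "len (z \<otimes> (b \<otimes> t)) < len (z \<otimes> b)"
      proof (cases "a = s")
        case True
        have "s \<otimes> (z \<otimes> (b \<otimes> t)) = w \<otimes> \<tau> (z \<otimes> t')" "s \<otimes> (z \<otimes> b) = w \<otimes> \<tau> z"
          unfolding zbt zb' True using wc zc t'S sS by (auto intro: simple_cancel_left)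
        then show ?thesis using up[OF True bt] up[OF True bK'] less by simp
      next
        case False
        then have "a = \<one>" using a by simp
        then show ?thesis using less zbt zb' wc zc t'S by simp
      qed
      then show "len (b \<otimes> t) < len b" using lenz[OF bt] lenz[OF bK'] by simp
    qed
    obtain x' k' where x': "x' \<in> generate G K'" "(left_cover K' ^^ k') x' (b \<otimes> \<tau> x')"
      and dim': "fixed_dim b + k' \<le> fixed_dim \<one>"
      using less.hyps[OF card K'S(1) tauK' longest] by blast
    have x'c: "x' \<in> carrier G" using x' K'S generate_closed by auto
    define x where "x = z \<otimes> x'"
    have xK: "x \<in> generate G K" unfolding x_def using z K'K[OF x'(1)] by (intro generate.eng)
    \<comment> \<open>Left translation by \<open>z\<close> conjugates the reflection and adds
      \<open>len z\<close> to both lengths.\<close>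
    have lift: "left_cover K (z \<otimes> u) (z \<otimes> v)" if "left_cover K' u v" for u v
    proof -
      from that obtain t where uv: "u \<in> generate G K'" "v \<in> generate G K'" "t \<in> reflections G S"
          "v = t \<otimes> u" "len v = len u + 1"
        by (auto simp: left_cover_def)
      have c: "u \<in> carrier G" "t \<in> carrier G" using uv K'S generate_closed reflections_closed by auto
      have "z \<otimes> v = z \<otimes> t \<otimes> inv z \<otimes> (z \<otimes> u)"
        using uv c zc by (simp add: m_assoc flip: m_assoc[of "inv z" z])
      then have "\<exists>t\<in>reflections G S. z \<otimes> v = t \<otimes> (z \<otimes> u)"
        using reflections_conj[OF uv(3) zc] by blast
      moreover have "len (z \<otimes> v) = len (z \<otimes> u) + 1"
        using lenz[OF uv(1)] lenz[OF uv(2)] uv(5) by linarith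
      ultimately show ?thesis
        unfolding left_cover_def
        using generate.eng[OF z(1) K'K[OF uv(1)]] generate.eng[OF z(1) K'K[OF uv(2)]] by blast
    qed
    have chain: "(left_cover K ^^ k') x (z \<otimes> (b \<otimes> \<tau> x'))"
      unfolding x_def by (rule relpowp_map[where f = "\<lambda>u. z \<otimes> u" and R = "left_cover K'", OF x'(2)]) (rule lift)
    have taux': "\<tau> x' \<in> generate G K'" using generate_aut[OF K'S(1) x'(1)] tauK' by simp
    \<comment> \<open>For \<open>a = \<one>\<close> this is already the required end of the chain;
      for \<open>a = s\<close> one more cover by \<open>s\<close> leads there.\<close>
    have endpoint: "z \<otimes> (b \<otimes> \<tau> x') = a \<otimes> (w \<otimes> \<tau> x)"
    proof -
      have "z \<otimes> (b \<otimes> \<tau> x') = (z \<otimes> b) \<otimes> \<tau> x'" using zc bc x'c by (simp add: m_assoc)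
      then show ?thesis unfolding zb x_def using zc ac wc x'c by (simp add: m_assoc)
    qed
    have dimb: "fixed_dim b = fixed_dim (a \<otimes> w)"
      using fixed_dim_twisted_conj[of "inv z" "a \<otimes> w"] zc ac wc by (simp add: b_def)
    have xc: "x \<in> carrier G" using xK K generate_closed by auto
    show ?thesis
    proof (cases "a = s")
      case False
      then have a1: "a = \<one>" using a by simp
      then have "(left_cover K ^^ k') x (w \<otimes> \<tau> x)" using chain endpoint wc xc by simp
      moreover have "fixed_dim w + k' \<le> fixed_dim \<one>" using dim' dimb a1 wc by simp
      ultimately show ?thesis using xK by blast
    next
      case True
      have bx: "b \<otimes> \<tau> x' \<in> generate G K'" using bK' taux' by (intro generate.eng)
      have end': "w \<otimes> \<tau> x = s \<otimes> (z \<otimes> (b \<otimes> \<tau> x'))"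
        unfolding endpoint True using wc xc sS by (simp add: simple_cancel_left)
      have "w \<otimes> \<tau> x \<in> generate G K"
        using wK generate_aut[OF K(1) xK] K(2) by (auto intro: generate.eng)
      then have "left_cover K (z \<otimes> (b \<otimes> \<tau> x')) (w \<otimes> \<tau> x)"
        unfolding left_cover_def
        using up[OF True bx] end' simple_reflection[OF sS] generate.eng[OF z(1) K'K[OF bx]] by auto
      with chain have chain': "(left_cover K ^^ Suc k') x (w \<otimes> \<tau> x)" by (rule relpowp_Suc_I)
      have swc: "s \<otimes> w \<in> carrier G" using sS wc by simp
      \<comment> \<open>The vector \<open>v\<close> is fixed by \<open>s w \<tau>\<close> but not by
        \<open>w \<tau>\<close>; the dimension gained pays for the additional cover.\<close>
      have "fixed_space w \<subseteq> fixed_space (s \<otimes> w)"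
      proof
        fix u assume u: "u \<in> fixed_space w"
        then have "root_form s u = 0" using as(2)[OF True] by blast
        then have "act s u = u" using sS by (simp add: act_simple simple_act_def)
        then show "u \<in> fixed_space (s \<otimes> w)" using u sS wc by (simp add: fixed_space_def act_mult)
      qed
      moreover have "v \<in> fixed_space (s \<otimes> w)" using fix_v True by (simp add: fixed_space_def)
      moreover have "v \<notin> fixed_space w" using as[OF True] by auto
      ultimately have "fixed_dim w + 1 \<le> fixed_dim (s \<otimes> w)"
        unfolding fixed_dim_def
        by (intro dim_less_finite_span[OF subspace_fixed_space _ _ _ fixed_space_span[OF swc]]) auto
      then have "fixed_dim w + Suc k' \<le> fixed_dim \<one>" using dim' dimb True by simp
      then show ?thesis using chain' xK by blast
    qed
  qed
qed

end

section \<open>Reflection length of the class of the longest element\<close>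

context finite_coxeter_system
begin

lemma reflection_words_closed: "ts \<in> lists (reflections G S) \<Longrightarrow> ts \<in> lists (carrier G)"
  using reflections_closed by auto

lemma ex_reflection_word:
  assumes "x \<in> carrier G"
  obtains ts where "ts \<in> lists (reflections G S)" "length ts = refl_length G S x" "word_prod G ts = x"
proof -
  obtain ws where ws: "ws \<in> lists S" "word_prod G ws = x"
    using reduced_simple_word assms by blast
  then have "ws \<in> lists (reflections G S)" using simple_reflection by auto
  then show ?thesis
    using reduced_word[of ws "reflections G S" G x] ws that unfolding refl_length_def by blast
qed

lemma word_prod_rev_reflections:
  "ts \<in> lists (reflections G S) \<Longrightarrow> word_prod G (rev ts) = inv (word_prod G ts)"
proof (induction ts)
  case (Cons t ts)
  have "t \<in> carrier G" "ts \<in> lists (carrier G)" "rev ts \<in> lists (carrier G)"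
    using Cons reflection_words_closed[of ts] reflections_closed by (auto simp: in_lists_conv_set)
  then show ?case
    using Cons reflection_inv[of t] word_prod_append[of "rev ts" "[t]"] by (simp add: inv_mult_group)
qed simp

lemma word_prod_conj:
  assumes "x \<in> carrier G"
  shows "ts \<in> lists (carrier G) \<Longrightarrow>
    word_prod G (map (\<lambda>t. x \<otimes> t \<otimes> inv x) ts) = x \<otimes> word_prod G ts \<otimes> inv x"
  using assms by (induction ts) (auto simp: m_assoc simp flip: m_assoc[of "inv x" x])

lemma is_longest_longest_element:
  assumes "longest_element G S w"
  shows "is_longest S w"
  using assms by (intro is_longest_if_maximal) (auto simp: longest_element_def generates)

definition right_cover :: "'a \<Rightarrow> 'a \<Rightarrow> bool" where
  "right_cover u v \<longleftrightarrow> u \<in> carrier G \<and> (\<exists>t\<in>reflections G S. v = u \<otimes> t) \<and> len v = len u + 1"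

lemma right_cover_left_cover:
  assumes "left_cover S u v"
  shows "right_cover u v"
proof -
  obtain t where t: "t \<in> reflections G S" "v = t \<otimes> u" "len v = len u + 1" "u \<in> carrier G"
    using assms generates by (auto simp: left_cover_def)
  have "inv u \<otimes> t \<otimes> u \<in> reflections G S"
    using reflections_conj[OF t(1), of "inv u"] t(4) by simp
  moreover have "v = u \<otimes> (inv u \<otimes> t \<otimes> u)"
    using t reflections_closed by (simp flip: m_assoc)
  ultimately show ?thesis using t unfolding right_cover_def by blast
qed

lemma bruhat_step_right_cover: "right_cover u v \<Longrightarrow> bruhat_step G S u v"
  unfolding right_cover_def bruhat_step_def by auto

lemma len_right_cover_chain: "(right_cover ^^ n) u v \<Longrightarrow> len v = len u + n"
  by (induction n arbitrary: v) (auto simp: right_cover_def)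

text \<open>A Bruhat step may raise the length by more than one, so the number of reflections is
  only bounded by the length difference.\<close>

lemma bruhat_le_reflection_word:
  assumes "bruhat_le G S x y" "x \<in> carrier G"
  obtains ts where "ts \<in> lists (reflections G S)" "y = x \<otimes> word_prod G ts" "len x + length ts \<le> len y"
proof -
  from assms(1) have "\<exists>ts\<in>lists (reflections G S). y = x \<otimes> word_prod G ts \<and> len x + length ts \<le> len y"
    unfolding bruhat_le_def
  proof (induction rule: rtranclp_induct)
    case base
    show ?case using assms by (intro bexI[of _ "[]"]) auto
  next
    case (step y z)
    then obtain ts where ts: "ts \<in> lists (reflections G S)" "y = x \<otimes> word_prod G ts"
        "len x + length ts \<le> len y"
      by blast
    obtain t where t: "t \<in> reflections G S" "z = y \<otimes> t" "len y < len z"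
      using step.hyps by (auto simp: bruhat_step_def)
    have "z = x \<otimes> word_prod G (ts @ [t])"
      using ts t assms(2) reflection_words_closed[OF ts(1)] reflections_closed
      by (simp add: word_prod_append m_assoc)
    then show ?case using ts t by (intro bexI[of _ "ts @ [t]"]) auto
  qed
  then show ?thesis using that by blast
qed

end

lemma (in twisted_coxeter_system) fixed_dim_reflection_word_mult:
  assumes "ts \<in> lists (reflections G S)" "h \<in> carrier G"
  shows "fixed_dim (word_prod G ts \<otimes> h) \<le> fixed_dim h + length ts"
  using assms(1)
proof (induction ts)
  case Nil
  then show ?case using assms by simp
next
  case (Cons t ts)
  have "ts \<in> lists (carrier G)" "t \<in> carrier G"
    using Cons reflection_words_closed reflections_closed by auto
  then have "word_prod G (t # ts) \<otimes> h = t \<otimes> (word_prod G ts \<otimes> h)" "word_prod G ts \<otimes> h \<in> carrier G"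
    using assms by (simp_all add: m_assoc)
  then show ?case using fixed_dim_reflection_mult[of t "word_prod G ts \<otimes> h"] Cons by simp
qed

context finite_coxeter_system
begin

text \<open>Left and right multiplication by the longest element both reverse lengths, so together
  they preserve them; injectivity gives bijectivity on a finite group.\<close>

lemma longest_conj_length_preserving:
  assumes w: "is_longest S w" and \<sigma>: "length_preserving_aut G S \<sigma>"
  shows "length_preserving_aut G S (\<lambda>x. w \<otimes> \<sigma> x \<otimes> w)"
proof -
  have wc: "w \<in> carrier G" using w generates by (auto simp: is_longest_def)
  have ww: "w \<otimes> w = \<one>" using is_longest_inv[OF subset_refl w] wc r_inv by metis
  have \<sigma>_hom: "\<sigma> \<in> hom G G" and \<sigma>_bij: "bij_betw \<sigma> (carrier G) (carrier G)"
    and \<sigma>_len: "\<And>x. x \<in> carrier G \<Longrightarrow> len (\<sigma> x) = len x"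
    using \<sigma> by (auto simp: length_preserving_aut_def iso_def)
  have \<sigma>_closed: "\<sigma> x \<in> carrier G" if "x \<in> carrier G" for x
    using \<sigma>_hom that by (auto simp: hom_def)
  have ww': "w \<otimes> (w \<otimes> x) = x" if "x \<in> carrier G" for x
    using that wc ww by (simp flip: m_assoc)
  have hom: "(\<lambda>x. w \<otimes> \<sigma> x \<otimes> w) \<in> hom G G"
    using \<sigma>_hom wc \<sigma>_closed by (auto simp: hom_def m_assoc ww')
  have "inj_on (\<lambda>x. w \<otimes> \<sigma> x \<otimes> w) (carrier G)"
    using \<sigma>_bij wc \<sigma>_closed by (auto simp: inj_on_def bij_betw_def)
  moreover have "(\<lambda>x. w \<otimes> \<sigma> x \<otimes> w) ` carrier G \<subseteq> carrier G"
    using wc \<sigma>_closed by auto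
  ultimately have "bij_betw (\<lambda>x. w \<otimes> \<sigma> x \<otimes> w) (carrier G) (carrier G)"
    using endo_inj_surj[OF finite_carrier] by (simp add: bij_betw_def)
  moreover have "len (w \<otimes> \<sigma> x \<otimes> w) = len x" if x: "x \<in> carrier G" for x
  proof -
    have L: "len (w \<otimes> y) + len y = len w" if "y \<in> carrier G" for y
      using is_longest_len[OF subset_refl w] that generates by simp
    have "inv (\<sigma> x \<otimes> w) = w \<otimes> inv (\<sigma> x)"
      using wc \<sigma>_closed x is_longest_inv[OF subset_refl w] by (simp add: inv_mult_group)
    then have "len (\<sigma> x \<otimes> w) = len (w \<otimes> inv (\<sigma> x))"
      using len_inv[of "\<sigma> x \<otimes> w"] wc \<sigma>_closed x by simp
    then show ?thesis
      using L[of "\<sigma> x \<otimes> w"] L[of "inv (\<sigma> x)"] len_inv[of "\<sigma> x"] \<sigma>_len[OF x] \<sigma>_closed[OF x] wc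
      by (simp add: m_assoc)
  qed
  ultimately show ?thesis using hom by (simp add: length_preserving_aut_def iso_def)
qed

text \<open>The same \<open>x\<close> and \<open>k\<close> serve all assertions. The clause on
  \<open>ts\<close> bounds any product of reflections leading from \<open>y\<close> to
  \<open>\<sigma> y \<otimes> w\<close>, whatever the lengths along the way, and thus covers
  downward edges of the quantum Bruhat graph too.\<close>

lemma reflection_length_longest_class:
  assumes longest: "longest_element G S w" and \<sigma>: "length_preserving_aut G S \<sigma>"
  obtains x k where
    "x \<in> carrier G" "(right_cover ^^ k) x (\<sigma> x \<otimes> w)" "len w = 2 * len x + k"
    "set_refl_length G S (twisted_class G \<sigma> w) = k"
    "\<And>y ts. y \<in> carrier G \<Longrightarrow> ts \<in> lists (reflections G S) \<Longrightarrow> \<sigma> y \<otimes> w = y \<otimes> word_prod G ts \<Longrightarrow> k \<le> length ts"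
    "Max {len x | x. x \<in> carrier G \<and> bruhat_le G S x (\<sigma> x \<otimes> w)} = len x"
proof -
  have w: "is_longest S w" using longest by (rule is_longest_longest_element)
  have wc: "w \<in> carrier G" using longest by (simp add: longest_element_def)
  have inv_w: "inv w = w" using is_longest_inv[OF subset_refl w] .
  have ww: "w \<otimes> w = \<one>" using inv_w wc r_inv by metis
  have ww': "w \<otimes> (w \<otimes> x) = x" if "x \<in> carrier G" for x
    using that wc ww by (simp flip: m_assoc)
  define \<tau> where "\<tau> = (\<lambda>x. w \<otimes> \<sigma> x \<otimes> w)"
  interpret T: twisted_coxeter_system G S \<tau>
    by unfold_locales (simp add: \<tau>_def longest_conj_length_preserving[OF w \<sigma>])
  have \<sigma>_closed: "\<sigma> x \<in> carrier G" if "x \<in> carrier G" for x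
    using \<sigma> that by (auto simp: length_preserving_aut_def iso_def hom_def)
  have \<sigma>_len: "len (\<sigma> x) = len x" if "x \<in> carrier G" for x
    using \<sigma> that by (auto simp: length_preserving_aut_def)
  have F: "w \<otimes> \<tau> x = \<sigma> x \<otimes> w" if "x \<in> carrier G" for x
    using that wc \<sigma>_closed by (simp add: \<tau>_def m_assoc ww')
  have lenF: "len (\<sigma> x \<otimes> w) + len x = len w" if "x \<in> carrier G" for x
    using is_longest_len[OF subset_refl w, of "\<tau> x"] that generates F[OF that] by simp
  obtain x k where x: "x \<in> carrier G" and chain: "(left_cover S ^^ k) x (w \<otimes> \<tau> x)"
    and dim: "T.fixed_dim w + k \<le> T.fixed_dim \<one>"
    using T.ex_saturated_chain[OF subset_refl T.aut_simple_image w] generates by auto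
  have chain': "(right_cover ^^ k) x (\<sigma> x \<otimes> w)"
    using relpowp_map[where f = id and R = "left_cover S", OF chain] right_cover_left_cover F[OF x] by auto
  \<comment> \<open>Each cover adds one, and the end of the chain has length
    \<open>len w - len x\<close>.\<close>
  have N: "len w = 2 * len x + k"
    using len_right_cover_chain[OF chain'] lenF[OF x] by linarith
  \<comment> \<open>A reflection word for the class element, times \<open>w\<close>, is
    \<open>y \<otimes> inv (\<tau> y)\<close>, a twisted conjugate of \<open>\<one>\<close>. So its
    reflections must raise the fixed dimension from that of \<open>w\<close> to that of
    \<open>\<one>\<close>.\<close>
  have lower: "k \<le> refl_length G S (y \<otimes> w \<otimes> inv (\<sigma> y))" if y: "y \<in> carrier G" for y
  proof -
    have c: "y \<otimes> w \<otimes> inv (\<sigma> y) \<in> carrier G" using y wc \<sigma>_closed by simp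
    obtain ts where ts: "ts \<in> lists (reflections G S)"
        "length ts = refl_length G S (y \<otimes> w \<otimes> inv (\<sigma> y))" "word_prod G ts = y \<otimes> w \<otimes> inv (\<sigma> y)"
      by (rule ex_reflection_word[OF c])
    have "inv (\<tau> y) = w \<otimes> inv (\<sigma> y) \<otimes> w"
      using y wc \<sigma>_closed inv_w by (simp add: \<tau>_def inv_mult_group m_assoc)
    then have "word_prod G ts \<otimes> w = y \<otimes> \<one> \<otimes> inv (\<tau> y)"
      unfolding ts(3) using y wc \<sigma>_closed by (simp add: m_assoc)
    then have "T.fixed_dim \<one> = T.fixed_dim (word_prod G ts \<otimes> w)"
      using T.fixed_dim_twisted_conj[of y \<one>] y by simp
    also have "\<dots> \<le> T.fixed_dim w + length ts"
      by (rule T.fixed_dim_reflection_word_mult[OF ts(1) wc])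
    finally show ?thesis using dim ts(2) by linarith
  qed
  \<comment> \<open>The class element is the conjugate by \<open>y\<close> of the inverse of
    \<open>word_prod G ts\<close>; reversing the word and conjugating its letters keeps their
    number.\<close>
  have upper: "refl_length G S (y \<otimes> w \<otimes> inv (\<sigma> y)) \<le> length ts"
    if y: "y \<in> carrier G" and ts: "ts \<in> lists (reflections G S)" "\<sigma> y \<otimes> w = y \<otimes> word_prod G ts" for y ts
  proof -
    have tsc: "ts \<in> lists (carrier G)" "rev ts \<in> lists (carrier G)"
      using ts reflection_words_closed by (auto simp: in_lists_conv_set)
    define us where "us = map (\<lambda>t. y \<otimes> t \<otimes> inv y) (rev ts)"
    have "us \<in> lists (reflections G S)"
      using ts reflections_conj y by (auto simp: us_def in_lists_conv_set)
    moreover have "word_prod G us = y \<otimes> w \<otimes> inv (\<sigma> y)"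
    proof -
      have "word_prod G us = y \<otimes> inv (y \<otimes> word_prod G ts)"
        unfolding us_def word_prod_conj[OF y tsc(2)] word_prod_rev_reflections[OF ts(1)]
        using y tsc by (simp add: inv_mult_group m_assoc)
      also have "\<dots> = y \<otimes> w \<otimes> inv (\<sigma> y)"
        unfolding ts(2)[symmetric] using y wc \<sigma>_closed inv_w by (simp add: inv_mult_group m_assoc)
      finally show ?thesis .
    qed
    ultimately show ?thesis
      using word_length_le[of us "reflections G S" G] unfolding refl_length_def by (simp add: us_def)
  qed
  \<comment> \<open>An ascending chain from \<open>y\<close> has at most
    \<open>len w - 2 * len y\<close> steps, since \<open>\<sigma> y \<otimes> w\<close> has length
    \<open>len w - len y\<close>.\<close>
  have bruhat: "refl_length G S (y \<otimes> w \<otimes> inv (\<sigma> y)) + 2 * len y \<le> len w"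
    if y: "y \<in> carrier G" "bruhat_le G S y (\<sigma> y \<otimes> w)" for y
  proof -
    obtain ts where "ts \<in> lists (reflections G S)" "\<sigma> y \<otimes> w = y \<otimes> word_prod G ts"
        "len y + length ts \<le> len (\<sigma> y \<otimes> w)"
      using bruhat_le_reflection_word[OF y(2,1)] by blast
    then show ?thesis using upper[OF y(1)] lenF[OF y(1)] by fastforce
  qed
  have x_le: "bruhat_le G S x (\<sigma> x \<otimes> w)"
    unfolding bruhat_le_def
    by (rule relpowp_imp_rtranclp[of k])
      (use relpowp_map[where f = id and R = right_cover and R' = "bruhat_step G S", OF chain']
        bruhat_step_right_cover in auto)
  have "Max {len x | x. x \<in> carrier G \<and> bruhat_le G S x (\<sigma> x \<otimes> w)} = len x"
  proof (rule Max_eqI)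
    show "finite {len x | x. x \<in> carrier G \<and> bruhat_le G S x (\<sigma> x \<otimes> w)}"
      using finite_carrier by simp
    show "len x \<in> {len x | x. x \<in> carrier G \<and> bruhat_le G S x (\<sigma> x \<otimes> w)}"
      using x x_le by blast
    \<comment> \<open>For every such element \<open>y\<close>,
      \<open>k + 2 * len y \<le> len w = 2 * len x + k\<close>.\<close>
    fix l assume "l \<in> {len x | x. x \<in> carrier G \<and> bruhat_le G S x (\<sigma> x \<otimes> w)}"
    then show "l \<le> len x" using bruhat lower N by fastforce
  qed
  moreover have "set_refl_length G S (twisted_class G \<sigma> w) = k"
    unfolding set_refl_length_def
  proof (rule Min_eqI)
    have "twisted_class G \<sigma> w = (\<lambda>x. x \<otimes> w \<otimes> inv (\<sigma> x)) ` carrier G"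
      by (auto simp: twisted_class_def)
    then show "finite (refl_length G S ` twisted_class G \<sigma> w)" using finite_carrier by simp
    show "k \<le> l" if "l \<in> refl_length G S ` twisted_class G \<sigma> w" for l
      using that lower by (auto simp: twisted_class_def)
    have "refl_length G S (x \<otimes> w \<otimes> inv (\<sigma> x)) = k"
      using bruhat[OF x x_le] lower[OF x] N by linarith
    then show "k \<in> refl_length G S ` twisted_class G \<sigma> w"
      using x by (auto simp: twisted_class_def intro!: image_eqI)
  qed
  moreover have "k \<le> length ts" if "y \<in> carrier G" "ts \<in> lists (reflections G S)" "\<sigma> y \<otimes> w = y \<otimes> word_prod G ts" for y ts
    using lower[OF that(1)] upper[OF that] by linarith
  ultimately show ?thesis using that x chain' N by blast
qed

end

section \<open>Root systems and the quantum Bruhat graph\<close>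

lemma coroot_inner: "coroot \<alpha> \<bullet> v = 2 * (\<alpha> \<bullet> v) / (\<alpha> \<bullet> \<alpha>)"
  by (simp add: coroot_def)

lemma linear_root_reflection: "linear (root_reflection \<alpha>)"
  by (rule linearI) (simp_all add: root_reflection_def inner_add_right algebra_simps)

lemma inner_root_reflection: "root_reflection \<alpha> u \<bullet> root_reflection \<alpha> v = u \<bullet> v"
proof (cases "\<alpha> = 0")
  case False
  then have "\<alpha> \<bullet> \<alpha> \<noteq> 0" by simp
  then show ?thesis
    by (simp add: root_reflection_def coroot_def inner_diff_left inner_diff_right inner_commute field_simps)
qed (simp add: root_reflection_def)

lemma root_reflection_self: "\<alpha> \<noteq> 0 \<Longrightarrow> root_reflection \<alpha> \<alpha> = - \<alpha>"
  by (simp add: root_reflection_def coroot_inner scaleR_2)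

lemma root_reflection_involution [simp]: "root_reflection \<alpha> (root_reflection \<alpha> v) = v"
proof (cases "\<alpha> = 0")
  case False
  have "coroot \<alpha> \<bullet> \<alpha> = 2" using False by (simp add: coroot_inner)
  then show ?thesis by (simp add: root_reflection_def inner_diff_right algebra_simps)
qed (simp add: root_reflection_def)

lemma root_reflection_uminus: "root_reflection (- \<alpha>) = root_reflection \<alpha>"
  by (simp add: root_reflection_def coroot_def fun_eq_iff)

lemma root_reflection_isometry_image:
  assumes "linear f" "\<And>u v. f u \<bullet> f v = u \<bullet> v"
  shows "root_reflection (f \<alpha>) (f v) = f (root_reflection \<alpha> v)"
  by (simp add: root_reflection_def coroot_inner assms linear_diff linear_scale)

lemma root_reflection_Bij: "root_reflection \<alpha> \<in> carrier (BijGroup UNIV)"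
  unfolding BijGroup_def Bij_def
  by (auto intro!: bij_betw_byWitness[where f' = "root_reflection \<alpha>"])

lemma BijGroup_UNIV_mult:
  "f \<in> carrier (BijGroup UNIV) \<Longrightarrow> g \<in> carrier (BijGroup UNIV) \<Longrightarrow> f \<otimes>\<^bsub>BijGroup UNIV\<^esub> g = f \<circ> g"
  by (auto simp: BijGroup_def compose_def fun_eq_iff)

lemma BijGroup_UNIV_one: "\<one>\<^bsub>BijGroup UNIV\<^esub> = id"
  by (auto simp: BijGroup_def)

lemma root_reflection_BijGroup_inv:
  "inv\<^bsub>BijGroup UNIV\<^esub> (root_reflection \<alpha>) = root_reflection \<alpha>"
  by (rule group.inv_equality[OF group_BijGroup])
    (simp_all add: root_reflection_Bij BijGroup_UNIV_mult BijGroup_UNIV_one fun_eq_iff)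

lemma carrier_weyl_group:
  "carrier (weyl_group \<Phi>) = generate (BijGroup UNIV) (root_reflection ` \<Phi>)"
proof -
  have "carrier (BijGroup UNIV) \<inter> root_reflection ` \<Phi> = root_reflection ` \<Phi>"
    using root_reflection_Bij by blast
  then show ?thesis by (simp add: weyl_group_def carrier_subgroup_generated)
qed

lemma group_weyl_group: "group (weyl_group \<Phi>)"
  unfolding weyl_group_def by (rule group.group_subgroup_generated[OF group_BijGroup])

lemma weyl_group_Bij: "w \<in> carrier (weyl_group \<Phi>) \<Longrightarrow> w \<in> carrier (BijGroup UNIV)"
  using group.generate_in_carrier[OF group_BijGroup] root_reflection_Bij
  unfolding carrier_weyl_group by (metis image_subsetI)

lemma weyl_group_mult:
  "v \<in> carrier (weyl_group \<Phi>) \<Longrightarrow> w \<in> carrier (weyl_group \<Phi>) \<Longrightarrow> v \<otimes>\<^bsub>weyl_group \<Phi>\<^esub> w = v \<circ> w"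
  using BijGroup_UNIV_mult[OF weyl_group_Bij weyl_group_Bij] by (simp add: weyl_group_def)

lemma weyl_group_one: "\<one>\<^bsub>weyl_group \<Phi>\<^esub> = id"
  by (simp add: weyl_group_def BijGroup_UNIV_one)

lemma id_weyl_group: "id \<in> carrier (weyl_group \<Phi>)"
  using monoid.one_closed[OF group.is_monoid[OF group_weyl_group[of \<Phi>]]] weyl_group_one[of \<Phi>] by simp

lemma root_reflection_weyl_group: "\<alpha> \<in> \<Phi> \<Longrightarrow> root_reflection \<alpha> \<in> carrier (weyl_group \<Phi>)"
  unfolding carrier_weyl_group by (intro generate.incl imageI)

section \<open>Positive systems and simple roots\<close>

locale positive_system =
  fixes \<Phi> P :: "'v::euclidean_space set"
  assumes root_system: "reduced_root_system \<Phi>" and positive: "positive_roots \<Phi> P"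
begin

lemma finite_roots: "finite \<Phi>" and nonzero: "\<alpha> \<in> \<Phi> \<Longrightarrow> \<alpha> \<noteq> 0"
  and reflection_root: "\<alpha> \<in> \<Phi> \<Longrightarrow> \<beta> \<in> \<Phi> \<Longrightarrow> root_reflection \<alpha> \<beta> \<in> \<Phi>"
  and integral: "\<alpha> \<in> \<Phi> \<Longrightarrow> \<beta> \<in> \<Phi> \<Longrightarrow> coroot \<alpha> \<bullet> \<beta> \<in> \<int>"
  and reduced: "\<alpha> \<in> \<Phi> \<Longrightarrow> c *\<^sub>R \<alpha> \<in> \<Phi> \<Longrightarrow> c = 1 \<or> c = - 1"
  using root_system by (auto simp: reduced_root_system_def)

lemma uminus_root: "\<alpha> \<in> \<Phi> \<Longrightarrow> - \<alpha> \<in> \<Phi>"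
  using reflection_root[of \<alpha> \<alpha>] root_reflection_self[OF nonzero] by simp

lemma weyl_group_isometry:
  assumes "w \<in> carrier (weyl_group \<Phi>)"
  shows "linear w \<and> (\<forall>u v. w u \<bullet> w v = u \<bullet> v) \<and> w ` \<Phi> \<subseteq> \<Phi>"
  using assms unfolding carrier_weyl_group
proof (induction rule: generate.induct)
  case one
  then show ?case by (simp add: BijGroup_UNIV_one linear_iff)
next
  case (incl h)
  then show ?case using linear_root_reflection inner_root_reflection reflection_root by auto
next
  case (inv h)
  then show ?case
    using linear_root_reflection inner_root_reflection reflection_root by (auto simp: root_reflection_BijGroup_inv)
next
  case (eng h1 h2)
  then have "h1 \<in> carrier (BijGroup UNIV)" "h2 \<in> carrier (BijGroup UNIV)"
    using weyl_group_Bij unfolding carrier_weyl_group by blast+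
  then have h12: "h1 \<otimes>\<^bsub>BijGroup UNIV\<^esub> h2 = h1 \<circ> h2" by (rule BijGroup_UNIV_mult)
  show ?case
    unfolding h12
  proof (intro conjI)
    show "linear (h1 \<circ> h2)" using eng.IH by (intro linear_compose) auto
  qed (use eng.IH in \<open>auto simp: image_subset_iff\<close>)
qed

text \<open>A fixed regular vector defining \<open>P\<close>; its inner product with a positive root
  serves as a height.\<close>

definition direction :: 'v where
  "direction = (SOME v. (\<forall>\<alpha>\<in>\<Phi>. v \<bullet> \<alpha> \<noteq> 0) \<and> P = {\<alpha>\<in>\<Phi>. v \<bullet> \<alpha> > 0})"

lemma direction: "\<alpha> \<in> \<Phi> \<Longrightarrow> direction \<bullet> \<alpha> \<noteq> 0" "P = {\<alpha>\<in>\<Phi>. direction \<bullet> \<alpha> > 0}"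
proof -
  have "(\<forall>\<alpha>\<in>\<Phi>. direction \<bullet> \<alpha> \<noteq> 0) \<and> P = {\<alpha>\<in>\<Phi>. direction \<bullet> \<alpha> > 0}"
    unfolding direction_def by (rule someI_ex) (use positive in \<open>simp add: positive_roots_def\<close>)
  then show "\<alpha> \<in> \<Phi> \<Longrightarrow> direction \<bullet> \<alpha> \<noteq> 0" "P = {\<alpha>\<in>\<Phi>. direction \<bullet> \<alpha> > 0}" by blast+
qed

lemma positive_root: "\<alpha> \<in> P \<Longrightarrow> \<alpha> \<in> \<Phi>" "\<alpha> \<in> P \<Longrightarrow> 0 < direction \<bullet> \<alpha>"
  using direction by auto

lemma positive_or_negative: "\<alpha> \<in> \<Phi> \<Longrightarrow> \<alpha> \<in> P \<or> - \<alpha> \<in> P"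
  using direction(1)[of \<alpha>] uminus_root[of \<alpha>] by (subst (1 2) direction(2)) auto

lemma not_positive_uminus: "\<alpha> \<in> P \<Longrightarrow> - \<alpha> \<notin> P"
  using positive_root(2)[of \<alpha>] positive_root(2)[of "- \<alpha>"] by auto

lemma finite_positive: "finite P"
  using finite_roots by (subst direction(2)) simp

abbreviation "\<Delta> \<equiv> simple_roots P"

lemma simple_positive: "\<delta> \<in> \<Delta> \<Longrightarrow> \<delta> \<in> P"
  by (simp add: simple_roots_def)

lemma finite_simple_roots: "finite \<Delta>"
  using finite_positive simple_positive finite_subset by (metis subsetI)

text \<open>Induction on the height, which is real; it is well founded because only finitely many
  positive roots lie below a given one.\<close>

lemma positive_induct [consumes 1, case_names less]:
  assumes "\<alpha> \<in> P"
    and "\<And>\<alpha>. \<alpha> \<in> P \<Longrightarrow> (\<And>\<beta>. \<beta> \<in> P \<Longrightarrow> direction \<bullet> \<beta> < direction \<bullet> \<alpha> \<Longrightarrow> Q \<beta>) \<Longrightarrow> Q \<alpha>"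
  shows "Q \<alpha>"
  using assms(1)
proof (induction "card {\<beta>\<in>P. direction \<bullet> \<beta> < direction \<bullet> \<alpha>}" arbitrary: \<alpha> rule: less_induct)
  case less
  show ?case
  proof (rule assms(2)[OF less.prems])
    fix \<beta> assume "\<beta> \<in> P" "direction \<bullet> \<beta> < direction \<bullet> \<alpha>"
    then show "Q \<beta>"
      using finite_positive by (intro less.hyps psubset_card_mono) auto
  qed
qed

text \<open>A positive root that is not simple is a sum of two positive roots of smaller
  height.\<close>

lemma positive_combination:
  assumes "\<alpha> \<in> P"
  obtains c where "\<And>\<delta>. 0 \<le> c \<delta>" "\<alpha> = (\<Sum>\<delta>\<in>\<Delta>. c \<delta> *\<^sub>R \<delta>)"
proof -
  from assms have "\<exists>c. (\<forall>\<delta>. 0 \<le> c \<delta>) \<and> \<alpha> = (\<Sum>\<delta>\<in>\<Delta>. c \<delta> *\<^sub>R \<delta>)"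
  proof (induction rule: positive_induct)
    case (less \<alpha>)
    show ?case
    proof (cases "\<alpha> \<in> \<Delta>")
      case True
      have "(\<Sum>\<delta>\<in>\<Delta>. of_bool (\<delta> = \<alpha>) *\<^sub>R \<delta>) = (\<Sum>\<delta>\<in>\<Delta>. if \<delta> = \<alpha> then \<delta> else 0)"
        by (rule sum.cong) auto
      then show ?thesis
        using True finite_simple_roots by (intro exI[of _ "\<lambda>\<delta>. of_bool (\<delta> = \<alpha>)"]) simp
    next
      case False
      then obtain \<beta> \<gamma> where bg: "\<beta> \<in> P" "\<gamma> \<in> P" "\<alpha> = \<beta> + \<gamma>"
        using less.hyps by (auto simp: simple_roots_def)
      then have "direction \<bullet> \<beta> < direction \<bullet> \<alpha>" "direction \<bullet> \<gamma> < direction \<bullet> \<alpha>"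
        using positive_root(2) by (auto simp: inner_add_right)
      then obtain c d where "\<forall>\<delta>. 0 \<le> c \<delta>" "\<beta> = (\<Sum>\<delta>\<in>\<Delta>. c \<delta> *\<^sub>R \<delta>)"
          "\<forall>\<delta>. 0 \<le> d \<delta>" "\<gamma> = (\<Sum>\<delta>\<in>\<Delta>. d \<delta> *\<^sub>R \<delta>)"
        using less.IH bg by metis
      then show ?thesis
        using bg by (intro exI[of _ "\<lambda>\<delta>. c \<delta> + d \<delta>"]) (simp add: scaleR_add_left sum.distrib)
    qed
  qed
  then show ?thesis using that by blast
qed

lemma simple_difference_not_root:
  assumes "\<alpha> \<in> \<Delta>" "\<beta> \<in> \<Delta>"
  shows "\<beta> - \<alpha> \<notin> \<Phi>"
proof
  assume "\<beta> - \<alpha> \<in> \<Phi>"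
  then consider "\<beta> - \<alpha> \<in> P" | "\<alpha> - \<beta> \<in> P" using positive_or_negative by fastforce
  then show False
  proof cases
    case 1
    have "\<beta> = \<alpha> + (\<beta> - \<alpha>)" by simp
    then show ?thesis using 1 assms unfolding simple_roots_def by blast
  next
    case 2
    have "\<alpha> = \<beta> + (\<alpha> - \<beta>)" by simp
    then show ?thesis using 2 assms unfolding simple_roots_def by blast
  qed
qed

text \<open>If the inner product were positive, one of the two Cartan integers would be 1 by the strict
  Cauchy-Schwarz inequality, and the difference of the two simple roots would be a root.\<close>

lemma simple_obtuse:
  assumes \<alpha>: "\<alpha> \<in> \<Delta>" and \<beta>: "\<beta> \<in> \<Delta>" and "\<alpha> \<noteq> \<beta>"
  shows "\<alpha> \<bullet> \<beta> \<le> 0"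
proof (rule ccontr)
  assume "\<not> ?thesis"
  then have pos: "0 < \<alpha> \<bullet> \<beta>" by simp
  have roots: "\<alpha> \<in> P" "\<beta> \<in> P" "\<alpha> \<in> \<Phi>" "\<beta> \<in> \<Phi>"
    using \<alpha> \<beta> simple_positive positive_root by auto
  have nz: "0 < \<alpha> \<bullet> \<alpha>" "0 < \<beta> \<bullet> \<beta>" using roots nonzero by auto
  obtain k l where kl: "coroot \<alpha> \<bullet> \<beta> = of_int k" "coroot \<beta> \<bullet> \<alpha> = of_int l"
    using integral roots by (metis Ints_cases)
  have "coroot \<alpha> \<bullet> \<beta> > 0" "coroot \<beta> \<bullet> \<alpha> > 0"
    using pos nz by (simp_all add: coroot_inner inner_commute[of \<beta> \<alpha>])
  then have kl_pos: "0 < k" "0 < l" using kl by simp_all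
  \<comment> \<open>Equality would make \<open>\<beta>\<close> a positive multiple of
    \<open>\<alpha>\<close>, and reducedness leaves only \<open>\<beta> = \<alpha>\<close>.\<close>
  have strict: "(\<alpha> \<bullet> \<beta>)\<^sup>2 < (\<alpha> \<bullet> \<alpha>) * (\<beta> \<bullet> \<beta>)"
  proof (rule ccontr)
    assume "\<not> ?thesis"
    then have "(\<alpha> \<bullet> \<beta>)\<^sup>2 = (\<alpha> \<bullet> \<alpha>) * (\<beta> \<bullet> \<beta>)" using Cauchy_Schwarz_ineq[of \<alpha> \<beta>] by simp
    then have "(\<beta> - ((\<alpha> \<bullet> \<beta>) / (\<alpha> \<bullet> \<alpha>)) *\<^sub>R \<alpha>) \<bullet> (\<beta> - ((\<alpha> \<bullet> \<beta>) / (\<alpha> \<bullet> \<alpha>)) *\<^sub>R \<alpha>) = 0"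
      using nz by (simp add: inner_diff_left inner_diff_right inner_commute power2_eq_square field_simps)
    then have eq: "\<beta> = ((\<alpha> \<bullet> \<beta>) / (\<alpha> \<bullet> \<alpha>)) *\<^sub>R \<alpha>" by simp
    then have "(\<alpha> \<bullet> \<beta>) / (\<alpha> \<bullet> \<alpha>) = 1 \<or> (\<alpha> \<bullet> \<beta>) / (\<alpha> \<bullet> \<alpha>) = - 1"
      using reduced roots by metis
    moreover have "(\<alpha> \<bullet> \<beta>) / (\<alpha> \<bullet> \<alpha>) > 0" using pos nz by simp
    ultimately have "(\<alpha> \<bullet> \<beta>) / (\<alpha> \<bullet> \<alpha>) = 1" by linarith
    then show False using eq \<open>\<alpha> \<noteq> \<beta>\<close> by (metis scaleR_one)
  qed
  have "of_int (k * l) = 4 * (\<alpha> \<bullet> \<beta>)\<^sup>2 / ((\<alpha> \<bullet> \<alpha>) * (\<beta> \<bullet> \<beta>))"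
    unfolding of_int_mult kl[symmetric] coroot_inner by (simp add: inner_commute power2_eq_square)
  also have "\<dots> < 4" using strict nz by (simp add: field_simps)
  finally have "real_of_int (k * l) < real_of_int 4" by simp
  then have "k * l < 4" by (simp only: of_int_less_iff)
  then have "k = 1 \<or> l = 1"
  proof (rule contrapos_pp)
    assume "\<not> (k = 1 \<or> l = 1)"
    then have "2 \<le> k" "2 \<le> l" using kl_pos by auto
    then have "2 * 2 \<le> k * l" by (intro mult_mono) auto
    then show "\<not> k * l < 4" by simp
  qed
  then show False
  proof
    assume "k = 1"
    then have "root_reflection \<alpha> \<beta> = \<beta> - \<alpha>" using kl by (simp add: root_reflection_def)
    then show False using reflection_root[of \<alpha> \<beta>] roots simple_difference_not_root[OF \<alpha> \<beta>] by simp
  next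
    assume "l = 1"
    then have "root_reflection \<beta> \<alpha> = \<alpha> - \<beta>" using kl by (simp add: root_reflection_def)
    then show False using reflection_root[of \<beta> \<alpha>] roots simple_difference_not_root[OF \<beta> \<alpha>] by simp
  qed
qed

text \<open>If the image were negative, \<open>\<alpha>\<close> minus its image, a multiple of
  \<open>\<beta>\<close>, would be a nonnegative combination of simple roots. Collecting the
  \<open>\<beta>\<close> terms gives a multiple of \<open>\<beta>\<close> equal to a combination
  \<open>R\<close> of the others: pairing with \<open>\<beta>\<close> shows the factor nonpositive,
  and pairing with \<open>direction\<close> then makes all coefficients of \<open>R\<close> zero. So
  \<open>\<alpha>\<close> is a multiple of \<open>\<beta>\<close>, and reducedness forces
  \<open>\<alpha> = \<beta>\<close>.\<close>

lemma simple_reflection_positive: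
  assumes \<beta>: "\<beta> \<in> \<Delta>" and \<alpha>: "\<alpha> \<in> P" "\<alpha> \<noteq> \<beta>"
  shows "root_reflection \<beta> \<alpha> \<in> P - {\<beta>}"
proof -
  have roots: "\<beta> \<in> P" "\<beta> \<in> \<Phi>" "\<alpha> \<in> \<Phi>" using \<beta> \<alpha> simple_positive positive_root by auto
  have "root_reflection \<beta> \<alpha> \<in> P"
  proof (rule ccontr)
    assume "\<not> ?thesis"
    then have neg: "- root_reflection \<beta> \<alpha> \<in> P"
      using positive_or_negative reflection_root roots by blast
    define k where "k = coroot \<beta> \<bullet> \<alpha>"
    obtain c where c: "\<And>\<delta>. 0 \<le> c \<delta>" "\<alpha> = (\<Sum>\<delta>\<in>\<Delta>. c \<delta> *\<^sub>R \<delta>)"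
      using positive_combination[OF \<alpha>(1)] by blast
    obtain d where d: "\<And>\<delta>. 0 \<le> d \<delta>" "- root_reflection \<beta> \<alpha> = (\<Sum>\<delta>\<in>\<Delta>. d \<delta> *\<^sub>R \<delta>)"
      using positive_combination[OF neg] by blast
    define e where "e \<delta> = c \<delta> + d \<delta>" for \<delta>
    have e: "0 \<le> e \<delta>" for \<delta> using c d by (simp add: e_def)
    define R where "R = (\<Sum>\<delta>\<in>\<Delta>-{\<beta>}. e \<delta> *\<^sub>R \<delta>)"
    have "k *\<^sub>R \<beta> = \<alpha> + (- root_reflection \<beta> \<alpha>)" by (simp add: root_reflection_def k_def)
    also have "\<dots> = (\<Sum>\<delta>\<in>\<Delta>. e \<delta> *\<^sub>R \<delta>)"
      unfolding d(2) by (subst c(2)) (simp add: e_def scaleR_add_left sum.distrib)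
    also have "\<dots> = e \<beta> *\<^sub>R \<beta> + R"
      unfolding R_def using \<beta> finite_simple_roots by (simp add: sum.remove)
    finally have eq: "(k - e \<beta>) *\<^sub>R \<beta> = R" by (simp add: algebra_simps)
    have "(k - e \<beta>) * (\<beta> \<bullet> \<beta>) = \<beta> \<bullet> R" by (simp flip: eq)
    also have "\<dots> \<le> 0"
      unfolding R_def inner_sum_right using simple_obtuse[OF \<beta>] e
      by (intro sum_nonpos) (auto intro!: mult_nonneg_nonpos)
    finally have 1: "k - e \<beta> \<le> 0"
      using nonzero[OF roots(2)] by (simp add: mult_le_0_iff) (metis inner_gt_zero_iff less_le_not_le)
    have terms: "0 \<le> e \<delta> * (direction \<bullet> \<delta>)" if "\<delta> \<in> \<Delta> - {\<beta>}" for \<delta>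
      using that e simple_positive positive_root(2) by (intro mult_nonneg_nonneg) (auto intro: less_imp_le)
    have "direction \<bullet> R = (k - e \<beta>) * (direction \<bullet> \<beta>)" by (simp flip: eq)
    then have "direction \<bullet> R \<le> 0"
      using 1 positive_root(2)[OF roots(1)] by (simp add: mult_nonpos_nonneg)
    then have "(\<Sum>\<delta>\<in>\<Delta>-{\<beta>}. e \<delta> * (direction \<bullet> \<delta>)) = 0"
      using terms unfolding R_def inner_sum_right inner_scaleR_right
      by (intro antisym sum_nonneg) auto
    then have "e \<delta> * (direction \<bullet> \<delta>) = 0" if "\<delta> \<in> \<Delta> - {\<beta>}" for \<delta>
      using terms that finite_simple_roots by (subst (asm) sum_nonneg_eq_0_iff) auto
    then have "e \<delta> = 0" if "\<delta> \<in> \<Delta> - {\<beta>}" for \<delta>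
      using that simple_positive positive_root(2) by fastforce
    then have "c \<delta> = 0" if "\<delta> \<in> \<Delta> - {\<beta>}" for \<delta>
      using that c(1)[of \<delta>] d(1)[of \<delta>] by (fastforce simp: e_def)
    then have "\<alpha> = c \<beta> *\<^sub>R \<beta>"
      using c(2) \<beta> finite_simple_roots by (simp add: sum.remove)
    then have "c \<beta> = 1 \<or> c \<beta> = - 1" using reduced[OF roots(2), of "c \<beta>"] roots(3) by simp
    then show False using \<open>\<alpha> = c \<beta> *\<^sub>R \<beta>\<close> \<alpha> c(1)[of \<beta>] by auto
  qed
  moreover have "root_reflection \<beta> \<alpha> \<noteq> \<beta>"
  proof
    assume "root_reflection \<beta> \<alpha> = \<beta>"
    then have "\<alpha> = - \<beta>" using root_reflection_involution[of \<beta> \<alpha>] root_reflection_self[OF nonzero[OF roots(2)]] by simp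
    then show False using \<alpha> roots not_positive_uminus by auto
  qed
  ultimately show ?thesis by simp
qed

text \<open>The simple reflection permutes the positive roots other than \<open>\<beta>\<close>, so
  the coroot of \<open>\<beta>\<close> is orthogonal to their sum.\<close>

lemma coroot_half_sum:
  assumes \<beta>: "\<beta> \<in> \<Delta>"
  shows "coroot \<beta> \<bullet> (2 *\<^sub>R half_sum P) = 2"
proof -
  have roots: "\<beta> \<in> P" "\<beta> \<noteq> 0" using \<beta> simple_positive positive_root nonzero by auto
  define T where "T = (\<Sum>\<alpha>\<in>P - {\<beta>}. \<alpha>)"
  have sum: "2 *\<^sub>R half_sum P = \<beta> + T"
    unfolding half_sum_def T_def using roots finite_positive by (simp add: sum.remove)
  have bij: "bij_betw (root_reflection \<beta>) (P - {\<beta>}) (P - {\<beta>})"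
    by (rule bij_betw_byWitness[where f' = "root_reflection \<beta>"])
      (use simple_reflection_positive[OF \<beta>] in auto)
  have "root_reflection \<beta> T = T"
    unfolding T_def linear_sum[OF linear_root_reflection]
    by (rule sum.reindex_bij_betw[OF bij])
  then have "(coroot \<beta> \<bullet> T) *\<^sub>R \<beta> = 0" by (simp add: root_reflection_def)
  then have "coroot \<beta> \<bullet> T = 0" using roots by simp
  moreover have "coroot \<beta> \<bullet> \<beta> = 2" using roots by (simp add: coroot_inner)
  ultimately show ?thesis unfolding sum by (simp add: inner_add_right)
qed

text \<open>Reflecting in a simple root with positive inner product keeps a non-simple root positive
  and lowers its height.\<close>

lemma positive_root_conjugate_simple:
  assumes "\<alpha> \<in> P"
  obtains w \<beta> where "w \<in> carrier (weyl_group \<Phi>)" "\<beta> \<in> \<Delta>" "\<alpha> = w \<beta>"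
proof -
  from assms have "\<exists>w\<in>carrier (weyl_group \<Phi>). \<exists>\<beta>\<in>\<Delta>. \<alpha> = w \<beta>"
  proof (induction rule: positive_induct)
    case (less \<alpha>)
    show ?case
    proof (cases "\<alpha> \<in> \<Delta>")
      case True
      then show ?thesis
        using id_weyl_group by (intro bexI[of _ id] bexI[of _ \<alpha>]) auto
    next
      case False
      obtain c where c: "\<And>\<delta>. 0 \<le> c \<delta>" "\<alpha> = (\<Sum>\<delta>\<in>\<Delta>. c \<delta> *\<^sub>R \<delta>)"
        using positive_combination[OF less.hyps] by blast
      \<comment> \<open>Otherwise \<open>\<alpha> \<bullet> \<alpha>\<close>, expanded in simple
        roots on one side, would be nonpositive.\<close>
      have "\<exists>\<delta>\<in>\<Delta>. 0 < \<delta> \<bullet> \<alpha>"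
      proof (rule ccontr)
        assume "\<not> ?thesis"
        then have "(\<Sum>\<delta>\<in>\<Delta>. c \<delta> * (\<delta> \<bullet> \<alpha>)) \<le> 0"
          using c by (intro sum_nonpos mult_nonneg_nonpos) auto
        also have "(\<Sum>\<delta>\<in>\<Delta>. c \<delta> * (\<delta> \<bullet> \<alpha>)) = \<alpha> \<bullet> \<alpha>"
          by (subst (2) c(2)) (simp add: inner_sum_left)
        finally show False using nonzero[OF positive_root(1)[OF less.hyps]] by (simp flip: not_less)
      qed
      then obtain \<delta> where \<delta>: "\<delta> \<in> \<Delta>" "0 < \<delta> \<bullet> \<alpha>" by blast
      have \<delta>r: "\<delta> \<in> \<Phi>" "0 < direction \<bullet> \<delta>" "\<delta> \<noteq> 0"
        using \<delta> simple_positive positive_root nonzero by auto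
      have "root_reflection \<delta> \<alpha> \<in> P"
        using simple_reflection_positive[OF \<delta>(1) less.hyps] False \<delta>(1) by auto
      moreover have "direction \<bullet> root_reflection \<delta> \<alpha> < direction \<bullet> \<alpha>"
        using \<delta> \<delta>r by (simp add: root_reflection_def inner_diff_right coroot_inner)
      ultimately obtain w \<beta> where w: "w \<in> carrier (weyl_group \<Phi>)" "\<beta> \<in> \<Delta>" "root_reflection \<delta> \<alpha> = w \<beta>"
        using less.IH by blast
      have "\<alpha> = (root_reflection \<delta> \<circ> w) \<beta>"
        using root_reflection_involution[of \<delta> \<alpha>] w(3) by simp
      moreover have "root_reflection \<delta> \<circ> w \<in> carrier (weyl_group \<Phi>)"
        using monoid.m_closed[OF group.is_monoid[OF group_weyl_group] root_reflection_weyl_group[OF \<delta>r(1)] w(1)]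
          weyl_group_mult[OF root_reflection_weyl_group[OF \<delta>r(1)] w(1)] by simp
      ultimately show ?thesis using w by blast
    qed
  qed
  then show ?thesis using that by blast
qed

end

lemma word_length_iso:
  assumes "group G" "group H" "\<phi> \<in> iso G H" "A \<subseteq> carrier G" "x \<in> carrier G"
  shows "word_length H (\<phi> ` A) (\<phi> x) = word_length G A x"
proof -
  interpret group_hom G H \<phi>
    using assms(1-3) by (simp add: group_hom_def group_hom_axioms_def iso_def)
  have inj: "inj_on \<phi> (carrier G)" using assms(3) by (simp add: iso_def bij_betw_def)
  have prod: "word_prod H (map \<phi> ws) = \<phi> (word_prod G ws)" if "ws \<in> lists A" for ws
    using that assms(4) by (induction ws) (auto simp: subset_iff in_lists_conv_set)
  have closed: "word_prod G ws \<in> carrier G" if "ws \<in> lists A" for ws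
    using that assms(4) G.word_prod_closed lists_mono by blast
  have "(\<exists>us\<in>lists (\<phi> ` A). length us = n \<and> word_prod H us = \<phi> x)
      \<longleftrightarrow> (\<exists>ws\<in>lists A. length ws = n \<and> word_prod G ws = x)" for n
    unfolding lists_image using inj_onD[OF inj _ closed assms(5)] by (auto simp: prod)
  then show ?thesis by (simp add: word_length_def)
qed

section \<open>The Coxeter group identified with a Weyl group\<close>

locale weyl_coxeter_system = finite_coxeter_system G S + positive_system \<Phi> P
  for G :: "('a, 'b) monoid_scheme" (structure) and S :: "'a set"
    and \<Phi> P :: "'v::euclidean_space set" +
  fixes \<phi> :: "'a \<Rightarrow> 'v \<Rightarrow> 'v"
  assumes iso: "\<phi> \<in> iso G (weyl_group \<Phi>)" and simple_image: "\<phi> ` S = simple_reflections P"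
begin

lemma iso_closed: "x \<in> carrier G \<Longrightarrow> \<phi> x \<in> carrier (weyl_group \<Phi>)"
  using iso by (auto simp: iso_def hom_def)

lemma iso_weyl_group_mult:
  "x \<in> carrier G \<Longrightarrow> y \<in> carrier G \<Longrightarrow> \<phi> (x \<otimes> y) = \<phi> x \<otimes>\<^bsub>weyl_group \<Phi>\<^esub> \<phi> y"
  using iso by (auto simp: iso_def hom_def)

lemma iso_mult: "x \<in> carrier G \<Longrightarrow> y \<in> carrier G \<Longrightarrow> \<phi> (x \<otimes> y) = \<phi> x \<circ> \<phi> y"
  using iso_weyl_group_mult weyl_group_mult[OF iso_closed iso_closed] by metis

lemma iso_one: "\<phi> \<one> = id"
  using hom_one[of \<phi> G "weyl_group \<Phi>"] iso group_weyl_group[of \<Phi>] weyl_group_one[of \<Phi>] is_group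
  by (simp add: iso_def)

lemma iso_inverse: "x \<in> carrier G \<Longrightarrow> \<phi> x (\<phi> (inv x) v) = v"
  using iso_mult[of x "inv x"] iso_one by (simp add: fun_eq_iff)

lemma len_iso: "x \<in> carrier G \<Longrightarrow> cox_length (weyl_group \<Phi>) (simple_reflections P) (\<phi> x) = len x"
  using word_length_iso[OF is_group group_weyl_group iso generators_closed] simple_image by simp

lemma iso_conj:
  assumes "x \<in> carrier G" "s \<in> S" "\<phi> s = root_reflection \<beta>"
  shows "\<phi> (x \<otimes> s \<otimes> inv x) = root_reflection (\<phi> x \<beta>)"
proof
  fix v
  have "\<phi> (x \<otimes> s \<otimes> inv x) v = \<phi> x (root_reflection \<beta> (\<phi> (inv x) v))"
    using assms by (simp add: iso_mult)
  also have "\<dots> = root_reflection (\<phi> x \<beta>) (\<phi> x (\<phi> (inv x) v))"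
    using weyl_group_isometry[OF iso_closed[OF assms(1)]]
    by (intro root_reflection_isometry_image[symmetric]) auto
  finally show "\<phi> (x \<otimes> s \<otimes> inv x) v = root_reflection (\<phi> x \<beta>) v"
    using assms by (simp add: iso_inverse)
qed

text \<open>A conjugate of a simple reflection is the reflection in the image of the simple root; a
  negative image may be replaced by its opposite.\<close>

lemma reflection_root_reflection:
  assumes "t \<in> reflections G S"
  obtains \<alpha> where "\<alpha> \<in> P" "\<phi> t = root_reflection \<alpha>"
proof -
  obtain x s where xs: "x \<in> carrier G" "s \<in> S" "t = x \<otimes> s \<otimes> inv x"
    using assms by (auto simp: reflections_def)
  have "\<phi> s \<in> simple_reflections P" using simple_image xs(2) by blast
  then obtain \<beta> where \<beta>: "\<beta> \<in> \<Delta>" "\<phi> s = root_reflection \<beta>"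
    by (auto simp: simple_reflections_def)
  have t: "\<phi> t = root_reflection (\<phi> x \<beta>)" using iso_conj[OF xs(1,2) \<beta>(2)] xs(3) by simp
  have "\<phi> x \<beta> \<in> \<Phi>"
    using weyl_group_isometry[OF iso_closed[OF xs(1)]] positive_root(1)[OF simple_positive[OF \<beta>(1)]] by blast
  then consider "\<phi> x \<beta> \<in> P" | "- \<phi> x \<beta> \<in> P" using positive_or_negative by blast
  then show ?thesis
    using that t root_reflection_uminus[of "\<phi> x \<beta>"] by cases auto
qed

text \<open>Every positive root is an image of a simple root. This turns the labels of quantum edges
  into reflections of \<open>G\<close>.\<close>

lemma root_reflection_reflection:
  assumes "\<alpha> \<in> P"
  obtains t where "t \<in> reflections G S" "\<phi> t = root_reflection \<alpha>"
proof -
  obtain w \<beta> where w: "w \<in> carrier (weyl_group \<Phi>)" "\<beta> \<in> \<Delta>" "\<alpha> = w \<beta>"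
    using positive_root_conjugate_simple[OF assms] by blast
  have "w \<in> \<phi> ` carrier G" using iso w(1) by (simp add: iso_def bij_betw_def)
  then obtain x where x: "x \<in> carrier G" "\<phi> x = w" by blast
  have "root_reflection \<beta> \<in> \<phi> ` S" using simple_image w(2) by (auto simp: simple_reflections_def)
  then obtain s where "root_reflection \<beta> = \<phi> s" "s \<in> S" by (rule imageE)
  then have s: "s \<in> S" "\<phi> s = root_reflection \<beta>" by simp_all
  have "\<phi> (x \<otimes> s \<otimes> inv x) = root_reflection \<alpha>" using iso_conj[OF x(1) s] x w by simp
  moreover have "x \<otimes> s \<otimes> inv x \<in> reflections G S" using x s by (auto simp: reflections_def)
  ultimately show ?thesis using that by blast
qed

section \<open>Edges and paths of the quantum Bruhat graph\<close>

lemma quantum_edge_right_cover: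
  assumes "right_cover u v"
  shows "quantum_edge \<Phi> P (\<phi> u) (\<phi> v)"
proof -
  obtain t where t: "u \<in> carrier G" "t \<in> reflections G S" "v = u \<otimes> t" "len v = len u + 1"
    using assms by (auto simp: right_cover_def)
  obtain \<alpha> where \<alpha>: "\<alpha> \<in> P" "\<phi> t = root_reflection \<alpha>"
    using reflection_root_reflection[OF t(2)] by blast
  have tc: "t \<in> carrier G" using t reflections_closed by blast
  have "\<phi> v = \<phi> u \<otimes>\<^bsub>weyl_group \<Phi>\<^esub> root_reflection \<alpha>"
    using iso_weyl_group_mult[OF t(1) tc] t(3) \<alpha>(2) by simp
  moreover have "cox_length (weyl_group \<Phi>) (simple_reflections P) (\<phi> v)
      = cox_length (weyl_group \<Phi>) (simple_reflections P) (\<phi> u) + 1"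
    using t tc len_iso by simp
  ultimately show ?thesis
    unfolding quantum_edge_def Let_def using \<alpha>(1) iso_closed[OF t(1)]
    by (intro conjI bexI[of _ \<alpha>]) simp_all
qed

text \<open>An ascent is an upward edge. A descent is a downward edge because the pairing of a
  simple coroot with the sum of the positive roots is 2, and \<open>- 2 + 1 = - 1\<close>.\<close>

lemma quantum_edge_simple:
  assumes "x \<in> carrier G" "s \<in> S"
  shows "quantum_edge \<Phi> P (\<phi> x) (\<phi> (x \<otimes> s))"
proof -
  have "\<phi> s \<in> simple_reflections P" using simple_image assms(2) by blast
  then obtain \<beta> where \<beta>: "\<beta> \<in> \<Delta>" "\<phi> s = root_reflection \<beta>"
    by (auto simp: simple_reflections_def)
  have "\<phi> (x \<otimes> s) = \<phi> x \<otimes>\<^bsub>weyl_group \<Phi>\<^esub> root_reflection \<beta>"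
    using iso_weyl_group_mult[of x s] assms \<beta>(2) by simp
  moreover have "cox_length (weyl_group \<Phi>) (simple_reflections P) (\<phi> (x \<otimes> s)) = len (x \<otimes> s)"
    "cox_length (weyl_group \<Phi>) (simple_reflections P) (\<phi> x) = len x"
    using len_iso assms by simp_all
  ultimately show ?thesis
    unfolding quantum_edge_def Let_def coroot_half_sum[OF \<beta>(1)]
    using iso_closed[OF assms(1)] simple_positive[OF \<beta>(1)] coroot_half_sum[OF \<beta>(1)]
      len_mult_simple[OF assms]
    by (intro conjI bexI[of _ \<beta>]) (simp_all only: of_nat_add of_nat_1, auto)
qed

text \<open>Simple reflections give edges in both directions, so the graph is connected and the
  \<open>LEAST\<close> in \<open>quantum_dist\<close> is attained.\<close>

lemma ex_quantum_path:
  assumes "x \<in> carrier G" "y \<in> carrier G"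
  shows "\<exists>n. (quantum_edge \<Phi> P ^^ n) (\<phi> x) (\<phi> y)"
proof -
  have path: "\<exists>n. (quantum_edge \<Phi> P ^^ n) (\<phi> x) (\<phi> (x \<otimes> z))" if "z \<in> generate G S" for z
    using subset_refl that
  proof (induction rule: generate_induct)
    case one
    then show ?case using assms by (intro exI[of _ 0]) simp
  next
    case (mult z s)
    then obtain n where n: "(quantum_edge \<Phi> P ^^ n) (\<phi> x) (\<phi> (x \<otimes> z))" by blast
    have z: "z \<in> carrier G" using mult generates by simp
    have "quantum_edge \<Phi> P (\<phi> (x \<otimes> z)) (\<phi> (x \<otimes> z \<otimes> s))"
      using z mult assms by (intro quantum_edge_simple) auto
    then have "(quantum_edge \<Phi> P ^^ Suc n) (\<phi> x) (\<phi> (x \<otimes> z \<otimes> s))" using n by (rule relpowp_Suc_I[rotated])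
    then show ?case using z mult assms by (metis m_assoc simple_closed)
  qed
  have "x \<otimes> (inv x \<otimes> y) = y" using assms by (simp flip: m_assoc)
  then show ?thesis using path[of "inv x \<otimes> y"] assms generates by simp
qed

text \<open>Only the reflection on each edge is retained, not its direction; this is all that the
  lower bound requires.\<close>

lemma quantum_path_reflection_word:
  assumes "(quantum_edge \<Phi> P ^^ n) (\<phi> x) w" "x \<in> carrier G"
  shows "\<exists>ts\<in>lists (reflections G S). length ts = n \<and> w = \<phi> (x \<otimes> word_prod G ts)"
  using assms(1)
proof (induction n arbitrary: w)
  case 0
  then show ?case using assms(2) by (intro bexI[of _ "[]"]) auto
next
  case (Suc n)
  then obtain v where "(quantum_edge \<Phi> P ^^ n) (\<phi> x) v" and edge: "quantum_edge \<Phi> P v w" by auto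
  then obtain ts where ts: "ts \<in> lists (reflections G S)" "length ts = n" "v = \<phi> (x \<otimes> word_prod G ts)"
    using Suc.IH by blast
  obtain \<alpha> where \<alpha>: "\<alpha> \<in> P" "w = v \<otimes>\<^bsub>weyl_group \<Phi>\<^esub> root_reflection \<alpha>"
    using edge by (auto simp: quantum_edge_def)
  obtain t where t: "t \<in> reflections G S" "\<phi> t = root_reflection \<alpha>"
    using root_reflection_reflection[OF \<alpha>(1)] by blast
  have c: "t \<in> carrier G" "ts \<in> lists (carrier G)"
    using t ts reflections_closed reflection_words_closed by auto
  have "w = \<phi> (x \<otimes> word_prod G ts \<otimes> t)"
    unfolding \<alpha>(2) ts(3) t(2)[symmetric]
    using c assms(2) iso_weyl_group_mult[of "x \<otimes> word_prod G ts" t] by simp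
  also have "x \<otimes> word_prod G ts \<otimes> t = x \<otimes> word_prod G (ts @ [t])"
    using c assms(2) by (simp add: word_prod_append m_assoc)
  finally show ?case using ts t by (intro bexI[of _ "ts @ [t]"]) auto
qed

end

theorem theorem5p1:
  fixes G :: "('a, 'b) monoid_scheme" and S :: "'a set" and \<sigma> :: "'a \<Rightarrow> 'a" and w\<^sub>0 :: 'a
  assumes "coxeter_system G S" and "finite (carrier G)"
    and "longest_element G S w\<^sub>0"
    and "length_preserving_aut G S \<sigma>"
  shows "int (cox_length G S w\<^sub>0)
           - 2 * int (Max {cox_length G S x | x. x \<in> carrier G \<and> bruhat_le G S x (\<sigma> x \<otimes>\<^bsub>G\<^esub> w\<^sub>0)})
         = int (set_refl_length G S (twisted_class G \<sigma> w\<^sub>0))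
       \<and> (\<forall>(\<Phi> :: 'v::euclidean_space set) P \<phi>. weyl_identification G S \<Phi> P \<phi> \<longrightarrow>
            set_refl_length G S (twisted_class G \<sigma> w\<^sub>0)
            = Min {quantum_dist \<Phi> P (\<phi> x) (\<phi> (\<sigma> x \<otimes>\<^bsub>G\<^esub> w\<^sub>0)) | x. x \<in> carrier G})"
proof -
  interpret finite_coxeter_system G S
    using assms(1,2) by (simp add: finite_coxeter_system_def finite_coxeter_system_axioms_def)
  have wc: "w\<^sub>0 \<in> carrier G" using assms(3) by (simp add: longest_element_def)
  have closed: "\<sigma> x \<otimes>\<^bsub>G\<^esub> w\<^sub>0 \<in> carrier G" if "x \<in> carrier G" for x
    using assms(4) wc that by (auto simp: length_preserving_aut_def iso_def hom_def)
  obtain x k where x: "x \<in> carrier G" and chain: "(right_cover ^^ k) x (\<sigma> x \<otimes>\<^bsub>G\<^esub> w\<^sub>0)"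
    and N: "len w\<^sub>0 = 2 * len x + k"
    and k: "set_refl_length G S (twisted_class G \<sigma> w\<^sub>0) = k"
    and lower: "\<And>y ts. y \<in> carrier G \<Longrightarrow> ts \<in> lists (reflections G S) \<Longrightarrow>
      \<sigma> y \<otimes>\<^bsub>G\<^esub> w\<^sub>0 = y \<otimes>\<^bsub>G\<^esub> word_prod G ts \<Longrightarrow> k \<le> length ts"
    and max: "Max {len x | x. x \<in> carrier G \<and> bruhat_le G S x (\<sigma> x \<otimes>\<^bsub>G\<^esub> w\<^sub>0)} = len x"
    using reflection_length_longest_class[OF assms(3,4)] by blast
  have "k = Min {quantum_dist \<Phi> P (\<phi> x) (\<phi> (\<sigma> x \<otimes>\<^bsub>G\<^esub> w\<^sub>0)) | x. x \<in> carrier G}"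
    if "weyl_identification G S \<Phi> P \<phi>" for \<Phi> P :: "'v set" and \<phi>
  proof -
    interpret weyl_coxeter_system G S \<Phi> P \<phi>
      using that by unfold_locales (auto simp: weyl_identification_def)
    have ge: "k \<le> quantum_dist \<Phi> P (\<phi> y) (\<phi> (\<sigma> y \<otimes>\<^bsub>G\<^esub> w\<^sub>0))" if y: "y \<in> carrier G" for y
    proof -
      have "(quantum_edge \<Phi> P ^^ quantum_dist \<Phi> P (\<phi> y) (\<phi> (\<sigma> y \<otimes>\<^bsub>G\<^esub> w\<^sub>0))) (\<phi> y) (\<phi> (\<sigma> y \<otimes>\<^bsub>G\<^esub> w\<^sub>0))"
        unfolding quantum_dist_def by (rule LeastI_ex[OF ex_quantum_path[OF y closed[OF y]]])
      then obtain ts where ts: "ts \<in> lists (reflections G S)"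
          "length ts = quantum_dist \<Phi> P (\<phi> y) (\<phi> (\<sigma> y \<otimes>\<^bsub>G\<^esub> w\<^sub>0))"
          "\<phi> (\<sigma> y \<otimes>\<^bsub>G\<^esub> w\<^sub>0) = \<phi> (y \<otimes>\<^bsub>G\<^esub> word_prod G ts)"
        using quantum_path_reflection_word[OF _ y] by blast
      have inj: "inj_on \<phi> (carrier G)" using iso by (simp add: iso_def bij_betw_def)
      have "\<sigma> y \<otimes>\<^bsub>G\<^esub> w\<^sub>0 = y \<otimes>\<^bsub>G\<^esub> word_prod G ts"
        using inj_onD[OF inj ts(3) closed[OF y]] y word_prod_closed[OF reflection_words_closed[OF ts(1)]]
        by simp
      then show ?thesis using lower[OF y ts(1)] ts(2) by simp
    qed
    \<comment> \<open>The saturated chain is a path of upward edges and attains the lower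
      bound.\<close>
    have "(quantum_edge \<Phi> P ^^ k) (\<phi> x) (\<phi> (\<sigma> x \<otimes>\<^bsub>G\<^esub> w\<^sub>0))"
      by (rule relpowp_map[where f = \<phi> and R = right_cover, OF chain]) (rule quantum_edge_right_cover)
    then have "quantum_dist \<Phi> P (\<phi> x) (\<phi> (\<sigma> x \<otimes>\<^bsub>G\<^esub> w\<^sub>0)) \<le> k"
      unfolding quantum_dist_def by (rule Least_le)
    then have "quantum_dist \<Phi> P (\<phi> x) (\<phi> (\<sigma> x \<otimes>\<^bsub>G\<^esub> w\<^sub>0)) = k" using ge[OF x] by simp
    then show ?thesis
      using ge x finite_carrier by (intro Min_eqI[symmetric]) auto
  qed
  then show ?thesis using N k max by simp
qed

end
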